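(* Let $\tau>0$, let $G_1$ and $G_2$ be non-solvable groups, and let $G=G_1\times G_2$. If $\phi$ is a $C^{1,\tau}$-action of $G$ on $S^1$, then $G$ admits a disjointly supported pair (with respect to $\phi$).
   Context: A $C^{1,\tau}$-action of a group $G$ on $S^1$ is a homomorphism $\phi: G\to\operatorname{Diff}_+^{1,\tau}(S^1)$, where $\operatorname{Diff}_+^{1,\tau}(S^1)$ is the group of orientation preserving $C^1$ diffeomorphisms of $S^1$ whose first derivatives are $\tau$-Hölder continuous. For a group $G$ acting on a space $X$, the (open) support of $g\in G$ is $\operatorname{supp} g = X\setminus \operatorname{Fix} g$, where $\operatorname{Fix} g$ is the set of points of $X$ fixed by $g$. The group $G$ (with the given action) admits a disjointly supported pair if there exist nontrivial elements $g,h\in G$ with $\operatorname{supp} g\cap\operatorname{supp} h=\varnothing$. *)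

theory Defs
  imports
    "HOL-Analysis.Analysis"
    "HOL-Algebra.Group_Action"
    "HOL-Algebra.Solvable_Groups"
begin

text \<open>
  The circle is the unit circle in the complex plane. The curve \<open>s \<mapsto> z * cis s\<close> passes through
  \<open>z\<close> with unit speed, counterclockwise, and \<open>\<i> * f z\<close> is the counterclockwise unit tangent vector
  at \<open>f z\<close>. The derivative of a circle map at \<open>z\<close> is thus the real number \<open>D\<close> by which its tangent
  map multiplies the unit tangent vector; equivalently it is the derivative of a lift
  \<open>\<real> \<rightarrow> \<real>\<close> of \<open>f\<close> at any point over \<open>z\<close>.
\<close>

abbreviation circle :: "complex set"
  where "circle \<equiv> sphere 0 1"

definition has_circle_deriv :: "(complex \<Rightarrow> complex) \<Rightarrow> real \<Rightarrow> complex \<Rightarrow> bool"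
  where "has_circle_deriv f D z \<longleftrightarrow>
    ((\<lambda>s. f (z * cis s)) has_vector_derivative (D *\<^sub>R (\<i> * f z))) (at 0)"

definition circle_deriv :: "(complex \<Rightarrow> complex) \<Rightarrow> complex \<Rightarrow> real"
  where "circle_deriv f z = (THE D. has_circle_deriv f D z)"

lemma circle_deriv_eqI:
  assumes "has_circle_deriv f D z" and "f z \<in> circle"
  shows "circle_deriv f z = D"
  unfolding circle_deriv_def
proof (rule the_equality)
  fix D' assume "has_circle_deriv f D' z"
  then have "D' *\<^sub>R (\<i> * f z) = D *\<^sub>R (\<i> * f z)"
    using assms(1) unfolding has_circle_deriv_def by (rule vector_derivative_unique_at)
  moreover have "f z \<noteq> 0"
    using assms(2) by auto
  ultimately show "D' = D"
    by simp
qed (fact assms(1))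

definition C1_circle_map :: "(complex \<Rightarrow> complex) \<Rightarrow> bool"
  where "C1_circle_map f \<longleftrightarrow> f ` circle \<subseteq> circle \<and>
    (\<forall>z\<in>circle. \<exists>D. has_circle_deriv f D z) \<and> continuous_on circle (circle_deriv f)"

definition C1_circle_diffeo :: "(complex \<Rightarrow> complex) \<Rightarrow> bool"
  where "C1_circle_diffeo f \<longleftrightarrow>
    bij_betw f circle circle \<and> C1_circle_map f \<and> C1_circle_map (inv_into circle f)"

definition orientation_preserving :: "(complex \<Rightarrow> complex) \<Rightarrow> bool"
  where "orientation_preserving f \<longleftrightarrow> (\<forall>z\<in>circle. circle_deriv f z > 0)"

text \<open>
  The chordal distance \<open>dist\<close> and the arc length distance on the circle are bi-Lipschitz equivalent,
  so they give the same Hoelder condition.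
\<close>

definition holder_on :: "real \<Rightarrow> complex set \<Rightarrow> (complex \<Rightarrow> real) \<Rightarrow> bool"
  where "holder_on \<tau> S u \<longleftrightarrow>
    (\<exists>C. \<forall>x\<in>S. \<forall>y\<in>S. dist (u x) (u y) \<le> C * dist x y powr \<tau>)"

text \<open>
  As in \<^const>\<open>BijGroup\<close>, membership in \<^const>\<open>Bij\<close> makes the maps extensional, so that equality of
  group elements is equality of maps on the circle.
\<close>

definition Diff_circle :: "real \<Rightarrow> (complex \<Rightarrow> complex) monoid"
  where "Diff_circle \<tau> = (BijGroup circle)
    \<lparr>carrier := {f \<in> Bij circle. C1_circle_diffeo f \<and> orientation_preserving f \<and>
                   holder_on \<tau> circle (circle_deriv f)}\<rparr>"

definition C1_holder_circle_action ::
  "real \<Rightarrow> ('a, 'm) monoid_scheme \<Rightarrow> ('a \<Rightarrow> complex \<Rightarrow> complex) \<Rightarrow> bool"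
  where "C1_holder_circle_action \<tau> G \<phi> \<longleftrightarrow> \<phi> \<in> hom G (Diff_circle \<tau>)"

definition open_support :: "'b set \<Rightarrow> ('a \<Rightarrow> 'b \<Rightarrow> 'b) \<Rightarrow> 'a \<Rightarrow> 'b set"
  where "open_support X \<phi> g = X - invariants X \<phi> g"

text \<open>
  Nontrivial means different from the identity of \<open>G\<close>. The action need not be faithful, so a
  nontrivial element may have empty support.
\<close>

definition admits_disjointly_supported_pair ::
  "('a, 'm) monoid_scheme \<Rightarrow> 'b set \<Rightarrow> ('a \<Rightarrow> 'b \<Rightarrow> 'b) \<Rightarrow> bool"
  where "admits_disjointly_supported_pair G X \<phi> \<longleftrightarrow>
    (\<exists>g\<in>carrier G. \<exists>h\<in>carrier G. g \<noteq> \<one>\<^bsub>G\<^esub> \<and> h \<noteq> \<one>\<^bsub>G\<^esub> \<and>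
       open_support X \<phi> g \<inter> open_support X \<phi> h = {})"

end

theory Submission
  imports Defs
begin

text \<open>
  If no two nontrivial elements have disjoint supports, the action is faithful. The lifts to the
  line of the two factors form commuting groups \<open>S\<close> and \<open>K\<close>. Let \<open>h\<close> and \<open>k\<close> be nontrivial elements
  with fixed points deep in their derived series (they exist by Hoelder's theorem, since the derived
  subgroups are not abelian), both moving a point \<open>x\<close>.

  The only analytic input is an argument in the style of Kopell: a diffeomorphism commuting with maps
  of bounded distortion that shrink a component of its support cannot be nontrivial there. It is
  applied in two ways. Words in a ping-pong pair have, on average, summable \<open>\<tau>\<close>-th powers of lengths,
  hence bounded distortion. And if \<open>k\<close> displaces an interval in which \<open>S\<close> produces \<open>Q ^ D\<close> disjoint
  images of \<open>I\<close> by words of length \<open>D * Q\<close>, then \<open>I\<close> is so short compared with its surroundings that the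
  translates \<open>(k ^^ n) ` I\<close> have summable \<open>\<tau>\<close>-th powers of lengths as soon as \<open>\<tau> * (1 + \<tau> * D) \<ge> 1\<close>.

  The first consequence is that elements of \<open>S\<close> whose supports cross near a point force \<open>K\<close> to be
  trivial there; so near \<open>x\<close> there are no crossings, and the components at \<open>x\<close> of elements along the
  derived series form chains \<open>A 0 \<supset> A 1 \<supset> \<dots>\<close> for \<open>S\<close> and \<open>B 0 \<supset> B 1 \<supset> \<dots>\<close> for \<open>K\<close>. Either \<open>A 2\<close> is
  displaced inside \<open>B 1\<close>, or \<open>B 1\<close> is displaced inside \<open>A 1\<close>; a displaced chain of length \<open>D\<close>
  provides the polynomially many images, a contradiction.
\<close>

section \<open>Supports of homeomorphisms of the line\<close>

text \<open>Kopell's classical lemma controls the distortion of iterates by the total length of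
  disjoint intervals, which suits derivatives of bounded variation. For a
  \<open>\<tau>\<close>-Hoelder derivative the relevant quantity is the sum of the
  \<open>\<tau>\<close>-th powers of the lengths, and disjointness alone does not bound it. Many
  commuting images close the gap: if a window of length \<open>L\<close> contains
  \<open>Q ^ D\<close> disjoint images of an interval, all of comparable length, with
  \<open>Q\<close> about \<open>L powr (- \<tau>)\<close>, then this length is at most of order
  \<open>L powr (1 + \<tau> * D)\<close>. Its \<open>\<tau>\<close>-th power is at most of order
  \<open>L\<close> once \<open>\<tau> * (1 + \<tau> * D) \<ge> 1\<close>, and the windows themselves
  are summable. Thus \<open>\<tau>\<close> alone dictates how deep in the derived series the
  elements must lie, and non-solvability supplies every depth. Hoelder's theorem needs an adjustment
  as well, since the stabilizer of a component need not act freely on it. The absence of crossings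
  makes its elements with a fixed point closed under composition, and the theorem survives modulo
  such elements.\<close>

text \<open>
  The third condition holds for lifts of circle maps, whose fixed point sets are periodic. It makes
  every component of the support either bounded or the whole line.
\<close>

definition line_diffeo :: "real \<Rightarrow> (real \<Rightarrow> real) \<Rightarrow> bool"
  where "line_diffeo \<tau> f \<longleftrightarrow> strict_mono f \<and> surj f \<and>
    ((\<exists>t. f t = t) \<longrightarrow> (\<forall>x. (\<exists>t<x. f t = t) \<and> (\<exists>t>x. f t = t))) \<and>
    (\<exists>C f'. \<forall>s. (f has_real_derivative f' s) (at s) \<and> f' s > 0 \<and>
       (\<forall>t. \<bar>ln (f' s) - ln (f' t)\<bar> \<le> C * \<bar>s - t\<bar> powr \<tau>))"

definition support_component :: "(real \<Rightarrow> real) \<Rightarrow> real set \<Rightarrow> bool"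
  where "support_component f J \<longleftrightarrow> (\<forall>t\<in>J. f t \<noteq> t) \<and>
    (J = UNIV \<or> (\<exists>a b. a < b \<and> J = {a<..<b} \<and> f a = a \<and> f b = b))"

lemma line_diffeoD:
  assumes "line_diffeo \<tau> f"
  shows "strict_mono f" "surj f" "inj f" "bij f" "continuous_on A f" "isCont f x"
proof -
  show m: "strict_mono f" and s: "surj f"
    using assms unfolding line_diffeo_def by auto
  then show "inj f" by (simp add: strict_mono_imp_inj_on)
  then show "bij f" using s by (simp add: bij_def)
  obtain f' where "\<And>s. (f has_real_derivative f' s) (at s)"
    using assms unfolding line_diffeo_def by blast
  then have *: "isCont f x" for x using DERIV_isCont by blast
  then show "isCont f x" "continuous_on A f" by (auto intro: continuous_at_imp_continuous_on)
qed

lemma strict_mono_surj_image_interval: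
  fixes g :: "real \<Rightarrow> real"
  assumes "strict_mono g" "surj g"
  shows "g ` {a<..<b} = {g a<..<g b}" "g ` {a..b} = {g a..g b}"
proof -
  have *: "\<exists>x. y = g x" for y using assms(2) by (metis surjD)
  show "g ` {a<..<b} = {g a<..<g b}"
  proof (intro subset_antisym subsetI)
    fix y assume "y \<in> {g a<..<g b}"
    then show "y \<in> g ` {a<..<b}" using *[of y] assms(1)
      by (auto simp: strict_mono_less)
  qed (use assms(1) in \<open>auto simp: strict_mono_less\<close>)
  show "g ` {a..b} = {g a..g b}"
  proof (intro subset_antisym subsetI)
    fix y assume "y \<in> {g a..g b}"
    then show "y \<in> g ` {a..b}" using *[of y] assms(1)
      by (auto simp: strict_mono_less_eq)
  qed (use assms(1) in \<open>auto simp: strict_mono_less_eq\<close>)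
qed

lemma support_component_interval: "support_component f J \<Longrightarrow> is_interval J"
  unfolding support_component_def by (auto simp: is_interval_convex_1 )

lemma IVT_fixed_point:
  fixes f :: "real \<Rightarrow> real"
  assumes "is_interval J" "continuous_on J f" "s \<in> J" "t \<in> J" "f s \<le> s" "f t \<ge> t"
  shows "\<exists>x\<in>J. f x = x"
proof -
  have "connected ((\<lambda>x. f x - x) ` J)"
    using assms by (intro connected_continuous_image continuous_intros)
      (auto simp: is_interval_connected)
  moreover have "f s - s \<in> (\<lambda>x. f x - x) ` J" "f t - t \<in> (\<lambda>x. f x - x) ` J"
    using assms by auto
  ultimately have "0 \<in> (\<lambda>x. f x - x) ` J"
    using assms(5,6) unfolding connected_iff_interval by (meson diff_ge_0_iff_ge diff_le_0_iff_le)
  then show ?thesis by auto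
qed

lemma fixed_point_free_sign:
  fixes f :: "real \<Rightarrow> real"
  assumes "is_interval J" "continuous_on J f" "\<forall>t\<in>J. f t \<noteq> t"
  shows "(\<forall>t\<in>J. f t > t) \<or> (\<forall>t\<in>J. f t < t)"
  using IVT_fixed_point[OF assms(1,2)] assms(3) by (meson linorder_not_less order_less_imp_le)

lemma support_component_exists:
  assumes "line_diffeo \<tau> f" "f x \<noteq> x"
  shows "\<exists>J. support_component f J \<and> x \<in> J"
proof (cases "\<exists>t. f t = t")
  case False
  then show ?thesis unfolding support_component_def by auto
next
  case True
  then obtain l r where lr: "l < x" "f l = l" "x < r" "f r = r"
    using assms(1) unfolding line_diffeo_def by meson
  define F where "F = {t. f t = t}"
  have "closed F" unfolding F_def
    using line_diffeoD(5)[OF assms(1), of UNIV] by (intro closed_Collect_eq) auto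
  \<comment> \<open>\<open>a\<close> and \<open>b\<close> are the fixed points nearest to
    \<open>x\<close> on either side; \<open>l\<close> and \<open>r\<close> witness that the two sets
    are nonempty.\<close>
  define a where "a = Sup (F \<inter> {..x})"
  define b where "b = Inf (F \<inter> {x..})"
  have a: "a \<in> F \<inter> {..x}" unfolding a_def using lr \<open>closed F\<close>
    by (intro closed_contains_Sup) (auto simp: F_def intro: bdd_aboveI2)
  have b: "b \<in> F \<inter> {x..}" unfolding b_def using lr \<open>closed F\<close>
    by (intro closed_contains_Inf) (auto simp: F_def intro: bdd_belowI)
  have ab: "a < x" "x < b" using a b assms(2) unfolding F_def by (auto simp: less_le)
  have "f t \<noteq> t" if "t \<in> {a<..<b}" for t
  proof
    assume "f t = t"
    show False
    proof (cases "t \<le> x")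
      case True
      then have "t \<le> a" unfolding a_def using \<open>f t = t\<close>
        by (intro cSup_upper) (auto simp: F_def)
      then show False using that by auto
    next
      case False
      then have "t \<ge> b" unfolding b_def using \<open>f t = t\<close>
        by (intro cInf_lower) (auto simp: F_def)
      then show False using that by auto
    qed
  qed
  moreover have "a < b" "f a = a" "f b = b" using a b ab unfolding F_def by auto
  ultimately have "support_component f {a<..<b}" unfolding support_component_def by blast
  then show ?thesis using ab by auto
qed

lemma support_component_unique:
  assumes "support_component f J" "support_component f J'" "J \<inter> J' \<noteq> {}"
  shows "J = J'"
proof -
  have *: ?thesis if "J = UNIV \<or> J' = UNIV" using that assms
    unfolding support_component_def by (metis UNIV_I)
  show ?thesis
  proof (cases "J = UNIV \<or> J' = UNIV")
    case False
    then obtain a b a' b' where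
      e: "a < b" "J = {a<..<b}" "f a = a" "f b = b" "a' < b'" "J' = {a'<..<b'}" "f a' = a'" "f b' = b'"
      using assms unfolding support_component_def by metis
    obtain z where "z \<in> J" "z \<in> J'" using assms by auto
    have n: "a' \<notin> J" "b' \<notin> J" "a \<notin> J'" "b \<notin> J'"
      using assms e unfolding support_component_def by blast+
    have "a = a'" "b = b'" using n \<open>z \<in> J\<close> \<open>z \<in> J'\<close> unfolding e by auto
    then show ?thesis using e by simp
  qed (use * in blast)
qed

text \<open>A map commuting with \<open>f\<close> permutes the fixed points of \<open>f\<close>,
  hence also the components of the support.\<close>

lemma support_component_image:
  assumes "support_component f J" "strict_mono g" "surj g" "\<And>t. f (g t) = g (f t)"
  shows "support_component f (g ` J)"
proof -
  have 1: "\<forall>t\<in>g ` J. f t \<noteq> t"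
    using assms unfolding support_component_def
    by (metis (no_types, lifting) imageE strict_mono_eq)
  show ?thesis
  proof (cases "J = UNIV")
    case True
    then show ?thesis using 1 assms(3) unfolding support_component_def by auto
  next
    case False
    then obtain a b where "a < b" "J = {a<..<b}" "f a = a" "f b = b"
      using assms unfolding support_component_def by metis
    then have "g a < g b" "g ` J = {g a<..<g b}" "f (g a) = g a" "f (g b) = g b"
      using assms strict_mono_surj_image_interval[of g a b] by (auto simp: strict_mono_less)
    then show ?thesis using 1 unfolding support_component_def by blast
  qed
qed

lemma support_component_self_image:
  assumes "support_component f J" "strict_mono f" "surj f"
  shows "f ` J = J"
proof (cases "J = UNIV")
  case False
  then obtain a b where "J = {a<..<b}" "f a = a" "f b = b"
    using assms(1) unfolding support_component_def by metis
  then show ?thesis using strict_mono_surj_image_interval(1)[OF assms(2,3), of a b] by simp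
qed (use assms(3) in simp)

lemma open_interval_eqD:
  fixes a b c d :: real
  assumes "a < b" "{a<..<b} = {c<..<d}"
  shows "a = c" "b = d"
  using assms greaterThanLessThan_eq_iff[of a b c d] by auto

text \<open>Crossing would put an endpoint of \<open>B\<close>, fixed by \<open>k\<close>, into
  \<open>J\<close>, so that \<open>k\<close> preserves \<open>J\<close> and fixes its endpoints; but
  one of these would lie in \<open>B\<close>, where \<open>k\<close> has no fixed point. If
  \<open>J\<close> is strictly inside \<open>B\<close>, an endpoint of \<open>J\<close> lies in
  \<open>B\<close> and is moved, so \<open>k\<close> cannot preserve \<open>J\<close>.\<close>

lemma support_component_nested:
  assumes f: "support_component f J" and k: "support_component k B" "strict_mono k" "surj k"
    and nc: "k ` J = J \<or> k ` J \<inter> J = {}" and meet: "J \<inter> B \<noteq> {}"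
  shows "J \<subseteq> B \<or> B \<subseteq> J" "J \<subset> B \<Longrightarrow> k ` J \<inter> J = {}"
proof -
  have 0: "J = UNIV \<or> (\<exists>a b. a < b \<and> J = {a<..<b})"
    using f unfolding support_component_def by auto
  have ends: "a \<notin> B \<and> b \<notin> B" if "J = {a<..<b}" "a < b" "k ` J = J" for a b
  proof -
    have "{k a<..<k b} = {a<..<b}" using that strict_mono_surj_image_interval[OF k(2,3)] by auto
    then have "k a = a" "k b = b" using open_interval_eqD[OF that(2), of "k a" "k b"] by auto
    then show ?thesis using k(1) unfolding support_component_def by auto
  qed
  show "J \<subseteq> B \<or> B \<subseteq> J"
  proof (rule ccontr)
    assume n: "\<not> ?thesis"
    then obtain a b where J: "J = {a<..<b}" "a < b" using 0 by auto
    obtain c d where B: "B = {c<..<d}" "c < d" "k c = c" "k d = d"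
      using n k(1) unfolding support_component_def by auto
    have "(a < c \<and> c < b \<and> b < d) \<or> (c < a \<and> a < d \<and> d < b)"
      using n meet J B by auto
    then have "(c \<in> J \<and> b \<in> B) \<or> (d \<in> J \<and> a \<in> B)" using J B by auto
    moreover have "c \<in> J \<or> d \<in> J \<Longrightarrow> k ` J = J" using nc B by (metis IntI empty_iff image_eqI)
    ultimately show False using ends[OF J] by auto
  qed
  assume "J \<subset> B"
  then obtain a b where J: "J = {a<..<b}" "a < b" using 0 by auto
  have "a \<in> B \<or> b \<in> B"
  proof (cases "B = UNIV")
    case False
    then obtain c d where B: "B = {c<..<d}" "c < d"
      using k(1) unfolding support_component_def by auto
    then show ?thesis using \<open>J \<subset> B\<close> J
      by (metis greaterThanLessThan_iff greaterThanLessThan_subseteq_greaterThanLessThan not_less order_less_le psubsetE)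
  qed auto
  then show "k ` J \<inter> J = {}" using ends[OF J] nc by auto
qed

text \<open>A bounded orbit would have its supremum in \<open>J\<close>. The preimage
  \<open>s0\<close> of the supremum lies strictly below it, so some iterate passes \<open>s0\<close>
  and the next one passes the supremum.\<close>

lemma funpow_exceeds:
  fixes f :: "real \<Rightarrow> real"
  assumes "is_interval J" "strict_mono f" "surj f" "\<forall>t\<in>J. f t > t" "t \<in> J" "y \<in> J"
  shows "\<exists>n. (f ^^ n) t > y"
proof (rule ccontr)
  assume n: "\<not> ?thesis"
  define Z where "Z = range (\<lambda>n. (f ^^ n) t)"
  have bd: "bdd_above Z" using n unfolding Z_def by (auto intro!: bdd_aboveI[of _ y] simp: not_less)
  have "Sup Z \<le> y" using n unfolding Z_def by (intro cSup_least) (auto simp: not_less)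
  moreover have "t \<le> Sup Z" using bd unfolding Z_def
    by (intro cSup_upper) (auto intro: range_eqI[of _ _ 0])
  ultimately have s: "Sup Z \<in> J" using assms by (meson is_interval_1)
  obtain s0 where s0: "f s0 = Sup Z" using assms(3) by (metis surjD)
  have "s0 < Sup Z" using s s0 assms(2,4) by (metis strict_mono_less)
  then obtain n where "(f ^^ n) t > s0"
    using less_cSup_iff[of Z s0] bd unfolding Z_def by auto
  then have "(f ^^ Suc n) t > Sup Z" using s0 assms(2) by (simp add: strict_mono_less flip: s0)
  moreover have "(f ^^ Suc n) t \<le> Sup Z" using bd unfolding Z_def by (intro cSup_upper) (rule rangeI)
  ultimately show False by simp
qed

lemma strict_mono_funpow: "strict_mono (f :: real \<Rightarrow> real) \<Longrightarrow> strict_mono (f ^^ n)"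
  by (induction n) (auto simp: strict_mono_def)

lemma funpow_fixed: "f x = x \<Longrightarrow> (f ^^ n) x = x"
  by (induction n) auto

lemma funpow_commutes:
  assumes "\<And>t. f (g t) = g (f t)" shows "f ((g ^^ n) t) = (g ^^ n) (f t)"
  by (induction n) (auto simp: assms)

section \<open>Distortion of words\<close>

lemma line_diffeo_derivative:
  assumes "line_diffeo \<tau> f"
  obtains C f' where "C \<ge> 0" "\<And>s. (f has_real_derivative f' s) (at s)" "\<And>s. f' s > 0"
    "\<And>s t. \<bar>ln (f' s) - ln (f' t)\<bar> \<le> C * \<bar>s - t\<bar> powr \<tau>"
proof -
  obtain C f' where *: "\<And>s. (f has_real_derivative f' s) (at s)" "\<And>s. f' s > 0"
    "\<And>s t. \<bar>ln (f' s) - ln (f' t)\<bar> \<le> C * \<bar>s - t\<bar> powr \<tau>"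
    using assms unfolding line_diffeo_def by blast
  have "\<bar>ln (f' s) - ln (f' t)\<bar> \<le> max C 0 * \<bar>s - t\<bar> powr \<tau>" for s t
    by (rule order_trans[OF *(3)]) (intro mult_right_mono, auto)
  then show ?thesis using that[of "max C 0" f'] * by auto
qed

lemma DERIV_funpow:
  fixes f :: "real \<Rightarrow> real"
  assumes "\<And>s. (f has_real_derivative f' s) (at s)"
  shows "((f ^^ n) has_real_derivative (\<Prod>i<n. f' ((f ^^ i) s))) (at s)"
proof (induction n)
  case (Suc n)
  have "(f \<circ> (f ^^ n) has_real_derivative f' ((f ^^ n) s) * (\<Prod>i<n. f' ((f ^^ i) s))) (at s)"
    by (rule DERIV_chain[OF assms Suc])
  then show ?case unfolding funpow.simps prod.lessThan_Suc by (subst mult.commute)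
qed (auto simp: id_def)

lemma DERIV_pos_strict_mono:
  fixes f :: "real \<Rightarrow> real"
  assumes "\<And>s. (f has_real_derivative f' s) (at s)" "\<And>s. f' s > 0"
  shows "strict_mono f"
  by (rule strict_monoI) (meson assms DERIV_pos_imp_increasing)

lemma real_MVT:
  fixes f :: "real \<Rightarrow> real"
  assumes "\<And>s. (f has_real_derivative f' s) (at s)" "a < b"
  obtains z where "a < z" "z < b" "f b - f a = (b - a) * f' z"
  using MVT2[OF assms(2), of f f'] assms(1) by blast

text \<open>
  A distortion argument in the style of Kopell's lemma: conjugating by the maps \<open>w\<close> compares the
  derivatives of the iterates of \<open>f\<close> on \<open>{u..b}\<close> with those on the tiny interval \<open>w ` {a..b}\<close>,
  where they are almost \<open>1\<close>. So the iterates cannot contract \<open>{u..b}\<close>.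
\<close>

lemma kopell_contradiction:
  assumes "\<tau> > 0" and f: "line_diffeo \<tau> f" "f a = a" "f b = b" "\<forall>t\<in>{a<..<b}. f t > t"
    and u: "a < u" "u < b" and E: "E > 0"
    and w: "\<And>\<epsilon>. \<epsilon> > 0 \<Longrightarrow> \<exists>w w'. (\<forall>t. (w has_real_derivative w' t) (at t) \<and> w' t > 0 \<and> w (f t) = f (w t))
              \<and> w b - w a < \<epsilon> \<and> (\<forall>s\<in>{u..b}. \<forall>t\<in>{u..b}. w' s \<le> E * w' t)"
  shows False
proof -
  obtain C f' where C: "C \<ge> 0" and f': "\<And>s. (f has_real_derivative f' s) (at s)" "\<And>s. f' s > 0"
    "\<And>s t. \<bar>ln (f' s) - ln (f' t)\<bar> \<le> C * \<bar>s - t\<bar> powr \<tau>"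
    using line_diffeo_derivative[OF f(1)] by metis
  define F where "F = (\<lambda>n s. \<Prod>i<n. f' ((f ^^ i) s))"
  have DF: "((f ^^ n) has_real_derivative F n s) (at s)" for n s
    unfolding F_def by (rule DERIV_funpow[OF f'(1)])
  have mono: "strict_mono f" using line_diffeoD[OF f(1)] by simp
  have up: "(f ^^ i) y \<in> {y..b}" if "y \<in> {u..b}" for i y
  proof (induction i)
    case (Suc i)
    have "f ((f ^^ i) y) \<ge> (f ^^ i) y"
      using Suc f u that by (cases "(f ^^ i) y = b") (auto simp: less_imp_le)
    moreover have "f ((f ^^ i) y) \<le> f b" using Suc mono by (simp add: strict_mono_less_eq)
    ultimately show ?case using Suc f by auto
  qed (use that in auto)
  have low: "F n y \<ge> 1 / (2 * E)" if y: "y \<in> {u..b}" for n y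
  proof -
    \<comment> \<open>With this \<open>\<epsilon>\<close>, \<open>n\<close> steps that each multiply
      the derivative by at least \<open>exp (- (C * \<epsilon> powr \<tau>))\<close> lose at most a
      factor 2. The \<open>+ 1\<close> keeps the denominator positive.\<close>
    define \<epsilon> where "\<epsilon> = (ln 2 / (n * C + 1)) powr (1 / \<tau>)"
    have nC: "real n * C \<ge> 0" using C by simp
    have "ln 2 / (n * C + 1) \<noteq> 0" using nC by simp
    then have "\<epsilon> > 0" unfolding \<epsilon>_def powr_gt_zero .
    have e: "\<epsilon> powr \<tau> = ln 2 / (n * C + 1)"
      unfolding \<epsilon>_def using \<open>\<tau> > 0\<close> nC by (simp add: powr_powr)
    have e2: "n * (C * \<epsilon> powr \<tau>) \<le> ln 2"
    proof -
      have "n * (C * \<epsilon> powr \<tau>) = (n * C) / (n * C + 1) * ln 2" unfolding e by simp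
      also have "\<dots> \<le> 1 * ln 2" using nC by (intro mult_right_mono) auto
      finally show ?thesis by simp
    qed
    obtain w w' where w: "\<And>t. (w has_real_derivative w' t) (at t)" "\<And>t. w' t > 0"
      "\<And>t. w (f t) = f (w t)" "w b - w a < \<epsilon>" "\<And>s t. s \<in> {u..b} \<Longrightarrow> t \<in> {u..b} \<Longrightarrow> w' s \<le> E * w' t"
      using w[OF \<open>\<epsilon> > 0\<close>] by blast
    have wm: "strict_mono w" using DERIV_pos_strict_mono w by blast
    \<comment> \<open>Since \<open>f\<close> fixes \<open>w a\<close> and \<open>w b\<close>, its
      derivative is exactly 1 somewhere between them; the Hoelder bound keeps it close to 1 on the
      whole short interval.\<close>
    have "w a < w b" using wm u by (simp add: strict_mono_less)
    then obtain \<xi> where \<xi>: "w a < \<xi>" "\<xi> < w b" "f (w b) - f (w a) = (w b - w a) * f' \<xi>"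
      by (rule real_MVT[OF f'(1)])
    have "f (w a) = w a" "f (w b) = w b" using f w(3) by metis+
    then have "f' \<xi> = 1" using \<xi>(3) \<open>w a < w b\<close> by simp
    have fl: "f' t \<ge> exp (- (C * \<epsilon> powr \<tau>))" if "t \<in> {w a..w b}" for t
    proof -
      have "\<bar>t - \<xi>\<bar> \<le> \<epsilon>" using that \<xi> w(4) by auto
      then have "\<bar>t - \<xi>\<bar> powr \<tau> \<le> \<epsilon> powr \<tau>" using \<open>\<tau> > 0\<close> by (intro powr_mono2) auto
      then have "\<bar>ln (f' t)\<bar> \<le> C * \<epsilon> powr \<tau>"
        using order_trans[OF f'(3)[of t \<xi>] mult_left_mono[OF _ C]] \<open>f' \<xi> = 1\<close> by simp
      then have "exp (- (C * \<epsilon> powr \<tau>)) \<le> exp (ln (f' t))" by simp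
      then show ?thesis using f'(2)[of t] by simp
    qed
    have "(f ^^ i) (w y) \<in> {w a..w b}" for i
    proof -
      have "(f ^^ i) (w y) = w ((f ^^ i) y)"
        using funpow_commutes[of w f i y] w(3) by simp
      then show ?thesis using up[OF y, of i] y u wm by (auto simp: strict_mono_less_eq)
    qed
    then have "(\<Prod>i<n. exp (- (C * \<epsilon> powr \<tau>))) \<le> F n (w y)"
      unfolding F_def using fl by (intro prod_mono) auto
    moreover have "(\<Prod>i<n. exp (- (C * \<epsilon> powr \<tau>))) = exp (- (n * (C * \<epsilon> powr \<tau>)))"
    proof -
      have "(\<Prod>i<n. exp (- (C * \<epsilon> powr \<tau>))) = exp (- (C * \<epsilon> powr \<tau>)) ^ n" by simp
      also have "\<dots> = exp (real n * (- (C * \<epsilon> powr \<tau>)))" by (rule exp_of_nat_mult[symmetric])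
      finally show ?thesis by (simp only: mult_minus_right)
    qed
    moreover have "\<dots> \<ge> exp (- ln 2)" using e2 by simp
    moreover have "exp (- ln 2) = (1 / 2 :: real)" by (simp add: exp_minus)
    ultimately have half: "F n (w y) \<ge> 1 / 2" by linarith
    \<comment> \<open>Differentiating \<open>(f ^^ n) \<circ> w = w \<circ> (f ^^ n)\<close> carries
      the lower bound from \<open>w y\<close> back to \<open>y\<close>, at the cost of the
      distortion \<open>E\<close> of \<open>w\<close>.\<close>
    have "((f ^^ n) \<circ> w has_real_derivative F n (w y) * w' y) (at y)"
      by (rule DERIV_chain[OF DF w(1)])
    moreover have "(w \<circ> (f ^^ n) has_real_derivative w' ((f ^^ n) y) * F n y) (at y)"
      by (rule DERIV_chain[OF w(1) DF])
    moreover have "(f ^^ n) \<circ> w = w \<circ> (f ^^ n)"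
      using funpow_commutes[of w f n, OF w(3)] by (simp add: fun_eq_iff)
    ultimately have eq: "F n (w y) * w' y = w' ((f ^^ n) y) * F n y"
      by (metis (no_types) DERIV_unique)
    have "w' ((f ^^ n) y) \<le> E * w' y" using w(5) up[OF y, of n] y by auto
    moreover have "1 / 2 * w' y \<le> w' ((f ^^ n) y) * F n y"
      unfolding eq[symmetric] using half w(2)[of y] by (intro mult_right_mono) auto
    moreover have "E * (1 / 2 * w' y) \<le> E * (w' ((f ^^ n) y) * F n y)"
      using calculation(2) E by (intro mult_left_mono) auto
    ultimately have "w' ((f ^^ n) y) * 1 \<le> w' ((f ^^ n) y) * (2 * E * F n y)"
      by (simp add: algebra_simps)
    then have "1 \<le> 2 * E * F n y" using w(2)[of "(f ^^ n) y"] by (simp only: mult_le_cancel_left_pos)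
    then show ?thesis using E by (simp add: field_simps)
  qed
  \<comment> \<open>Once an iterate of \<open>u\<close> exceeds \<open>y\<close>, less than the
    fraction \<open>1 / (2 * E)\<close> of the length of \<open>{u..b}\<close> is left, which
    \<open>low\<close> and the mean value theorem forbid.\<close>
  define y where "y = max u (b - (b - u) / (2 * E))"
  have "y \<in> {a<..<b}" using u E unfolding y_def by auto
  then obtain n where n: "(f ^^ n) u > y"
    using funpow_exceeds[of "{a<..<b}" f u y] line_diffeoD[OF f(1)] f(4) u by (auto simp: is_interval_convex_1)
  obtain z where z: "u < z" "z < b" "(f ^^ n) b - (f ^^ n) u = (b - u) * F n z"
    by (rule real_MVT[OF DF u(2)])
  have "(b - u) * F n z \<ge> (b - u) * (1 / (2 * E))" using low[of z n] z u by (intro mult_left_mono) auto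
  then show False using z n f(3) unfolding y_def by (simp add: funpow_fixed)
qed

definition word :: "('a \<Rightarrow> 'a) list \<Rightarrow> 'a \<Rightarrow> 'a"
  where "word gs = foldr (\<circ>) gs id"

lemma word_simps [simp]: "word [] = id" "word (g # gs) = g \<circ> word gs"
  by (simp_all add: word_def)

lemma word_replicate: "word (replicate n g) = g ^^ n"
  by (induction n) auto

lemma word_append: "word (gs @ hs) = word gs \<circ> word hs"
  by (induction gs) auto

lemma word_commutes:
  assumes "\<And>g t. g \<in> set gs \<Longrightarrow> k (g t) = g (k t)" shows "k (word gs t) = word gs (k t)"
  using assms by (induction gs) auto

text \<open>The last letter of a list acts first, so the proper suffixes give the successive
  intervals on which the letters act. The cost adds up the \<open>\<tau>\<close>-th powers of their
  lengths.\<close>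

primrec word_cost :: "real \<Rightarrow> real \<Rightarrow> real \<Rightarrow> (real \<Rightarrow> real) list \<Rightarrow> real"
  where "word_cost \<tau> a b [] = 0"
  | "word_cost \<tau> a b (g # gs) = (word gs b - word gs a) powr \<tau> + word_cost \<tau> a b gs"

text \<open>By the chain rule the logarithmic derivative of a word is the sum of those of its
  letters along the orbit, and each of them varies by at most \<open>C\<close> times the
  \<open>\<tau>\<close>-th power of the length of the interval on which the letter acts.\<close>

lemma word_distortion:
  assumes "\<tau> > 0" "C \<ge> 0"
    "\<forall>g\<in>set gs. \<exists>g'. \<forall>s. (g has_real_derivative g' s) (at s) \<and> g' s > 0 \<and>
       (\<forall>t. \<bar>ln (g' s) - ln (g' t)\<bar> \<le> C * \<bar>s - t\<bar> powr \<tau>)"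
  shows "\<exists>w'. (\<forall>s. (word gs has_real_derivative w' s) (at s) \<and> w' s > 0) \<and>
    (\<forall>s\<in>{a..b}. \<forall>t\<in>{a..b}. \<bar>ln (w' s) - ln (w' t)\<bar> \<le> C * word_cost \<tau> a b gs)"
  using assms(3)
proof (induction gs)
  case Nil
  show ?case by (intro exI[of _ "\<lambda>_. 1"]) (auto simp: id_def)
next
  case (Cons g gs)
  have sub: "\<forall>g\<in>set gs. \<exists>g'. \<forall>s. (g has_real_derivative g' s) (at s) \<and> g' s > 0 \<and>
       (\<forall>t. \<bar>ln (g' s) - ln (g' t)\<bar> \<le> C * \<bar>s - t\<bar> powr \<tau>)"
    using Cons.prems by simp
  obtain w' where w: "\<And>s. (word gs has_real_derivative w' s) (at s)" "\<And>s. w' s > 0"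
    "\<And>s t. s\<in>{a..b} \<Longrightarrow> t\<in>{a..b} \<Longrightarrow> \<bar>ln (w' s) - ln (w' t)\<bar> \<le> C * word_cost \<tau> a b gs"
    using Cons.IH[OF sub] by blast
  obtain g' where g: "\<And>s. (g has_real_derivative g' s) (at s)" "\<And>s. g' s > 0"
    "\<And>s t. \<bar>ln (g' s) - ln (g' t)\<bar> \<le> C * \<bar>s - t\<bar> powr \<tau>"
    using bspec[OF Cons.prems, of g] by auto
  have m: "strict_mono (word gs)" using DERIV_pos_strict_mono w by blast
  define v where "v = (\<lambda>s. g' (word gs s) * w' s)"
  have "(word (g # gs) has_real_derivative v s) (at s)" for s
    unfolding v_def word_simps by (rule DERIV_chain[OF g(1) w(1)])
  moreover have "v s > 0" for s unfolding v_def using g(2) w(2) by simp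
  moreover have "\<bar>ln (v s) - ln (v t)\<bar> \<le> C * word_cost \<tau> a b (g # gs)"
    if st: "s \<in> {a..b}" "t \<in> {a..b}" for s t
  proof -
    have "\<bar>word gs s - word gs t\<bar> \<le> word gs b - word gs a"
      using st strict_mono_less_eq[OF m, of a s] strict_mono_less_eq[OF m, of a t]
        strict_mono_less_eq[OF m, of s b] strict_mono_less_eq[OF m, of t b] by auto
    then have "\<bar>word gs s - word gs t\<bar> powr \<tau> \<le> (word gs b - word gs a) powr \<tau>"
      using assms(1) by (intro powr_mono2) auto
    then have "\<bar>ln (g' (word gs s)) - ln (g' (word gs t))\<bar> \<le> C * (word gs b - word gs a) powr \<tau>"
      using order_trans[OF g(3)[of "word gs s" "word gs t"] mult_left_mono[OF _ assms(2)]] by simp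
    moreover have "ln (v s) = ln (g' (word gs s)) + ln (w' s)" for s
      unfolding v_def using g(2)[of "word gs s"] w(2)[of s] by (simp add: ln_mult)
    ultimately show ?thesis using w(3)[OF st] by (simp add: distrib_left)
  qed
  ultimately show ?case by blast
qed

section \<open>Many disjoint images inside a displaced window\<close>

lemma sum_disjoint_intervals_le:
  fixes x y :: "'i \<Rightarrow> real"
  assumes "finite I" "A \<le> B" "\<And>i. i \<in> I \<Longrightarrow> A \<le> x i \<and> x i \<le> y i \<and> y i \<le> B"
    "\<And>i j. i \<in> I \<Longrightarrow> j \<in> I \<Longrightarrow> i \<noteq> j \<Longrightarrow> {x i<..<y i} \<inter> {x j<..<y j} = {}"
  shows "(\<Sum>i\<in>I. y i - x i) \<le> B - A"
proof -
  have "measure lborel (\<Union>i\<in>I. {x i<..<y i}) = (\<Sum>i\<in>I. measure lborel {x i<..<y i})"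
  proof (rule measure_finite_Union)
    show "disjoint_family_on (\<lambda>i. {x i<..<y i}) I"
      using assms(4) unfolding disjoint_family_on_def by blast
  qed (use assms(1,3) in \<open>auto simp: emeasure_lborel_Ioo\<close>)
  also have "\<dots> = (\<Sum>i\<in>I. y i - x i)" using assms(3) by (intro sum.cong) auto
  finally have "(\<Sum>i\<in>I. y i - x i) = measure lborel (\<Union>i\<in>I. {x i<..<y i})" by simp
  also have "\<dots> \<le> measure lborel {A..B}"
    using assms by (intro measure_mono_fmeasurable) (force simp: fmeasurable_def)+
  also have "\<dots> = B - A" using assms(2) by simp
  finally show ?thesis .
qed

text \<open>The derivative is 1 somewhere between the two fixed points, and the Hoelder bound
  spreads this over \<open>{A..B}\<close>. What matters is that \<open>C\<close> is the same for all
  intervals, so the factor tends to 1 as they shrink.\<close>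

lemma expansion_near_fixed_points:
  assumes "\<tau> > 0" "line_diffeo \<tau> e"
  shows "\<exists>C\<ge>0. \<forall>A B q r s t. A \<le> q \<and> q < r \<and> r \<le> B \<and> e q = q \<and> e r = r \<and> A \<le> s \<and> s \<le> t \<and> t \<le> B
    \<longrightarrow> exp (- (C * (B - A) powr \<tau>)) * (t - s) \<le> e t - e s"
proof -
  obtain C e' where C: "C \<ge> 0" and e': "\<And>s. (e has_real_derivative e' s) (at s)" "\<And>s. e' s > 0"
    "\<And>s t. \<bar>ln (e' s) - ln (e' t)\<bar> \<le> C * \<bar>s - t\<bar> powr \<tau>"
    using line_diffeo_derivative[OF assms(2)] by metis
  have "exp (- (C * (B - A) powr \<tau>)) * (t - s) \<le> e t - e s"
    if *: "A \<le> q" "q < r" "r \<le> B" "e q = q" "e r = r" "A \<le> s" "s \<le> t" "t \<le> B" for A B q r s t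
  proof (cases "s = t")
    case False
    then have "s < t" using that by simp
    obtain \<xi> where \<xi>: "q < \<xi>" "\<xi> < r" "e r - e q = (r - q) * e' \<xi>"
      by (rule real_MVT[OF e'(1) \<open>q < r\<close>])
    then have "e' \<xi> = 1" using * by simp
    obtain z where z: "s < z" "z < t" "e t - e s = (t - s) * e' z"
      by (rule real_MVT[OF e'(1) \<open>s < t\<close>])
    have "\<bar>z - \<xi>\<bar> powr \<tau> \<le> (B - A) powr \<tau>" using * \<xi> z assms(1) by (intro powr_mono2) auto
    then have "\<bar>ln (e' z)\<bar> \<le> C * (B - A) powr \<tau>"
      using order_trans[OF e'(3)[of z \<xi>] mult_left_mono[OF _ C]] \<open>e' \<xi> = 1\<close> by simp
    then have "exp (- (C * (B - A) powr \<tau>)) \<le> exp (ln (e' z))" by simp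
    then have "exp (- (C * (B - A) powr \<tau>)) \<le> e' z" using e'(2)[of z] by simp
    then show ?thesis using z \<open>s < t\<close> by (simp add: mult.commute)
  qed simp
  then show ?thesis using C by blast
qed

lemma expansion_near_fixed_points_finite:
  assumes "\<tau> > 0" "finite E" "\<And>e. e \<in> E \<Longrightarrow> line_diffeo \<tau> e"
  shows "\<exists>C\<ge>0. \<forall>e\<in>E. \<forall>A B q r s t. A \<le> q \<and> q < r \<and> r \<le> B \<and> e q = q \<and> e r = r \<and> A \<le> s \<and> s \<le> t \<and> t \<le> B
    \<longrightarrow> exp (- (C * (B - A) powr \<tau>)) * (t - s) \<le> e t - e s"
proof -
  have "\<forall>e\<in>E. \<exists>C. C \<ge> 0 \<and> (\<forall>A B q r s t. A \<le> q \<and> q < r \<and> r \<le> B \<and> e q = q \<and> e r = r \<and> A \<le> s \<and> s \<le> t \<and> t \<le> B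
    \<longrightarrow> exp (- (C * (B - A) powr \<tau>)) * (t - s) \<le> e t - e s)"
    using expansion_near_fixed_points[OF assms(1)] assms(3) by blast
  then obtain Cf where Cf: "\<And>e. e \<in> E \<Longrightarrow> Cf e \<ge> 0"
    "\<And>e A B q r s t. e \<in> E \<Longrightarrow> A \<le> q \<and> q < r \<and> r \<le> B \<and> e q = q \<and> e r = r \<and> A \<le> s \<and> s \<le> t \<and> t \<le> B
      \<Longrightarrow> exp (- (Cf e * (B - A) powr \<tau>)) * (t - s) \<le> e t - e s"
    using bchoice by (metis (lifting))
  define C where "C = sum Cf E"
  have "C \<ge> 0" unfolding C_def using Cf(1) by (rule sum_nonneg)
  moreover have "exp (- (C * (B - A) powr \<tau>)) * (t - s) \<le> e t - e s"
    if "e \<in> E" "A \<le> q \<and> q < r \<and> r \<le> B \<and> e q = q \<and> e r = r \<and> A \<le> s \<and> s \<le> t \<and> t \<le> B" for e A B q r s t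
  proof -
    have "Cf e \<le> C" unfolding C_def using that(1) assms(2) Cf(1) by (intro member_le_sum) auto
    then have "Cf e * (B - A) powr \<tau> \<le> C * (B - A) powr \<tau>" by (intro mult_right_mono) auto
    then have "exp (- (C * (B - A) powr \<tau>)) * (t - s) \<le> exp (- (Cf e * (B - A) powr \<tau>)) * (t - s)"
      using that(2) by (intro mult_right_mono) auto
    then show ?thesis using Cf(2)[OF that] by linarith
  qed
  ultimately show ?thesis by blast
qed

lemma word_cost_replicate:
  "word_cost \<tau> a b (replicate n k) = (\<Sum>i<n. ((k ^^ i) b - (k ^^ i) a) powr \<tau>)"
  by (induction n) (simp_all add: word_replicate)

lemma funpow_in_component:
  fixes k :: "real \<Rightarrow> real"
  assumes "strict_mono k" "k c = c" "k d = d" "t \<in> {c<..<d}"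
  shows "(k ^^ n) t \<in> {c<..<d}"
proof (induction n)
  case (Suc n)
  then have "k c < k ((k ^^ n) t)" "k ((k ^^ n) t) < k d" using assms(1) by (auto simp: strict_mono_less)
  then show ?case using assms by simp
qed (use assms in auto)

text \<open>
  The translates \<open>(k ^^ n) ` {a..b}\<close> have summable lengths \<open>L n\<close>. As \<open>e \<in> E\<close> commutes with \<open>k\<close>,
  it has fixed points in consecutive translates, so \<open>\<bar>ln e'\<bar> \<le> C * L n powr \<tau>\<close> there. About
  \<open>L n powr (- \<tau>)\<close> steps therefore change lengths by a bounded factor only, and the polynomially many
  disjoint images of \<open>{u<..<b'}\<close> reached by then force \<open>(k ^^ n) ` {u<..<b'}\<close> to be so short that
  the \<open>\<tau>\<close>-th powers of the lengths are summable. This bounds the distortion of all \<open>k ^^ n\<close>.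
\<close>

lemma many_images_contradiction:
  fixes D :: nat
  assumes \<tau>: "\<tau> > 0"
    and k: "line_diffeo \<tau> k" "k c = c" "k d = d" "\<forall>t\<in>{c<..<d}. k t > t"
    and ab: "c < a" "a < b" "b \<le> k a" "b < d"
    and f: "line_diffeo \<tau> f" "\<And>t. f (k t) = k (f t)" "f a' = a'" "f b' = b'"
      "\<forall>t\<in>{a'<..<b'}. f t > t" "a \<le> a'" "a' < u" "u < b'" "b' \<le> b"
    and E: "finite E" "\<And>e. e \<in> E \<Longrightarrow> line_diffeo \<tau> e" "\<And>e t. e \<in> E \<Longrightarrow> e (k t) = k (e t)"
      "\<And>e. e \<in> E \<Longrightarrow> \<exists>q\<in>{a..b}. e q = q" "\<And>e. e \<in> E \<Longrightarrow> e ` X \<subseteq> X"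
    and X: "{u..b'} \<subseteq> X" "X \<subseteq> {a..b}"
    and D: "\<tau> * (1 + \<tau> * D) \<ge> 1"
    and Y: "\<And>Q. \<exists>Y. finite Y \<and> Q ^ D \<le> card Y \<and> (\<forall>gs\<in>Y. set gs \<subseteq> E \<and> length gs \<le> D * Q) \<and>
      (\<forall>gs\<in>Y. \<forall>hs\<in>Y. gs \<noteq> hs \<longrightarrow> word gs ` {u<..<b'} \<inter> word hs ` {u<..<b'} = {})"
  shows False
proof -
  define p where "p = (\<lambda>n. k ^^ n)"
  \<comment> \<open>The window runs over two consecutive translates: a fixed point \<open>q\<close>
    of a letter then yields two distinct fixed points \<open>p n q\<close> and
    \<open>p (Suc n) q\<close> inside it.\<close>
  define L where "L = (\<lambda>n. p (n + 2) a - p n a)"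
  have km: "strict_mono k" "surj k" using line_diffeoD[OF k(1)] by auto
  have pm: "strict_mono (p n)" for n unfolding p_def by (rule strict_mono_funpow[OF km(1)])
  have ps: "surj (p n)" for n proof (induction n)
    case (Suc n)
    then show ?case unfolding p_def funpow.simps using comp_surj km(2) by blast
  qed (simp add: p_def)
  have pa: "p (Suc n) t = p n (k t)" for n t unfolding p_def by (simp add: funpow_swap1)
  have pin: "p n t \<in> {c<..<d}" if "t \<in> {c<..<d}" for n t
    unfolding p_def using funpow_in_component[OF km(1) k(2,3) that] .
  have acd: "a \<in> {c<..<d}" using ab by auto
  have ba: "p n b \<le> p (Suc n) a" for n
    unfolding pa using ab(3) pm[of n] by (simp add: strict_mono_less_eq)
  have a_b: "p n a < p n b" for n using ab pm[of n] by (simp add: strict_mono_less)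
  have bL: "p n b \<le> p (n + 2) a" for n using ba[of n] a_b[of "Suc n"] ba[of "Suc n"] by simp
  have Lpos: "L n > 0" for n using bL[of n] a_b[of n] unfolding L_def by simp
  have bL': "p n b - p n a \<le> L n" for n unfolding L_def using bL[of n] by simp
  have Lle: "L n \<le> d - c" for n
    using pin[OF acd, of n] pin[OF acd, of "n + 2"] unfolding L_def by auto
  \<comment> \<open>Each gap between consecutive points \<open>p n a\<close> is counted by at most
    two windows; hence the factor 2 below.\<close>
  have "(\<Sum>n<N. L n) = p N a + p (Suc N) a - a - k a" for N
    by (induction N) (auto simp: L_def p_def)
  moreover have "k a > a" using k(4) acd by blast
  ultimately have Lsum: "(\<Sum>n<N. L n) \<le> 2 * (d - c)" for N
    using pin[OF acd, of N] pin[OF acd, of "Suc N"] ab by auto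
  obtain C where C: "C \<ge> 0" "\<And>e A B q r s t. e \<in> E \<Longrightarrow>
      A \<le> q \<and> q < r \<and> r \<le> B \<and> e q = q \<and> e r = r \<and> A \<le> s \<and> s \<le> t \<and> t \<le> B
      \<Longrightarrow> exp (- (C * (B - A) powr \<tau>)) * (t - s) \<le> e t - e s"
    using expansion_near_fixed_points_finite[OF \<tau> E(1,2)] by metis
  have step: "exp (- (C * L n powr \<tau>)) * (t - s) \<le> e t - e s"
    if st: "e \<in> E" "p n a \<le> s" "s \<le> t" "t \<le> p n b" for e n s t
  proof -
    obtain q where q: "q \<in> {a..b}" "e q = q" using E(4)[OF st(1)] by blast
    have fixp: "e (p m q) = p m q" for m
      unfolding p_def using funpow_commutes[of e k m q] E(3)[OF that(1)] q by simp
    have "q \<in> {c<..<d}" using q ab by auto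
    then have "q < k q" using k(4) by blast
    then have 1: "p n q < p (Suc n) q" unfolding pa using pm[of n] by (simp add: strict_mono_less)
    have 2: "p n a \<le> p n q" using q pm[of n] by (simp add: strict_mono_less_eq)
    have "p (Suc n) q \<le> p (Suc n) b" using q pm[of "Suc n"] by (simp add: strict_mono_less_eq)
    then have 3: "p (Suc n) q \<le> p (n + 2) a" using ba[of "Suc n"] by simp
    show ?thesis unfolding L_def
      by (rule C(2)[OF st(1), of _ "p n q" "p (Suc n) q"]) (use 1 2 3 fixp st bL[of n] in auto)
  qed
  have wX: "word gs t \<in> X" if "set gs \<subseteq> E" "t \<in> X" for gs t
    using that(1) by (induction gs) (use that(2) E(5) in auto)
  have wp: "word gs (p n t) = p n (word gs t)" if "set gs \<subseteq> E" for gs n t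
    unfolding p_def using funpow_commutes[of "word gs" k n t] word_commutes[of gs k] E(3) that
    by (metis subsetD)
  \<comment> \<open>The letters map \<open>X\<close> into itself, so all suffixes keep the points
    between \<open>p n a\<close> and \<open>p n b\<close>, where \<open>step\<close> applies to the
    next letter.\<close>
  have slow: "exp (- (C * L n powr \<tau> * length gs)) * (p n t - p n s) \<le> word gs (p n t) - word gs (p n s)"
    if "set gs \<subseteq> E" and st: "s \<in> X" "t \<in> X" "s \<le> t" for gs s t n
    using that(1)
  proof (induction gs)
    case (Cons g gs)
    then have gs: "set gs \<subseteq> E" and g: "g \<in> E" by auto
    have IH: "exp (- (C * L n powr \<tau> * length gs)) * (p n t - p n s) \<le> word gs (p n t) - word gs (p n s)"
      using Cons.IH[OF gs] .
    have "p n s \<le> p n t" using st pm[of n] by (simp add: strict_mono_less_eq)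
    then have "0 \<le> exp (- (C * L n powr \<tau> * length gs)) * (p n t - p n s)" by simp
    then have le: "word gs (p n s) \<le> word gs (p n t)" using IH by simp
    have "word gs s \<in> {a..b}" "word gs t \<in> {a..b}" using wX[OF gs] st X(2) by blast+
    then have "p n a \<le> word gs (p n s)" "word gs (p n t) \<le> p n b"
      unfolding wp[OF gs] using pm[of n] by (auto simp: strict_mono_less_eq)
    then have 1: "exp (- (C * L n powr \<tau>)) * (word gs (p n t) - word gs (p n s)) \<le> g (word gs (p n t)) - g (word gs (p n s))"
      using step[OF g _ le] by blast
    have 2: "exp (- (C * L n powr \<tau>)) * (exp (- (C * L n powr \<tau> * length gs)) * (p n t - p n s))
      \<le> exp (- (C * L n powr \<tau>)) * (word gs (p n t) - word gs (p n s))"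
      using IH by (intro mult_left_mono) auto
    have "exp (- (C * L n powr \<tau> * length (g # gs))) = exp (- (C * L n powr \<tau>)) * exp (- (C * L n powr \<tau> * length gs))"
      unfolding exp_add[symmetric] by (simp add: algebra_simps)
    then show ?case unfolding word_simps o_apply using order_trans[OF 2 1] by (simp only: mult.assoc)
  qed simp
  define len where "len = (\<lambda>n. p n b' - p n u)"
  have lenpos: "len n > 0" for n unfolding len_def using f(8) pm[of n] by (simp add: strict_mono_less)
  have uX: "u \<in> X" "b' \<in> X" using X(1) f(8) by auto
  have count: "real Q ^ D * (exp (- (C * D * (L n powr \<tau> * Q))) * len n) \<le> L n" for Q n
  proof -
    obtain Y where Y: "finite Y" "Q ^ D \<le> card Y" "\<And>gs. gs\<in>Y \<Longrightarrow> set gs \<subseteq> E" "\<And>gs. gs\<in>Y \<Longrightarrow> length gs \<le> D * Q"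
      "\<And>gs hs. gs\<in>Y \<Longrightarrow> hs\<in>Y \<Longrightarrow> gs \<noteq> hs \<Longrightarrow> word gs ` {u<..<b'} \<inter> word hs ` {u<..<b'} = {}"
      using Y[of Q] by metis
    define m where "m = exp (- (C * D * (L n powr \<tau> * Q))) * len n"
    have wm: "strict_mono (word gs) \<and> surj (word gs)" if "gs \<in> Y" for gs
      using Y(3)[OF that]
    proof (induction gs)
      case (Cons g gs)
      then show ?case using line_diffeoD(1,2)[OF E(2), of g] comp_surj[of "word gs" g]
        by (auto simp: strict_mono_def)
    qed (auto simp: strict_mono_def)
    have "real Q ^ D * m \<le> card Y * m"
      using Y(2) lenpos[of n] unfolding m_def
      by (intro mult_right_mono) (auto simp flip: of_nat_power)
    also have "\<dots> = (\<Sum>gs\<in>Y. m)" by simp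
    also have "\<dots> \<le> (\<Sum>gs\<in>Y. word gs (p n b') - word gs (p n u))"
    proof (rule sum_mono)
      fix gs assume gs: "gs \<in> Y"
      have "C * L n powr \<tau> * length gs \<le> C * L n powr \<tau> * (real D * Q)"
        using Y(4)[OF gs] C(1) by (intro mult_left_mono) (auto simp flip: of_nat_mult)
      then have "exp (- (C * D * (L n powr \<tau> * Q))) \<le> exp (- (C * L n powr \<tau> * length gs))"
        by (simp add: algebra_simps)
      then have "m \<le> exp (- (C * L n powr \<tau> * length gs)) * len n"
        unfolding m_def using lenpos[of n] by (intro mult_right_mono) auto
      then show "m \<le> word gs (p n b') - word gs (p n u)"
        using slow[OF Y(3)[OF gs] uX, of n] f(8) unfolding len_def by simp
    qed
    also have "\<dots> \<le> p n b - p n a"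
    proof (rule sum_disjoint_intervals_le[OF Y(1)])
      show "p n a \<le> p n b" using a_b[of n] by simp
      fix gs assume gs: "gs \<in> Y"
      have "word gs u \<in> {a..b}" "word gs b' \<in> {a..b}" using wX[OF Y(3)[OF gs]] uX X(2) by blast+
      then show "p n a \<le> word gs (p n u) \<and> word gs (p n u) \<le> word gs (p n b') \<and> word gs (p n b') \<le> p n b"
        unfolding wp[OF Y(3)[OF gs]] using pm[of n] wm[OF gs] f(8) by (auto simp: strict_mono_less_eq)
    next
      fix gs hs assume gh: "gs \<in> Y" "hs \<in> Y" "gs \<noteq> hs"
      have "{word gs (p n u)<..<word gs (p n b')} = p n ` word gs ` {u<..<b'}" if "gs \<in> Y" for gs
        using wm[OF that] pm[of n] ps[of n] wp[OF Y(3)[OF that]]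
        by (simp add: strict_mono_surj_image_interval)
      moreover have "inj (p n)" using pm[of n] by (rule strict_mono_imp_inj_on)
      ultimately show "{word gs (p n u)<..<word gs (p n b')} \<inter> {word hs (p n u)<..<word hs (p n b')} = {}"
        using Y(5)[OF gh] gh by (simp flip: image_Int)
    qed
    finally show ?thesis unfolding m_def using bL'[of n] by simp
  qed
  \<comment> \<open>\<open>R0\<close> bounds \<open>L n powr \<tau> * Q\<close> for the
    \<open>Q\<close> chosen below, and \<open>1 / M\<close> bounds the resulting shrinking factor
    from below, both uniformly in \<open>n\<close>.\<close>
  define R0 where "R0 = 1 + (d - c) powr \<tau>"
  define M where "M = exp (C * D * R0)"
  define W where "W = M powr \<tau> * (d - c) powr (\<tau> * (1 + \<tau> * D) - 1)"
  have lenbound: "len n powr \<tau> \<le> W * L n" for n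
  proof -
    \<comment> \<open>The largest order of magnitude for which words of length \<open>D * Q\<close>
      still change lengths by a bounded factor only; it yields about
      \<open>L n powr (- (\<tau> * D))\<close> disjoint images.\<close>
    define Q where "Q = nat \<lceil>L n powr (- \<tau>)\<rceil>"
    have Q: "L n powr (- \<tau>) \<le> Q" "Q \<le> L n powr (- \<tau>) + 1" unfolding Q_def using powr_ge_zero[of "L n" "- \<tau>"] by linarith+
    have "L n powr \<tau> * Q \<le> L n powr \<tau> * (L n powr (- \<tau>) + 1)" using Q(2) by (intro mult_left_mono) auto
    also have "\<dots> = 1 + L n powr \<tau>" using Lpos[of n] by (simp add: distrib_left flip: powr_add)
    also have "\<dots> \<le> R0" unfolding R0_def using Lpos[of n] Lle[of n] \<tau> by (simp add: powr_mono2)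
    finally have "C * D * (L n powr \<tau> * Q) \<le> C * D * R0" using C(1) by (intro mult_left_mono) auto
    then have e: "1 / M \<le> exp (- (C * D * (L n powr \<tau> * Q)))"
      unfolding M_def by (simp add: exp_minus field_simps)
    have "L n powr (- (\<tau> * D)) = (L n powr (- \<tau>)) ^ D"
      using Lpos[of n] by (simp add: powr_powr flip: powr_realpow)
    also have "\<dots> \<le> real Q ^ D" using Q(1) by (intro power_mono) auto
    finally have "L n powr (- (\<tau> * D)) * (1 / M * len n) \<le> real Q ^ D * (exp (- (C * D * (L n powr \<tau> * Q))) * len n)"
      using e lenpos[of n] by (intro mult_mono mult_right_mono) (auto simp: M_def)
    also have "\<dots> \<le> L n" by (rule count)
    finally have "L n powr (\<tau> * D) * (L n powr (- (\<tau> * D)) * (1 / M * len n)) \<le> L n powr (\<tau> * D) * L n"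
      by (intro mult_left_mono) auto
    then have "1 / M * len n \<le> L n powr (\<tau> * D) * L n"
      using Lpos[of n] by (simp flip: mult.assoc powr_add)
    also have "\<dots> = L n powr (1 + \<tau> * D)" using Lpos[of n] by (simp add: powr_add)
    finally have "len n \<le> M * L n powr (1 + \<tau> * D)" by (simp add: M_def field_simps)
    then have "len n powr \<tau> \<le> (M * L n powr (1 + \<tau> * D)) powr \<tau>"
      using lenpos[of n] \<tau> by (intro powr_mono2) auto
    also have "\<dots> = M powr \<tau> * L n powr (\<tau> * (1 + \<tau> * D))"
      using Lpos[of n] by (simp add: powr_mult powr_powr M_def mult.commute)
    \<comment> \<open>Here the condition on \<open>D\<close> enters: the exponent left after
      splitting off one factor \<open>L n\<close> is nonnegative, so that part is bounded by a power
      of \<open>d - c\<close>.\<close>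
    also have "L n powr (\<tau> * (1 + \<tau> * D)) = L n powr (\<tau> * (1 + \<tau> * D) - 1) * L n"
      using Lpos[of n] by (simp add: powr_diff)
    also have "M powr \<tau> * \<dots> \<le> M powr \<tau> * ((d - c) powr (\<tau> * (1 + \<tau> * D) - 1) * L n)"
      using Lpos[of n] Lle[of n] D by (intro mult_left_mono mult_right_mono powr_mono2) auto
    finally show ?thesis unfolding W_def by simp
  qed
  define R where "R = W * (2 * (d - c))"
  have cost: "word_cost \<tau> u b' (replicate n k) \<le> R" for n
  proof -
    have "word_cost \<tau> u b' (replicate n k) = (\<Sum>i<n. len i powr \<tau>)"
      unfolding word_cost_replicate len_def p_def ..
    also have "\<dots> \<le> (\<Sum>i<n. W * L i)" by (intro sum_mono lenbound)
    also have "\<dots> \<le> R" unfolding R_def sum_distrib_left[symmetric]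
      using Lsum[of n] by (intro mult_left_mono) (auto simp: W_def)
    finally show ?thesis .
  qed
  obtain Ck k' where k': "Ck \<ge> 0" "\<And>s. (k has_real_derivative k' s) (at s)" "\<And>s. k' s > 0"
    "\<And>s t. \<bar>ln (k' s) - ln (k' t)\<bar> \<le> Ck * \<bar>s - t\<bar> powr \<tau>"
    using line_diffeo_derivative[OF k(1)] by metis
  show False
  proof (rule kopell_contradiction[OF \<tau> f(1,3,4,5,7,8), of "exp (Ck * R)"])
    fix \<epsilon> :: real assume "\<epsilon> > 0"
    have "\<exists>n. L n < \<epsilon>"
    proof (rule ccontr)
      assume "\<not> ?thesis"
      then have ge: "\<epsilon> \<le> L n" for n by (simp add: not_less)
      obtain N :: nat where "N * \<epsilon> > 2 * (d - c)" using \<open>\<epsilon> > 0\<close> by (meson reals_Archimedean3)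
      moreover have "N * \<epsilon> \<le> (\<Sum>n<N. L n)" using sum_mono[of "{..<N}" "\<lambda>_. \<epsilon>" L] ge by simp
      ultimately show False using Lsum[of N] by simp
    qed
    then obtain n where n: "L n < \<epsilon>" by blast
    have "\<forall>g\<in>set (replicate n k). \<exists>g'. \<forall>s. (g has_real_derivative g' s) (at s) \<and> g' s > 0 \<and>
       (\<forall>t. \<bar>ln (g' s) - ln (g' t)\<bar> \<le> Ck * \<bar>s - t\<bar> powr \<tau>)"
      using k'(2-4) by (auto intro!: exI[of _ k'])
    from word_distortion[OF \<tau> k'(1) this, of u b']
    obtain w' where w': "\<And>s. (p n has_real_derivative w' s) (at s)" "\<And>s. w' s > 0"
      "\<And>s t. s\<in>{u..b'} \<Longrightarrow> t\<in>{u..b'} \<Longrightarrow> \<bar>ln (w' s) - ln (w' t)\<bar> \<le> Ck * word_cost \<tau> u b' (replicate n k)"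
      unfolding word_replicate p_def by blast
    have "w' s \<le> exp (Ck * R) * w' t" if "s\<in>{u..b'}" "t\<in>{u..b'}" for s t
    proof -
      have "ln (w' s) \<le> Ck * R + ln (w' t)"
        using w'(3)[OF that] mult_left_mono[OF cost[of n] k'(1)] by linarith
      then have "exp (ln (w' s)) \<le> exp (Ck * R + ln (w' t))" by simp
      then show ?thesis using w'(2)[of s] w'(2)[of t] by (simp add: exp_add)
    qed
    moreover have "p n b' - p n a' < \<epsilon>"
    proof -
      have "p n b' \<le> p n b" "p n a \<le> p n a'" using f(6,9) pm[of n] by (auto simp: strict_mono_less_eq)
      then show ?thesis using bL'[of n] n by linarith
    qed
    moreover have "p n (f t) = f (p n t)" for t unfolding p_def using funpow_commutes[of f k n t] f(2) by simp
    ultimately show "\<exists>w w'. (\<forall>t. (w has_real_derivative w' t) (at t) \<and> 0 < w' t \<and> w (f t) = f (w t)) \<and>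
        w b' - w a' < \<epsilon> \<and> (\<forall>s\<in>{u..b'}. \<forall>t\<in>{u..b'}. w' s \<le> exp (Ck * R) * w' t)"
      using w'(1,2) by (intro exI[of _ "p n"] exI[of _ w']) blast
  qed simp
qed

section \<open>Ping-pong\<close>

text \<open>A high iterate of \<open>f\<close> squeezes \<open>{p..b}\<close> into the part beyond
  \<open>q\<close>, to the right of \<open>g b\<close>, and \<open>g\<close> sends this part back
  between \<open>p\<close> and \<open>g b\<close>. The fixed point of the second map comes from the
  intermediate value theorem; it is what \<open>many_images_contradiction\<close> asks of its
  letters.\<close>

lemma ping_pong_pair:
  fixes f g :: "real \<Rightarrow> real"
  assumes f: "strict_mono f" "surj f" "continuous_on UNIV f" "f b = b" "\<forall>t\<in>{a<..<b}. f t > t"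
    and g: "strict_mono g" "surj g" "continuous_on UNIV g" "a < g b" "g b < b"
  obtains p m where "a < p" "p < b" "(f ^^ m) ` {p..b} \<subseteq> {p..b}" "(g \<circ> (f ^^ m)) ` {p..b} \<subseteq> {p..b}"
    "(f ^^ m) ` {p..b} \<inter> (g \<circ> (f ^^ m)) ` {p..b} = {}" "\<exists>q\<in>{p..b}. (g \<circ> (f ^^ m)) q = q"
proof -
  define p where "p = (a + g b) / 2"
  have p: "a < p" "p < g b" "p < b" unfolding p_def using g(4,5) by auto
  obtain r where r: "g r = p" using g(2) by (metis surjD)
  then have "r < b" using p g(1) by (metis strict_mono_less)
  define q where "q = (max (max (g b) r) p + b) / 2"
  have q: "g b < q" "r < q" "p < q" "q < b" unfolding q_def using \<open>r < b\<close> p g(5) by auto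
  obtain m where m: "(f ^^ m) p > q"
    using funpow_exceeds[of "{a<..<b}" f p q] f p q by (auto simp: is_interval_convex_1)
  define F where "F = f ^^ m"
  have Fm: "strict_mono F" unfolding F_def by (rule strict_mono_funpow[OF f(1)])
  have Fb: "F b = b" unfolding F_def using f(4) by (rule funpow_fixed)
  have im: "q < F t \<and> F t \<le> b" if "t \<in> {p..b}" for t
  proof -
    have "F p \<le> F t" "F t \<le> F b" using that Fm by (auto simp: strict_mono_less_eq)
    then show ?thesis using m Fb unfolding F_def by simp
  qed
  have img: "p < g (F t) \<and> g (F t) \<le> g b" if "t \<in> {p..b}" for t
  proof -
    have "g r < g (F t)" "g (F t) \<le> g b"
      using im[OF that] q(2) g(1) by (auto simp: strict_mono_less strict_mono_less_eq)
    then show ?thesis using r by simp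
  qed
  have "continuous_on UNIV F" unfolding F_def
    by (induction m) (auto intro: continuous_on_compose2[OF f(3)] simp: id_def)
  then have "continuous_on UNIV (g \<circ> F)"
    by (intro continuous_on_compose continuous_on_subset[OF g(3)]) auto
  then have "continuous_on {p..b} (g \<circ> F)" by (rule continuous_on_subset) simp
  then have "\<exists>x\<in>{p..b}. (g \<circ> F) x = x"
    using img[of p] img[of b] p g(5)
    by (intro IVT_fixed_point[of _ _ b p]) (auto simp: is_interval_cc)
  then show ?thesis
    using that[of p m] p im img q g(5) unfolding F_def[symmetric] by fastforce
qed

text \<open>After cancelling the common prefix, the first differing letters send the images into the
  disjoint images of \<open>X\<close> under \<open>F\<close> and \<open>G\<close>. Equal lengths
  prevent one word from being a prefix of the other.\<close>

lemma ping_pong_words_disjoint: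
  assumes "F ` X \<subseteq> X" "G ` X \<subseteq> X" "F ` X \<inter> G ` X = {}" "inj F" "inj G" "U \<subseteq> X"
    and "length gs = length hs" "set gs \<subseteq> {F, G}" "set hs \<subseteq> {F, G}" "gs \<noteq> hs"
  shows "word gs ` U \<inter> word hs ` U = {}"
  using assms(7-10)
proof (induction rule: list_induct2)
  case (Cons g gs h hs)
  have sub: "word fs ` U \<subseteq> X" if "set fs \<subseteq> {F, G}" for fs
    using that by (induction fs) (use assms(1,2,6) in auto)
  show ?case
  proof (cases "g = h")
    case True
    then have "word gs ` U \<inter> word hs ` U = {}" using Cons by auto
    moreover have "inj g" using Cons.prems assms(4,5) by auto
    ultimately have "g ` word gs ` U \<inter> g ` word hs ` U = {}" by (simp flip: image_Int)
    then show ?thesis using True by (simp add: image_comp)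
  next
    case False
    then have "g ` X \<inter> h ` X = {}" using Cons.prems assms(3) by auto
    moreover have "word (g # gs) ` U \<subseteq> g ` X" "word (h # hs) ` U \<subseteq> h ` X"
      using sub[of gs] sub[of hs] Cons.prems by auto
    ultimately show ?thesis by blast
  qed
qed simp

text \<open>As long as no proper suffix has an image shorter than \<open>\<delta>\<close>, every
  letter costs at least \<open>\<delta> powr \<tau>\<close>. A long cheap word therefore has a
  suffix with short image that is no more expensive.\<close>

lemma word_cost_or_short_suffix:
  assumes "\<delta> > 0" "\<tau> > 0"
  shows "(\<exists>as hs. gs = as @ hs \<and> word hs b - word hs a < \<delta> \<and> word_cost \<tau> a b hs \<le> word_cost \<tau> a b gs)
    \<or> word_cost \<tau> a b gs \<ge> length gs * \<delta> powr \<tau>"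
proof (induction gs)
  case (Cons g gs)
  consider (1) as hs where "gs = as @ hs" "word hs b - word hs a < \<delta>" "word_cost \<tau> a b hs \<le> word_cost \<tau> a b gs"
    | (2) "word_cost \<tau> a b gs \<ge> length gs * \<delta> powr \<tau>" using Cons by blast
  then show ?case
  proof cases
    case 1
    then have "g # gs = (g # as) @ hs" "word_cost \<tau> a b hs \<le> word_cost \<tau> a b (g # gs)"
      using powr_ge_zero[of "word gs b - word gs a" \<tau>] by (auto intro: add_increasing)
    then show ?thesis using 1(2) by blast
  next
    case 2
    show ?thesis
    proof (cases "word gs b - word gs a < \<delta>")
      case True
      then show ?thesis by (intro disjI1 exI[of _ "[g]"] exI[of _ gs]) auto
    next
      case False
      then have "\<delta> powr \<tau> \<le> (word gs b - word gs a) powr \<tau>" using assms by (intro powr_mono2) auto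
      then show ?thesis using 2 by (simp add: algebra_simps)
    qed
  qed
qed simp

text \<open>
  The \<open>2 ^ N\<close> words of length \<open>N\<close> map \<open>{c<..<d}\<close> to disjoint intervals, so on average over these
  words the \<open>\<tau>\<close>-th power of the length of the image decays like \<open>2 powr (- \<tau> * N)\<close>. Hence some long
  words have bounded distortion although the image of \<open>{c<..<d}\<close> is short.
\<close>

lemma free_words_contradiction:
  assumes \<tau>: "0 < \<tau>" "\<tau> \<le> 1"
    and FG: "line_diffeo \<tau> F" "line_diffeo \<tau> G" "F ` {p..b} \<subseteq> {p..b}" "G ` {p..b} \<subseteq> {p..b}"
      "F ` {p..b} \<inter> G ` {p..b} = {}" "\<And>t. F (k t) = k (F t)" "\<And>t. G (k t) = k (G t)"
    and k: "line_diffeo \<tau> k" "k c = c" "k d = d" "\<forall>t\<in>{c<..<d}. k t > t" "c < d" "p \<le> c" "d \<le> b"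
  shows False
proof -
  define Ws where "Ws = (\<lambda>N. {gs. set gs \<subseteq> {F, G} \<and> length gs = N})"
  define len where "len = (\<lambda>gs. word gs d - word gs c)"
  define B where "B = b - p"
  have "B > 0" unfolding B_def using k by auto
  have "F \<noteq> G" using FG(5) k(5-7) by fastforce
  then have card: "card (Ws N) = 2 ^ N" for N
    unfolding Ws_def using card_lists_length_eq[of "{F, G}" N] by (simp add: numeral_2_eq_2)
  have fin: "finite (Ws N)" for N unfolding Ws_def by (rule finite_lists_length_eq) simp
  have wm: "strict_mono (word gs) \<and> surj (word gs)" if "set gs \<subseteq> {F, G}" for gs
    using that
  proof (induction gs)
    case (Cons g gs)
    then have "strict_mono g" "surj g" using line_diffeoD(1,2)[OF FG(1)] line_diffeoD(1,2)[OF FG(2)] by auto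
    then show ?case using Cons comp_surj[of "word gs" g] by (auto simp: strict_mono_def)
  qed (auto simp: strict_mono_def)
  have lenpos: "len gs > 0" if "gs \<in> Ws N" for gs N
    using wm[of gs] that k(5) unfolding Ws_def len_def by (simp add: strict_mono_less)
  have sublen: "(\<Sum>gs\<in>Ws N. len gs) \<le> B" for N
    unfolding len_def B_def
  proof (rule sum_disjoint_intervals_le[OF fin])
    show "p \<le> b" using k by simp
    fix gs assume gs: "gs \<in> Ws N"
    have "word gs ` {p..b} \<subseteq> {p..b}" using gs unfolding Ws_def
    proof (induction gs arbitrary: N)
      case (Cons g gs)
      then show ?case using FG(3,4) by (auto simp: image_subset_iff)
    qed simp
    then have "word gs c \<in> {p..b}" "word gs d \<in> {p..b}" using k(5-7) by (simp_all add: image_subset_iff)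
    then show "p \<le> word gs c \<and> word gs c \<le> word gs d \<and> word gs d \<le> b"
      using lenpos[OF gs] unfolding len_def by simp
  next
    fix gs hs assume gh: "gs \<in> Ws N" "hs \<in> Ws N" "gs \<noteq> hs"
    have "word gs ` {c<..<d} \<inter> word hs ` {c<..<d} = {}"
      using gh unfolding Ws_def
      by (intro ping_pong_words_disjoint[OF FG(3,4,5) line_diffeoD(3)[OF FG(1)] line_diffeoD(3)[OF FG(2)]])
        (use k(5-7) in auto)
    then show "{word gs c<..<word gs d} \<inter> {word hs c<..<word hs d} = {}"
      using wm[of gs] wm[of hs] gh unfolding Ws_def by (simp add: strict_mono_surj_image_interval)
  qed
  define r where "r = (2 :: real) powr (- \<tau>)"
  have r: "0 < r" "r < 1" unfolding r_def using \<tau> powr_less_one[of 2 "- \<tau>"] by auto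
  have U: "(\<Sum>gs\<in>Ws N. len gs powr \<tau>) \<le> 2 ^ N * (r ^ N * (1 + B))" for N
  proof -
    define \<delta> where "\<delta> = (1 / 2 :: real) ^ N"
    have "\<delta> > 0" unfolding \<delta>_def by simp
    have \<delta>r: "\<delta> powr \<tau> = r ^ N"
      unfolding \<delta>_def r_def by (simp add: powr_minus powr_divide power_divide inverse_eq_divide
        powr_power powr_powr mult.commute flip: powr_realpow)
    \<comment> \<open>This replaces the concavity inequality for the mean of
      \<open>\<tau>\<close>-th powers: intervals up to the typical length \<open>\<delta>\<close>
      contribute at most \<open>\<delta> powr \<tau>\<close>, and longer ones are compared with
      their length, using \<open>\<tau> \<le> 1\<close>.\<close>
    have le: "len gs powr \<tau> \<le> \<delta> powr \<tau> + \<delta> powr (\<tau> - 1) * len gs" if "gs \<in> Ws N" for gs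
    proof (cases "len gs \<le> \<delta>")
      case True
      then have "len gs powr \<tau> \<le> \<delta> powr \<tau>" using lenpos[OF that] \<tau> by (intro powr_mono2) auto
      moreover have "\<delta> powr (\<tau> - 1) * len gs \<ge> 0" using lenpos[OF that] by simp
      ultimately show ?thesis by linarith
    next
      case False
      have "len gs powr \<tau> = len gs powr (\<tau> - 1) * len gs" using lenpos[OF that] by (simp add: powr_diff)
      also have "\<dots> \<le> \<delta> powr (\<tau> - 1) * len gs"
        using False \<open>\<delta> > 0\<close> \<tau> lenpos[OF that] by (intro mult_right_mono powr_mono2') auto
      finally show ?thesis using powr_ge_zero[of \<delta> \<tau>] by linarith
    qed
    have "(\<Sum>gs\<in>Ws N. len gs powr \<tau>) \<le> (\<Sum>gs\<in>Ws N. \<delta> powr \<tau> + \<delta> powr (\<tau> - 1) * len gs)"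
      by (intro sum_mono le)
    also have "\<dots> = 2 ^ N * \<delta> powr \<tau> + \<delta> powr (\<tau> - 1) * (\<Sum>gs\<in>Ws N. len gs)"
      by (simp add: sum.distrib card sum_distrib_left)
    also have "\<dots> \<le> 2 ^ N * \<delta> powr \<tau> + \<delta> powr (\<tau> - 1) * B"
      using sublen[of N] by (intro add_left_mono mult_left_mono) auto
    also have "\<delta> powr (\<tau> - 1) = 2 ^ N * \<delta> powr \<tau>"
      using \<open>\<delta> > 0\<close> by (simp add: powr_diff) (simp add: \<delta>_def power_divide)
    finally show ?thesis unfolding \<delta>r by (simp add: algebra_simps)
  qed
  define T where "T = (\<lambda>N. \<Sum>gs\<in>Ws N. word_cost \<tau> c d gs)"
  \<comment> \<open>Every word of length \<open>N\<close> extends at the front by two letters, and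
    either extension adds the same cost. Divided by the number of words, this is the recursion of a
    geometric series with ratio \<open>r\<close>.\<close>
  have T_Suc: "T (Suc N) = 2 * ((\<Sum>gs\<in>Ws N. len gs powr \<tau>) + T N)" for N
  proof -
    have "Ws (Suc N) = (\<lambda>(g, gs). g # gs) ` ({F, G} \<times> Ws N)"
    proof (intro subset_antisym subsetI)
      fix gs assume "gs \<in> Ws (Suc N)"
      then obtain h hs where "gs = h # hs" "h \<in> {F, G}" "hs \<in> Ws N"
        unfolding Ws_def by (cases gs) auto
      then show "gs \<in> (\<lambda>(g, gs). g # gs) ` ({F, G} \<times> Ws N)" by force
    qed (auto simp: Ws_def)
    moreover have "inj_on (\<lambda>(g, gs). g # gs) ({F, G} \<times> Ws N)" by (auto simp: inj_on_def)
    ultimately have "T (Suc N) = (\<Sum>(g, gs)\<in>{F, G} \<times> Ws N. len gs powr \<tau> + word_cost \<tau> c d gs)"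
      unfolding T_def by (simp add: sum.reindex case_prod_unfold len_def)
    also have "\<dots> = (\<Sum>g\<in>{F, G}. \<Sum>gs\<in>Ws N. len gs powr \<tau> + word_cost \<tau> c d gs)"
      by (rule sum.cartesian_product[symmetric])
    also have "\<dots> = 2 * ((\<Sum>gs\<in>Ws N. len gs powr \<tau>) + T N)"
      using \<open>F \<noteq> G\<close> by (simp add: sum.distrib T_def)
    finally show ?thesis .
  qed
  have T: "T N \<le> 2 ^ N * ((1 + B) * (\<Sum>i<N. r ^ i))" for N
  proof (induction N)
    case (Suc N)
    have "T (Suc N) \<le> 2 * (2 ^ N * (r ^ N * (1 + B)) + 2 ^ N * ((1 + B) * (\<Sum>i<N. r ^ i)))"
      unfolding T_Suc using U[of N] Suc by simp
    then show ?case by (simp add: algebra_simps)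
  qed (auto simp: T_def Ws_def)
  define M where "M = (1 + B) * (1 / (1 - r))"
  have cheap: "\<exists>gs\<in>Ws N. word_cost \<tau> c d gs \<le> M" for N
  proof (rule ccontr)
    assume "\<not> ?thesis"
    then have "M < word_cost \<tau> c d gs" if "gs \<in> Ws N" for gs using that by (auto simp: not_le)
    moreover have "Ws N \<noteq> {}" using card[of N] by auto
    ultimately have "(\<Sum>gs\<in>Ws N. M) < T N" unfolding T_def using fin by (intro sum_strict_mono) auto
    moreover have "(\<Sum>i<N. r ^ i) \<le> 1 / (1 - r)"
      using r by (simp add: sum_gp_strict divide_right_mono)
    then have "2 ^ N * ((1 + B) * (\<Sum>i<N. r ^ i)) \<le> 2 ^ N * M" unfolding M_def
      using \<open>B > 0\<close> by (intro mult_left_mono) auto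
    ultimately show False using T[of N] card[of N] by simp
  qed
  obtain C1 F' where C1: "C1 \<ge> 0" "\<And>s. (F has_real_derivative F' s) (at s)" "\<And>s. F' s > 0"
    "\<And>s t. \<bar>ln (F' s) - ln (F' t)\<bar> \<le> C1 * \<bar>s - t\<bar> powr \<tau>"
    using line_diffeo_derivative[OF FG(1)] by metis
  obtain C2 G' where C2: "C2 \<ge> 0" "\<And>s. (G has_real_derivative G' s) (at s)" "\<And>s. G' s > 0"
    "\<And>s t. \<bar>ln (G' s) - ln (G' t)\<bar> \<le> C2 * \<bar>s - t\<bar> powr \<tau>"
    using line_diffeo_derivative[OF FG(2)] by metis
  define C where "C = C1 + C2"
  have C: "C \<ge> 0" unfolding C_def using C1 C2 by simp
  have C12: "C1 * x powr \<tau> \<le> C * x powr \<tau>" "C2 * x powr \<tau> \<le> C * x powr \<tau>" for x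
    unfolding C_def using C1(1) C2(1) by (simp_all add: mult_right_mono)
  have FGd: "\<exists>g'. \<forall>s. (g has_real_derivative g' s) (at s) \<and> g' s > 0 \<and>
       (\<forall>t. \<bar>ln (g' s) - ln (g' t)\<bar> \<le> C * \<bar>s - t\<bar> powr \<tau>)" if g: "g \<in> {F, G}" for g
  proof -
    consider "g = F" | "g = G" using g by auto
    then show ?thesis
    proof cases
      case 1
      then show ?thesis
        using C1(2,3) order_trans[OF C1(4) C12(1)] by (intro exI[of _ F']) simp
    next
      case 2
      then show ?thesis
        using C2(2,3) order_trans[OF C2(4) C12(2)] by (intro exI[of _ G']) simp
    qed
  qed
  define u where "u = (c + d) / 2"
  have u: "c < u" "u < d" unfolding u_def using k by auto
  show False
  \<comment> \<open>Here \<open>k\<close> is the map that is iterated, and the words in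
    \<open>F\<close> and \<open>G\<close> are the commuting maps that shrink its component.\<close>
  proof (rule kopell_contradiction[OF \<tau>(1) k(1,2,3,4) u, of "exp (C * M)"])
    fix \<epsilon> :: real assume "\<epsilon> > 0"
    then have "\<epsilon> powr \<tau> > 0" by simp
    then obtain N :: nat where N: "N * \<epsilon> powr \<tau> > M" by (meson reals_Archimedean3)
    obtain gs where gs: "gs \<in> Ws N" "word_cost \<tau> c d gs \<le> M" using cheap by blast
    then have "\<not> word_cost \<tau> c d gs \<ge> length gs * \<epsilon> powr \<tau>" using N unfolding Ws_def by simp
    then obtain as hs where hs: "gs = as @ hs" "word hs d - word hs c < \<epsilon>" "word_cost \<tau> c d hs \<le> word_cost \<tau> c d gs"
      using word_cost_or_short_suffix[OF \<open>\<epsilon> > 0\<close> \<tau>(1), of gs d c] by blast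
    have hsFG: "set hs \<subseteq> {F, G}" using gs hs unfolding Ws_def by auto
    have "\<forall>g\<in>set hs. \<exists>g'. \<forall>s. (g has_real_derivative g' s) (at s) \<and> g' s > 0 \<and>
       (\<forall>t. \<bar>ln (g' s) - ln (g' t)\<bar> \<le> C * \<bar>s - t\<bar> powr \<tau>)" using FGd hsFG by blast
    from word_distortion[OF \<tau>(1) C this, of c d]
    obtain w' where w': "\<And>s. (word hs has_real_derivative w' s) (at s)" "\<And>s. w' s > 0"
      "\<And>s t. s\<in>{c..d} \<Longrightarrow> t\<in>{c..d} \<Longrightarrow> \<bar>ln (w' s) - ln (w' t)\<bar> \<le> C * word_cost \<tau> c d hs"
      by blast
    have "w' s \<le> exp (C * M) * w' t" if st: "s\<in>{u..d}" "t\<in>{u..d}" for s t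
    proof -
      have "C * word_cost \<tau> c d hs \<le> C * M" using gs hs C by (intro mult_left_mono) auto
      then have "ln (w' s) \<le> C * M + ln (w' t)"
        using w'(3)[of s t] st u by auto
      then have "exp (ln (w' s)) \<le> exp (C * M + ln (w' t))" by simp
      then show ?thesis using w'(2)[of s] w'(2)[of t] by (simp add: exp_add)
    qed
    moreover have "word hs (k t) = k (word hs t)" for t
      using word_commutes[of hs k t] hsFG FG(6,7) by (metis insertE singletonD subsetD)
    ultimately show "\<exists>w w'. (\<forall>t. (w has_real_derivative w' t) (at t) \<and> 0 < w' t \<and> w (k t) = k (w t)) \<and>
        w d - w c < \<epsilon> \<and> (\<forall>s\<in>{u..d}. \<forall>t\<in>{u..d}. w' s \<le> exp (C * M) * w' t)"
      using w'(1,2) hs(2) by (intro exI[of _ "word hs"] exI[of _ w']) blast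
  qed simp
qed

section \<open>Commuting groups of line diffeomorphisms\<close>

text \<open>The notation \<open>inv\<close> is occupied by the inverse in HOL-Algebra.\<close>

abbreviation inv_fun :: "('a \<Rightarrow> 'b) \<Rightarrow> 'b \<Rightarrow> 'a"
  where "inv_fun \<equiv> inv_into UNIV"

lemma support_componentI:
  assumes "a < b" "f a = a" "f b = b" "\<And>t. a < t \<Longrightarrow> t < b \<Longrightarrow> f t \<noteq> t"
  shows "support_component f {a<..<b}"
  unfolding support_component_def using assms by (metis greaterThanLessThan_iff)

text \<open>An exponent at most 1 is what the averaging over words requires. Lifts of circle maps
  have it after passing to \<open>min \<tau> 1\<close>, because the circle is bounded.\<close>

locale line_group =
  fixes \<tau> :: real and S :: "(real \<Rightarrow> real) set"
  assumes exponent: "0 < \<tau>" "\<tau> \<le> 1"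
    and diffeo: "f \<in> S \<Longrightarrow> line_diffeo \<tau> f"
    and id_mem: "id \<in> S"
    and comp_mem: "f \<in> S \<Longrightarrow> g \<in> S \<Longrightarrow> f \<circ> g \<in> S"
    and inv_mem: "f \<in> S \<Longrightarrow> inv_fun f \<in> S"
begin

lemma mono: "f \<in> S \<Longrightarrow> strict_mono f"
  and surj: "f \<in> S \<Longrightarrow> surj f"
  and inj: "f \<in> S \<Longrightarrow> inj f"
  and cont: "f \<in> S \<Longrightarrow> continuous_on A f"
  using line_diffeoD[OF diffeo] by auto

lemma less_iff: "f \<in> S \<Longrightarrow> f x < f y \<longleftrightarrow> x < y"
  using mono by (simp add: strict_mono_less)

lemma le_iff: "f \<in> S \<Longrightarrow> f x \<le> f y \<longleftrightarrow> x \<le> y"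
  using mono by (simp add: strict_mono_less_eq)

lemma inv_apply [simp]: "f \<in> S \<Longrightarrow> inv_fun f (f x) = x" "f \<in> S \<Longrightarrow> f (inv_fun f x) = x"
  using inj surj by (auto simp: surj_f_inv_f)

lemma inv_fixed: "f \<in> S \<Longrightarrow> f x = x \<Longrightarrow> inv_fun f x = x"
  by (metis inv_apply(1))

lemma funpow_mem: "f \<in> S \<Longrightarrow> f ^^ n \<in> S"
  by (induction n) (auto intro: id_mem comp_mem)

lemma component_exists: "f \<in> S \<Longrightarrow> f x \<noteq> x \<Longrightarrow> \<exists>J. support_component f J \<and> x \<in> J"
  using support_component_exists diffeo by blast

lemma component_sign:
  assumes "f \<in> S" "support_component f J"
  shows "(\<forall>t\<in>J. f t > t) \<or> (\<forall>t\<in>J. f t < t)"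
  using fixed_point_free_sign[OF support_component_interval[OF assms(2)] cont[OF assms(1)]] assms(2)
  unfolding support_component_def by blast

lemma orient_up:
  assumes f: "f \<in> S" and J: "support_component f {a<..<b}" and "a < b"
  obtains f1 where "f1 \<in> S" "f1 = f \<or> f1 = inv_fun f" "support_component f1 {a<..<b}" "f1 a = a" "f1 b = b"
    "\<forall>t\<in>{a<..<b}. f1 t > t"
proof -
  have "{a<..<b} \<noteq> UNIV" by auto
  then obtain a' b' where ab: "a' < b'" "{a<..<b} = {a'<..<b'}" "f a' = a'" "f b' = b'"
    using J unfolding support_component_def by auto
  then have "a' = a" "b' = b" using open_interval_eqD[OF \<open>a < b\<close>] by auto
  then have ends: "f a = a" "f b = b" using ab by auto
  from component_sign[OF f J] show ?thesis
  proof
    assume "\<forall>t\<in>{a<..<b}. f t > t"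
    then show ?thesis using that[OF f] J ends by blast
  next
    assume down: "\<forall>t\<in>{a<..<b}. f t < t"
    have "inv_fun f t > t" if t: "t \<in> {a<..<b}" for t
    proof -
      have "a < inv_fun f t \<and> inv_fun f t < b"
        using t less_iff[OF f, of a "inv_fun f t"] less_iff[OF f, of "inv_fun f t" b] f ends by simp
      then have "f (inv_fun f t) < inv_fun f t" using down by auto
      then show ?thesis using f by simp
    qed
    moreover from this have "support_component (inv_fun f) {a<..<b}"
      using inv_fixed[OF f] ends \<open>a < b\<close> by (intro support_componentI) fastforce+
    ultimately show ?thesis using that[OF inv_mem[OF f]] inv_fixed[OF f] ends by blast
  qed
qed

end

text \<open>Conjugation by \<open>t \<mapsto> - t\<close>. It interchanges the two ends of an
  interval, so results on crossings at right ends transfer to left ends.\<close>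

definition reflect :: "(real \<Rightarrow> real) \<Rightarrow> real \<Rightarrow> real"
  where "reflect f = (\<lambda>t. - f (- t))"

lemma line_diffeo_reflect:
  assumes "line_diffeo \<tau> f"
  shows "line_diffeo \<tau> (reflect f)"
proof -
  have m: "strict_mono (reflect f)"
    using line_diffeoD(1)[OF assms] by (auto simp: reflect_def strict_mono_def)
  have s: "surj (reflect f)"
  proof (rule surjI)
    show "reflect f (reflect (inv_fun f) t) = t" for t
      using line_diffeoD(2)[OF assms] by (simp add: reflect_def surj_f_inv_f)
  qed
  have fx: "reflect f t = t \<longleftrightarrow> f (- t) = - t" for t by (auto simp: reflect_def)
  have fix_unbounded: "(\<exists>t<x. reflect f t = t) \<and> (\<exists>t>x. reflect f t = t)" if "reflect f z = z" for x z
  proof -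
    have "(\<exists>t<(- x). f t = t) \<and> (\<exists>t>(- x). f t = t)"
      using assms that fx unfolding line_diffeo_def by blast
    then obtain t t' where "t < - x" "f t = t" "t' > - x" "f t' = t'" by blast
    then show ?thesis by (intro conjI exI[of _ "- t"] exI[of _ "- t'"]) (auto simp: fx)
  qed
  obtain C f' where f': "\<And>s. (f has_real_derivative f' s) (at s)" "\<And>s. f' s > 0"
    "\<And>s t. \<bar>ln (f' s) - ln (f' t)\<bar> \<le> C * \<bar>s - t\<bar> powr \<tau>"
    using line_diffeo_derivative[OF assms] by metis
  have 1: "(reflect f has_real_derivative f' (- s)) (at s)" for s
    unfolding reflect_def by (rule derivative_eq_intros DERIV_chain2[OF f'(1)] refl | simp)+
  have 2: "\<bar>ln (f' (- s)) - ln (f' (- t))\<bar> \<le> C * \<bar>s - t\<bar> powr \<tau>" for s t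
    using f'(3)[of "- s" "- t"] by (simp add: abs_minus_commute)
  have "\<exists>C f'. \<forall>s. (reflect f has_real_derivative f' s) (at s) \<and> f' s > 0 \<and>
       (\<forall>t. \<bar>ln (f' s) - ln (f' t)\<bar> \<le> C * \<bar>s - t\<bar> powr \<tau>)"
    by (intro exI[of _ C] exI[of _ "\<lambda>s. f' (- s)"]) (simp add: 1 2 f'(2))
  moreover have "(\<exists>t. reflect f t = t) \<longrightarrow> (\<forall>x. (\<exists>t<x. reflect f t = t) \<and> (\<exists>t>x. reflect f t = t))"
    by (intro impI allI, erule exE, rule fix_unbounded)
  ultimately show ?thesis unfolding line_diffeo_def using m s by simp
qed

lemma line_group_reflect:
  assumes "line_group \<tau> S"
  shows "line_group \<tau> (reflect ` S)"
proof -
  interpret line_group \<tau> S by fact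
  show ?thesis
  proof
    show "id \<in> reflect ` S" using id_mem by (auto simp: reflect_def image_iff id_def intro!: bexI[of _ id])
  next
    fix f g assume "f \<in> reflect ` S" "g \<in> reflect ` S"
    then obtain f' g' where *: "f' \<in> S" "g' \<in> S" "f = reflect f'" "g = reflect g'" by auto
    then have "f \<circ> g = reflect (f' \<circ> g')" by (auto simp: reflect_def)
    then show "f \<circ> g \<in> reflect ` S" using * comp_mem by blast
  next
    fix f assume "f \<in> reflect ` S"
    then obtain f' where *: "f' \<in> S" "f = reflect f'" by auto
    have "inv_fun f = reflect (inv_fun f')"
    proof (rule inv_equality)
      show "reflect (inv_fun f') (f x) = x" "f (reflect (inv_fun f') x) = x" for x
        using * by (simp_all add: reflect_def)
    qed
    then show "inv_fun f \<in> reflect ` S" using * inv_mem by blast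
  qed (use exponent diffeo line_diffeo_reflect in auto)
qed

section \<open>Crossings in one group, seen by the commuting group\<close>

locale commuting_line_groups = S: line_group \<tau> S + K: line_group \<tau> K for \<tau> S K +
  assumes commute: "f \<in> S \<Longrightarrow> k \<in> K \<Longrightarrow> f (k t) = k (f t)"
begin

lemma swap: "commuting_line_groups \<tau> K S"
  by unfold_locales (simp add: commute)

lemma reflected: "commuting_line_groups \<tau> (reflect ` S) (reflect ` K)"
proof -
  interpret S': line_group \<tau> "reflect ` S" by (rule line_group_reflect) unfold_locales
  interpret K': line_group \<tau> "reflect ` K" by (rule line_group_reflect) unfold_locales
  show ?thesis
  proof
    fix f k t assume "f \<in> reflect ` S" "k \<in> reflect ` K"
    then obtain f' k' where "f' \<in> S" "k' \<in> K" "f = reflect f'" "k = reflect k'" by blast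
    then show "f (k t) = k (f t)" using commute[of f' k' "- t"] by (simp add: reflect_def)
  qed
qed

lemma image_component:
  assumes "f \<in> S" "k \<in> K" "support_component f J"
  shows "k ` J = J \<or> k ` J \<inter> J = {}"
  using support_component_unique[OF support_component_image[OF assms(3) K.mono K.surj] assms(3)]
    assms(1,2) commute by blast

lemma displaced_interval:
  assumes k: "k \<in> K" "k c = c" "k d = d" "\<forall>t\<in>{c<..<d}. k t > t"
    and sub: "{a<..<b} \<subseteq> {c<..<d}" "a < b" and dis: "k ` {a<..<b} \<inter> {a<..<b} = {}"
  shows "c < a" "b \<le> k a" "b < d"
proof -
  have cd: "c \<le> a" "b \<le> d" using sub by (auto simp: greaterThanLessThan_subseteq_greaterThanLessThan)
  have dis': "{k a<..<k b} \<inter> {a<..<b} = {}"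
    using dis strict_mono_surj_image_interval(1)[OF K.mono K.surj] k by metis
  have kab: "k a < k b" using sub K.less_iff[OF k(1)] by simp
  have ka: "k a \<ge> a" using cd sub k by (cases "c = a") (auto simp: less_imp_le)
  show 1: "b \<le> k a"
  proof (rule ccontr)
    assume "\<not> ?thesis"
    then have "(k a + min (k b) b) / 2 \<in> {k a<..<k b} \<inter> {a<..<b}" using kab ka sub by auto
    then show False using dis' by blast
  qed
  show "c < a" using 1 cd sub k by (cases "c = a") auto
  show "b < d" using 1 cd sub K.less_iff[OF k(1), of a d] k by auto
qed

text \<open>The crossing makes \<open>f\<close> and \<open>g\<close> play ping-pong near
  \<open>b\<close>. A component of \<open>k\<close> meeting \<open>{a<..<b}\<close> is nested with
  it. If it is larger, \<open>k\<close> displaces \<open>{a<..<b}\<close> and the exponentially many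
  ping-pong words give more than enough disjoint images; if it is smaller, the ping-pong words
  shrink it with bounded distortion.\<close>

lemma crossing_trivial_right:
  assumes f: "f \<in> S" "f a = a" "f b = b" "\<forall>t\<in>{a<..<b}. f t > t"
    and g: "g \<in> S" "a < g b" "g b < b" and k: "k \<in> K" "k z = z" and t: "t \<in> {a<..<b}"
  shows "k t = t"
proof (rule ccontr)
  assume "k t \<noteq> t"
  then obtain B where B: "support_component k B" "t \<in> B" using K.component_exists[OF k(1)] by blast
  then have "B \<noteq> UNIV" using k unfolding support_component_def by auto
  then obtain c d where cd: "c < d" "B = {c<..<d}" "k c = c" "k d = d"
    using B unfolding support_component_def by auto
  have "a < b" using t by auto
  have A: "support_component f {a<..<b}"    by (rule support_componentI[OF \<open>a < b\<close> f(2,3)]) (metis f(4) greaterThanLessThan_iff less_irrefl)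
  obtain k1 where k1: "k1 \<in> K" "k1 = k \<or> k1 = inv_fun k" "support_component k1 {c<..<d}" "k1 c = c" "k1 d = d"
    "\<forall>t\<in>{c<..<d}. k1 t > t"
    using K.orient_up[OF k(1), of c d] B cd by blast
  have meet: "{a<..<b} \<inter> {c<..<d} \<noteq> {}" using t B cd by auto
  obtain p m where pm: "a < p" "p < b" "(f ^^ m) ` {p..b} \<subseteq> {p..b}" "(g \<circ> (f ^^ m)) ` {p..b} \<subseteq> {p..b}"
    "(f ^^ m) ` {p..b} \<inter> (g \<circ> (f ^^ m)) ` {p..b} = {}" "\<exists>q\<in>{p..b}. (g \<circ> (f ^^ m)) q = q"
    using ping_pong_pair[OF S.mono[OF f(1)] S.surj[OF f(1)] S.cont[OF f(1)] f(3,4)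
      S.mono[OF g(1)] S.surj[OF g(1)] S.cont[OF g(1)] g(2,3)] by metis
  define F where "F = f ^^ m"
  define G where "G = g \<circ> (f ^^ m)"
  have FG: "F \<in> S" "G \<in> S" unfolding F_def G_def using S.funpow_mem[OF f(1)] S.comp_mem g(1) by auto
  note pp = pm(3-6)[folded G_def, folded F_def]
  have nest: "{a<..<b} \<subseteq> {c<..<d} \<or> {c<..<d} \<subseteq> {a<..<b}"
    "{a<..<b} \<subset> {c<..<d} \<Longrightarrow> k1 ` {a<..<b} \<inter> {a<..<b} = {}"
    using support_component_nested[OF A k1(3) K.mono[OF k1(1)] K.surj[OF k1(1)] image_component[OF f(1) k1(1) A] meet]
    by auto
  interpret sw: commuting_line_groups \<tau> K S by (rule swap)
  have nest': "{c<..<d} \<subset> {a<..<b} \<Longrightarrow> f ` {c<..<d} \<inter> {c<..<d} = {}"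
    using support_component_nested(2)[OF k1(3) A S.mono[OF f(1)] S.surj[OF f(1)] sw.image_component[OF k1(1) f(1) k1(3)]] meet
    by auto
  consider "{a<..<b} = {c<..<d}" | "{a<..<b} \<subset> {c<..<d}" | "{c<..<d} \<subset> {a<..<b}" using nest by blast
  then show False
  proof cases
    case 1
    \<comment> \<open>Equal intervals: \<open>k\<close> fixes \<open>b\<close> and commutes with
      \<open>g\<close>, so it fixes \<open>g b\<close>, which lies inside its own component.\<close>
    then have "b = d" using open_interval_eqD[OF \<open>a < b\<close>] by auto
    then have "k (g b) = g b" using commute[OF g(1) k(1), of b] cd by simp
    moreover have "g b \<in> B" using 1 cd g by auto
    ultimately show False using B(1) unfolding support_component_def by blast
  next
    case 2
    then have dis: "c < a" "b \<le> k1 a" "b < d"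
      using displaced_interval[OF k1(1,4,5,6) _ \<open>a < b\<close> nest(2)] by auto
    \<comment> \<open>Any depth \<open>D\<close> is available here, because the
      \<open>2 ^ (D * Q)\<close> words of length \<open>D * Q\<close> outnumber
      \<open>Q ^ D\<close>.\<close>
    obtain D :: nat where D: "1 / \<tau>\<^sup>2 \<le> D" using real_arch_simple by blast
    show False
    proof (rule many_images_contradiction[OF S.exponent(1) K.diffeo[OF k1(1)] k1(4,5,6) dis(1) \<open>a < b\<close> dis(2,3)
        S.diffeo[OF f(1)] commute[OF f(1) k1(1)] f(2,3,4) order_refl pm(1,2) order_refl,
        of "{F, G}" "{p..b}" D])
      show "1 \<le> \<tau> * (1 + \<tau> * D)"
      proof -
        have "1 \<le> \<tau>\<^sup>2 * D" using D S.exponent by (simp add: field_simps)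
        then show ?thesis using S.exponent by (simp add: algebra_simps power2_eq_square)
      qed
      show "e \<in> {F, G} \<Longrightarrow> line_diffeo \<tau> e" for e using FG S.diffeo by auto
      show "e \<in> {F, G} \<Longrightarrow> e (k1 t) = k1 (e t)" for e t using FG commute k1(1) by auto
      show "e \<in> {F, G} \<Longrightarrow> \<exists>q\<in>{a..b}. e q = q" for e
        using pp(4) pm(1,2) f(3) funpow_fixed[of f b m] unfolding F_def
        by (auto intro: bexI[of _ b])
      show "e \<in> {F, G} \<Longrightarrow> e ` {p..b} \<subseteq> {p..b}" for e using pp by auto
      show "{p..b} \<subseteq> {a..b}" using pm by auto
      fix Q
      have "F \<noteq> G" using pp(3) pm(2) by fastforce
      define Y where "Y = {gs. set gs \<subseteq> {F, G} \<and> length gs = D * Q}"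
      have "finite Y" unfolding Y_def by (rule finite_lists_length_eq) simp
      moreover have "Q ^ D \<le> card Y"
      proof -
        have "card Y = 2 ^ (D * Q)" unfolding Y_def
          using card_lists_length_eq[of "{F, G}" "D * Q"] \<open>F \<noteq> G\<close> by (simp add: numeral_2_eq_2)
        also have "\<dots> = (2 ^ Q) ^ D" by (metis power_mult mult.commute)
        finally show ?thesis by (simp add: power_mono less_imp_le)
      qed
      moreover have "word gs ` {p<..<b} \<inter> word hs ` {p<..<b} = {}"
        if "gs \<in> Y" "hs \<in> Y" "gs \<noteq> hs" for gs hs
        using that unfolding Y_def
        by (intro ping_pong_words_disjoint[OF pp(1,2,3) S.inj[OF FG(1)] S.inj[OF FG(2)]]) auto
      ultimately show "\<exists>Y. finite Y \<and> Q ^ D \<le> card Y \<and>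
          (\<forall>gs\<in>Y. set gs \<subseteq> {F, G} \<and> length gs \<le> D * Q) \<and>
          (\<forall>gs\<in>Y. \<forall>hs\<in>Y. gs \<noteq> hs \<longrightarrow> word gs ` {p<..<b} \<inter> word hs ` {p<..<b} = {})"
        by (intro exI[of _ Y]) (auto simp: Y_def)
    qed simp_all
  next
    case 3
    have "a < c"
      using sw.displaced_interval(1)[OF f(1,2,3,4) _ cd(1) nest'] 3 by blast
    \<comment> \<open>An iterate of \<open>f\<close> carries the component of \<open>k1\<close> into
      \<open>{p..b}\<close>, where the ping-pong takes place; since \<open>f\<close> commutes with
      \<open>k1\<close>, the latter still moves all points of the image up.\<close>
    have "c \<in> {a<..<b}" "d \<le> b" using 3 cd(1) \<open>a < c\<close>
      by (auto simp: greaterThanLessThan_subseteq_greaterThanLessThan psubset_eq)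
    then obtain n where n: "(f ^^ n) c > p"
      using funpow_exceeds[of "{a<..<b}" f c p] S.mono[OF f(1)] S.surj[OF f(1)] f(4) pm(1,2)
      by (auto simp: is_interval_convex_1)
    define h where "h = f ^^ n"
    have h: "h \<in> S" unfolding h_def using S.funpow_mem[OF f(1)] .
    have hk: "k1 (h t) = h (k1 t)" for t using commute[OF h k1(1), of t] by simp
    have "h d \<le> b" using \<open>d \<le> b\<close> S.le_iff[OF h, of d b] f(3) unfolding h_def by (simp add: funpow_fixed)
    have up: "\<forall>t\<in>{h c<..<h d}. k1 t > t"
    proof
      fix t assume "t \<in> {h c<..<h d}"
      then have "t \<in> h ` {c<..<d}"
        using strict_mono_surj_image_interval(1)[OF S.mono[OF h] S.surj[OF h], of c d] by simp
      then obtain s where "s \<in> {c<..<d}" "t = h s" by blast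
      then show "k1 t > t" using hk k1(6) S.less_iff[OF h] by simp
    qed
    show False
      by (rule free_words_contradiction[OF S.exponent S.diffeo[OF FG(1)] S.diffeo[OF FG(2)] pp(1,2,3)
          commute[OF FG(1) k1(1)] commute[OF FG(2) k1(1)] K.diffeo[OF k1(1)], of "h c" "h d"])
        (use up hk k1(4,5) n \<open>h d \<le> b\<close> S.less_iff[OF h] cd(1) in \<open>auto simp: h_def\<close>)
  qed
qed

text \<open>If the image of \<open>A\<close> overlaps \<open>A\<close> without being equal to it,
  then \<open>g\<close> or its inverse moves an endpoint of \<open>A\<close> into \<open>A\<close>.
  For a right endpoint this is the previous lemma; for a left endpoint it follows by
  reflection.\<close>

lemma crossing_trivial:
  assumes f: "f \<in> S" "support_component f A" and g: "g \<in> S" "g ` A \<inter> A \<noteq> {}" "g ` A \<noteq> A"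
    and k: "k \<in> K" "k z = z" and t: "t \<in> A"
  shows "k t = t"
proof -
  have "A \<noteq> UNIV" using g S.surj by blast
  then obtain a b where ab: "a < b" "A = {a<..<b}" using f unfolding support_component_def by auto
  obtain f1 where f1: "f1 \<in> S" "f1 a = a" "f1 b = b" "\<forall>t\<in>{a<..<b}. f1 t > t"
    using S.orient_up[OF f(1)] f(2) ab by metis
  have right: ?thesis if "h \<in> S" "a < h b" "h b < b" for h
    using crossing_trivial_right[OF f1 that k] t ab by simp
  have left: ?thesis if h: "h \<in> S" "a < h a" "h a < b" for h
  proof -
    interpret R: commuting_line_groups \<tau> "reflect ` S" "reflect ` K" by (rule reflected)
    \<comment> \<open>Reflection reverses the direction of motion, so the inverse of
      \<open>f1\<close> is needed to obtain a map that moves points up.\<close>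
    have inv1: "inv_fun f1 \<in> S" using S.inv_mem f1 by blast
    have "reflect k (- t) = - t"
    proof (rule R.crossing_trivial_right)
      show "reflect (inv_fun f1) \<in> reflect ` S" "reflect h \<in> reflect ` S" "reflect k \<in> reflect ` K"
        using inv1 h k by auto
      show "reflect (inv_fun f1) (- b) = - b" "reflect (inv_fun f1) (- a) = - a"
        using f1 S.inv_fixed by (auto simp: reflect_def)
      show "\<forall>t\<in>{- b<..<- a}. t < reflect (inv_fun f1) t"
      proof
        fix s assume s: "s \<in> {- b<..<- a}"
        have "a < inv_fun f1 (- s) \<and> inv_fun f1 (- s) < b"
          using s S.less_iff[OF f1(1), of a "inv_fun f1 (- s)"] S.less_iff[OF f1(1), of "inv_fun f1 (- s)" b] f1
          by auto
        then show "s < reflect (inv_fun f1) s"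
          using bspec[OF f1(4), of "inv_fun f1 (- s)"] f1(1) by (simp add: reflect_def)
      qed
      show "- b < reflect h (- a)" "reflect h (- a) < - a" using h by (auto simp: reflect_def)
      show "reflect k (- z) = - z" using k by (simp add: reflect_def)
      show "- t \<in> {- b<..<- a}" using t ab by auto
    qed
    then show ?thesis by (simp add: reflect_def)
  qed
  have im: "g ` A = {g a<..<g b}"
    unfolding ab using strict_mono_surj_image_interval(1)[OF S.mono S.surj] g(1) by blast
  have meet: "g a < b" "a < g b" using g(2)[unfolded im] ab(2) by auto
  have ne: "g a \<noteq> a \<or> g b \<noteq> b" using g(3)[unfolded im] ab(2) by auto
  have gi: "inv_fun g \<in> S" "g (inv_fun g x) = x" for x using S.inv_mem[OF g(1)] g(1) by auto
  consider "a < g a" | "g b < b" | "g a < a" | "g b > b" using ne by linarith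
  then show ?thesis
  proof cases
    case 3
    then show ?thesis using left[OF gi(1)] S.less_iff[OF g(1), of a "inv_fun g a"] S.less_iff[OF g(1), of "inv_fun g a" b] gi(2) meet
      by simp
  next
    case 4
    then show ?thesis using right[OF gi(1)] S.less_iff[OF g(1), of a "inv_fun g b"] S.less_iff[OF g(1), of "inv_fun g b" b] gi(2) meet
      by simp
  qed (use left[OF g(1)] right[OF g(1)] meet in auto)
qed

end

section \<open>Hoelder's theorem modulo elements with fixed points\<close>

text \<open>The condition \<open>fixed_comp\<close> replaces freeness of the action. In a free
  action it is trivial, since only the identity has fixed points; in general it lets elements with
  fixed points be treated as negligible.\<close>

locale interval_group =
  fixes \<Gamma> :: "(real \<Rightarrow> real) set" and J :: "real set"
  assumes g_mono: "e \<in> \<Gamma> \<Longrightarrow> strict_mono e"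
    and g_surj: "e \<in> \<Gamma> \<Longrightarrow> surj e"
    and g_cont: "e \<in> \<Gamma> \<Longrightarrow> continuous_on J e"
    and g_id: "id \<in> \<Gamma>"
    and g_comp: "e \<in> \<Gamma> \<Longrightarrow> e' \<in> \<Gamma> \<Longrightarrow> e \<circ> e' \<in> \<Gamma>"
    and g_inv: "e \<in> \<Gamma> \<Longrightarrow> inv_fun e \<in> \<Gamma>"
    and g_image: "e \<in> \<Gamma> \<Longrightarrow> e ` J = J"
    and J_interval: "is_interval J" and J_nonempty: "J \<noteq> {}"
    and fixed_comp: "e \<in> \<Gamma> \<Longrightarrow> e' \<in> \<Gamma> \<Longrightarrow> \<exists>y\<in>J. e y = y \<Longrightarrow> \<exists>y\<in>J. e' y = y \<Longrightarrow> \<exists>y\<in>J. e (e' y) = y"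
begin

lemma g_less: "e \<in> \<Gamma> \<Longrightarrow> e x < e y \<longleftrightarrow> x < y"
  using g_mono by (simp add: strict_mono_less)

lemma g_le: "e \<in> \<Gamma> \<Longrightarrow> e x \<le> e y \<longleftrightarrow> x \<le> y"
  using g_mono by (simp add: strict_mono_less_eq)

lemma g_inv_apply [simp]: "e \<in> \<Gamma> \<Longrightarrow> inv_fun e (e x) = x" "e \<in> \<Gamma> \<Longrightarrow> e (inv_fun e x) = x"
  using g_surj g_mono by (auto simp: surj_f_inv_f strict_mono_imp_inj_on)

lemma g_in: "e \<in> \<Gamma> \<Longrightarrow> x \<in> J \<Longrightarrow> e x \<in> J"
  using g_image by blast

lemma g_funpow: "e \<in> \<Gamma> \<Longrightarrow> e ^^ n \<in> \<Gamma>"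
  by (induction n) (auto intro: g_id g_comp)

text \<open>
  Elements with a fixed point in \<open>J\<close> are infinitesimal: \<open>below\<close> is a bi-invariant total preorder
  that is Archimedean.
\<close>

definition below :: "(real \<Rightarrow> real) \<Rightarrow> (real \<Rightarrow> real) \<Rightarrow> bool"
  where "below e e' \<longleftrightarrow> (\<exists>t\<in>J. e t \<le> e' t)"

text \<open>Suppose \<open>e \<circ> e'\<close> moves all of \<open>J\<close> up. If one factor had
  no fixed point, it would move everything down, and a point which the other factor does not move up
  would give a contradiction. So both have fixed points, and \<open>fixed_comp\<close>
  applies.\<close>

lemma below_id_comp:
  assumes "e \<in> \<Gamma>" "e' \<in> \<Gamma>" "below e id" "below e' id"
  shows "below (e \<circ> e') id"
proof (rule ccontr)
  assume n: "\<not> ?thesis"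
  then have up: "t < e (e' t)" if "t \<in> J" for t using that unfolding below_def by (auto simp: not_le)
  obtain t where t: "t \<in> J" "e t \<le> t" using assms(3) unfolding below_def by auto
  obtain s where s: "s \<in> J" "e' s \<le> s" using assms(4) unfolding below_def by auto
  have "\<exists>y\<in>J. e' y = y"
  proof (rule ccontr)
    assume "\<not> ?thesis"
    then have "\<forall>t\<in>J. e' t < t"
      using fixed_point_free_sign[OF J_interval g_cont[OF assms(2)]] s by (meson not_le)
    then have "e (e' t) < e t" using t g_less[OF assms(1)] by blast
    then show False using up[OF t(1)] t by simp
  qed
  moreover have "\<exists>y\<in>J. e y = y"
  proof (rule ccontr)
    assume "\<not> ?thesis"
    then have "\<forall>t\<in>J. e t < t"
      using fixed_point_free_sign[OF J_interval g_cont[OF assms(1)]] t by (meson not_le)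
    then have "e (e' s) < e' s" using g_in[OF assms(2) s(1)] by blast
    then show False using up[OF s(1)] s by simp
  qed
  ultimately obtain y where "y \<in> J" "e (e' y) = y" using fixed_comp[OF assms(1,2)] by blast
  then show False using up by fastforce
qed

lemma below_iff: "e \<in> \<Gamma> \<Longrightarrow> below f e \<longleftrightarrow> below (inv_fun e \<circ> f) id"
  using g_le[of "inv_fun e"] g_inv unfolding below_def
  by (metis comp_apply g_inv_apply(1) id_apply)

lemma below_trans:
  assumes "e \<in> \<Gamma>" "f \<in> \<Gamma>" "g \<in> \<Gamma>" "below e f" "below f g"
  shows "below e g"
proof -
  have "below ((inv_fun g \<circ> f) \<circ> (inv_fun f \<circ> e)) id"
    by (rule below_id_comp[OF g_comp[OF g_inv[OF assms(3)] assms(2)] g_comp[OF g_inv[OF assms(2)] assms(1)]])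
      (use assms(4,5) below_iff[OF assms(3)] below_iff[OF assms(2)] in blast)+
  moreover have "(inv_fun g \<circ> f) \<circ> (inv_fun f \<circ> e) = inv_fun g \<circ> e"
    using assms(2) by (simp add: fun_eq_iff)
  ultimately show ?thesis using below_iff[OF assms(3)] by simp
qed

lemma below_left: "h \<in> \<Gamma> \<Longrightarrow> below e f \<Longrightarrow> below (h \<circ> e) (h \<circ> f)"
  unfolding below_def using g_le by auto

lemma below_right:
  assumes "h \<in> \<Gamma>" "below e f" shows "below (e \<circ> h) (f \<circ> h)"
proof -
  obtain t where t: "t \<in> J" "e t \<le> f t" using assms(2) unfolding below_def by auto
  then show ?thesis unfolding below_def
    using g_in[OF g_inv[OF assms(1)] t(1)] assms(1) by (intro bexI[of _ "inv_fun h t"]) auto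
qed

lemma below_comp:
  assumes "e \<in> \<Gamma>" "e' \<in> \<Gamma>" "f \<in> \<Gamma>" "f' \<in> \<Gamma>" "below e e'" "below f f'"
  shows "below (e \<circ> f) (e' \<circ> f')"
  using below_trans[OF _ _ _ below_right[OF assms(3,5)] below_left[OF assms(2,6)]] assms(1-4) g_comp by blast

lemma below_total: "below e f \<or> below f e"
  unfolding below_def using J_nonempty by (meson ex_in_conv linear)

lemma archimedean:
  assumes "d \<in> \<Gamma>" "\<not> below d id" "e \<in> \<Gamma>" "y \<in> J" "y \<le> e y"
  obtains m where "below (d ^^ m) e" "below e (d ^^ Suc m)"
proof -
  have "\<forall>t\<in>J. d t > t" using assms(2) unfolding below_def by (auto simp: not_le)
  then have ex: "\<exists>n. (d ^^ n) y > e y"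
    using funpow_exceeds[OF J_interval g_mono[OF assms(1)] g_surj[OF assms(1)] _ assms(4) g_in[OF assms(3,4)]] by blast
  define n where "n = (LEAST n. (d ^^ n) y > e y)"
  have n: "(d ^^ n) y > e y" unfolding n_def using ex by (rule LeastI_ex)
  then obtain m where m: "n = Suc m" using assms(5) by (cases n) auto
  then have "\<not> (d ^^ m) y > e y" unfolding n_def using not_less_Least lessI by metis
  then have "below (d ^^ m) e" unfolding below_def using assms(4) not_less by blast
  moreover have "below e (d ^^ Suc m)"
    unfolding below_def using n assms(4) unfolding m by (meson less_imp_le)
  ultimately show ?thesis by (rule that)
qed

text \<open>Hoelder's argument for the positive commutator \<open>c\<close>. If some positive
  \<open>d\<close> has square strictly below \<open>c\<close>, enclosing \<open>a\<close> and
  \<open>b\<close> between consecutive powers of \<open>d\<close> determines both products up to a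
  factor \<open>d \<circ> d\<close>, so \<open>c\<close> is below that square. Otherwise there is a
  least positive element \<open>\<epsilon>\<close>, and \<open>a\<close> and \<open>b\<close> are
  equivalent to powers of it, which commute.\<close>

lemma commute_mod_fixed_aux:
  assumes a: "a \<in> \<Gamma>" "y \<in> J" "y \<le> a y" and b: "b \<in> \<Gamma>" "y \<le> b y"
    and gt: "\<forall>s\<in>J. b (a s) < a (b s)"
  shows False
proof -
  define c where "c = a \<circ> b \<circ> inv_fun a \<circ> inv_fun b"
  have c: "c \<in> \<Gamma>" unfolding c_def using a b g_comp g_inv by simp
  have cI: "below c f" if "below (a \<circ> b) (f \<circ> (b \<circ> a))" for f
  proof -
    obtain t where t: "t \<in> J" "a (b t) \<le> f (b (a t))" using \<open>below _ _\<close> unfolding below_def by auto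
    then have "c (b (a t)) \<le> f (b (a t))" unfolding c_def using a b by simp
    then show ?thesis unfolding below_def using t g_in a b by blast
  qed
  have cpos: "\<not> below c id"
  proof
    assume "below c id"
    then obtain t where t: "t \<in> J" "c t \<le> t" unfolding below_def by auto
    define s where "s = inv_fun a (inv_fun b t)"
    have "s \<in> J" "t = b (a s)" "c t = a (b s)"
      unfolding s_def c_def using a b t g_in g_inv by auto
    then show False using gt t by fastforce
  qed
  show False
  proof (cases "\<exists>d\<in>\<Gamma>. \<not> below d id \<and> \<not> below c (d \<circ> d)")
    case True
    then obtain d where d: "d \<in> \<Gamma>" "\<not> below d id" "\<not> below c (d \<circ> d)" by blast
    obtain m where m: "below (d ^^ m) a" "below a (d ^^ Suc m)" by (rule archimedean[OF d(1,2) a])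
    obtain n where n: "below (d ^^ n) b" "below b (d ^^ Suc n)" by (rule archimedean[OF d(1,2) b(1) a(2) b(2)])
    note dn = g_funpow[OF d(1)]
    have 1: "below (a \<circ> b) (d ^^ Suc m \<circ> d ^^ Suc n)"
      by (rule below_comp[OF a(1) dn b(1) dn m(2) n(2)])
    have 2: "below ((d \<circ> d) \<circ> (d ^^ n \<circ> d ^^ m)) ((d \<circ> d) \<circ> (b \<circ> a))"
      by (rule below_left[OF g_comp[OF d(1,1)] below_comp[OF dn b(1) dn a(1) n(1) m(1)]])
    have "d ^^ Suc m \<circ> d ^^ Suc n = (d \<circ> d) \<circ> (d ^^ n \<circ> d ^^ m)"
    proof -
      have "d ^^ Suc m \<circ> d ^^ Suc n = d ^^ (Suc (Suc 0) + (n + m))"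
        unfolding funpow_add[symmetric] by (simp add: add.commute)
      also have "\<dots> = (d \<circ> d) \<circ> (d ^^ n \<circ> d ^^ m)"
        unfolding funpow_add by simp
      finally show ?thesis .
    qed
    then have "below (a \<circ> b) ((d \<circ> d) \<circ> (b \<circ> a))"
      using below_trans[OF _ _ _ 1] 2 a(1) b(1) d(1) dn g_comp by metis
    then show False using cI d(3) by blast
  next
    case False
    then have sq: "below c (d \<circ> d)" if "d \<in> \<Gamma>" "\<not> below d id" for d using that by blast
    \<comment> \<open>Either \<open>c\<close> is least, or some positive \<open>d1\<close> lies
      strictly below it. In the latter case \<open>d1\<close> is least: a smaller positive
      \<open>d2\<close> would factor \<open>d1\<close> as \<open>d2 \<circ> x\<close> with
      \<open>x\<close> positive, and the square of the smaller factor would lie below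
      \<open>d1\<close> but not below \<open>c\<close>.\<close>
    obtain \<epsilon> where \<epsilon>: "\<epsilon> \<in> \<Gamma>" "\<not> below \<epsilon> id" "\<And>d. d \<in> \<Gamma> \<Longrightarrow> \<not> below d id \<Longrightarrow> below \<epsilon> d"
    proof (cases "\<exists>d\<in>\<Gamma>. \<not> below d id \<and> \<not> below c d")
      case False
      then show ?thesis using that[OF c cpos] by blast
    next
      case True
      then obtain d1 where d1: "d1 \<in> \<Gamma>" "\<not> below d1 id" "\<not> below c d1" by blast
      have "below d1 d2" if d2: "d2 \<in> \<Gamma>" "\<not> below d2 id" for d2
      proof (rule ccontr)
        assume n: "\<not> below d1 d2"
        define x where "x = inv_fun d2 \<circ> d1"
        have x: "x \<in> \<Gamma>" "d2 \<circ> x = d1" unfolding x_def using d1 d2 g_comp g_inv by (auto simp: fun_eq_iff)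
        have xpos: "\<not> below x id" using n below_iff[OF d2(1)] unfolding x_def by blast
        have "below c d1"
        proof (cases "below d2 x")
          case True
          show ?thesis
            using below_trans[OF c _ d1(1) sq[OF d2]] below_left[OF d2(1) True] x d2 g_comp by metis
        next
          case False
          then have "below x d2" using below_total by blast
          then show ?thesis
            using below_trans[OF c _ d1(1) sq[OF x(1) xpos]] below_right[OF x(1), of x d2] x g_comp by metis
        qed
        then show False using d1 by blast
      qed
      then show ?thesis using that[OF d1(1,2)] by blast
    qed
    note en = g_funpow[OF \<epsilon>(1)]
    \<comment> \<open>Discreteness: the remainder \<open>x\<close> after dividing out the largest
      power of \<open>\<epsilon>\<close> is either not positive or at least
      \<open>\<epsilon>\<close>, and both cases leave \<open>e\<close> equivalent to a
      power.\<close>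
    have disc: "\<exists>j. below e (\<epsilon> ^^ j) \<and> below (\<epsilon> ^^ j) e" if e: "e \<in> \<Gamma>" "y \<le> e y" for e
    proof -
      obtain m where m: "below (\<epsilon> ^^ m) e" "below e (\<epsilon> ^^ Suc m)" by (rule archimedean[OF \<epsilon>(1,2) e(1) a(2) e(2)])
      define x where "x = inv_fun (\<epsilon> ^^ m) \<circ> e"
      have x: "x \<in> \<Gamma>" "\<epsilon> ^^ m \<circ> x = e" unfolding x_def using e en g_comp g_inv by (auto simp: fun_eq_iff)
      show ?thesis
      proof (cases "below x id")
        case True
        then show ?thesis using m(1) below_iff[OF en] unfolding x_def by blast
      next
        case False
        then have "below (\<epsilon> ^^ m \<circ> \<epsilon>) (\<epsilon> ^^ m \<circ> x)" using below_left[OF en \<epsilon>(3)[OF x(1)]] by blast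
        then have "below (\<epsilon> ^^ Suc m) e" unfolding x(2) by (simp only: funpow_Suc_right)
        then show ?thesis using m(2) by blast
      qed
    qed
    obtain i where i: "below a (\<epsilon> ^^ i)" "below (\<epsilon> ^^ i) a" using disc[OF a(1,3)] by blast
    obtain j where j: "below b (\<epsilon> ^^ j)" "below (\<epsilon> ^^ j) b" using disc[OF b] by blast
    have "below (a \<circ> b) (\<epsilon> ^^ i \<circ> \<epsilon> ^^ j)" by (rule below_comp[OF a(1) en b(1) en i(1) j(1)])
    moreover have "below (\<epsilon> ^^ j \<circ> \<epsilon> ^^ i) (b \<circ> a)" by (rule below_comp[OF en b(1) en a(1) j(2) i(2)])
    moreover have "\<epsilon> ^^ i \<circ> \<epsilon> ^^ j = \<epsilon> ^^ j \<circ> \<epsilon> ^^ i"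
      unfolding funpow_add[symmetric] by (simp add: add.commute)
    ultimately have "below (a \<circ> b) (id \<circ> (b \<circ> a))"
      using below_trans[OF g_comp[OF a(1) b(1)] g_comp[OF en en] g_comp[OF b(1) a(1)]] by simp
    then show False using cI cpos by blast
  qed
qed

text \<open>If \<open>a\<close> and \<open>b\<close> commute at no point of \<open>J\<close>, their
  commutator has no fixed point there and has constant sign; exchanging \<open>a\<close> and
  \<open>b\<close> makes it positive. Passing to inverses arranges that neither element moves
  \<open>y\<close> down.\<close>

theorem commute_mod_fixed:
  assumes "a \<in> \<Gamma>" "b \<in> \<Gamma>"
  shows "\<exists>s\<in>J. a (b s) = b (a s)"
proof -
  obtain y where y: "y \<in> J" using J_nonempty by blast
  have nonneg: "\<exists>s\<in>J. a (b s) = b (a s)" if ab: "a \<in> \<Gamma>" "b \<in> \<Gamma>" "y \<le> a y" "y \<le> b y" for a b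
  proof (rule ccontr)
    assume n: "\<not> ?thesis"
    define c where "c = a \<circ> b \<circ> inv_fun a \<circ> inv_fun b"
    have c: "c \<in> \<Gamma>" unfolding c_def using ab g_comp g_inv by simp
    have cs: "c (b (a s)) = a (b s)" for s unfolding c_def using ab by simp
    have "c t \<noteq> t" if "t \<in> J" for t
    proof
      assume "c t = t"
      define s where "s = inv_fun a (inv_fun b t)"
      have "s \<in> J" "t = b (a s)"
        unfolding s_def using ab \<open>t \<in> J\<close> g_in g_inv by auto
      then show False using cs[of s] \<open>c t = t\<close> n by metis
    qed
    then consider "\<forall>t\<in>J. c t > t" | "\<forall>t\<in>J. c t < t"
      using fixed_point_free_sign[OF J_interval g_cont[OF c]] by blast
    then show False
    proof cases
      case 1
      then have "\<forall>s\<in>J. b (a s) < a (b s)" using cs g_in ab by metis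
      then show False using commute_mod_fixed_aux[OF ab(1) y ab(3) ab(2) ab(4)] by blast
    next
      case 2
      then have "\<forall>s\<in>J. a (b s) < b (a s)" using cs g_in ab by metis
      then show False using commute_mod_fixed_aux[OF ab(2) y ab(4) ab(1) ab(3)] by blast
    qed
  qed
  have flip: "\<exists>s\<in>J. a (b s) = b (a s)" if ab: "a \<in> \<Gamma>" "b \<in> \<Gamma>" "\<exists>s\<in>J. inv_fun a (b s) = b (inv_fun a s)" for a b
  proof -
    obtain s where s: "s \<in> J" "inv_fun a (b s) = b (inv_fun a s)" using ab(3) by blast
    have "a (b (inv_fun a s)) = b (a (inv_fun a s))" using s(2)[symmetric] ab by simp
    then show ?thesis using g_in[OF g_inv[OF ab(1)] s(1)] by blast
  qed
  have sgn: "y \<le> inv_fun e y" if "e \<in> \<Gamma>" "\<not> y \<le> e y" for e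
    using that g_le[OF that(1), of y "inv_fun e y"] by simp
  have half: "\<exists>s\<in>J. a (b s) = b (a s)" if ab: "a \<in> \<Gamma>" "b \<in> \<Gamma>" "y \<le> b y" for a b
    using nonneg[OF ab(1,2) _ ab(3)] nonneg[OF g_inv[OF ab(1)] ab(2) _ ab(3)] flip[OF ab(1,2)] sgn[OF ab(1)] by blast
  show ?thesis
  proof (cases "y \<le> b y")
    case False
    then obtain s where "s \<in> J" "inv_fun b (a s) = a (inv_fun b s)"
      using half[OF assms(1) g_inv[OF assms(2)] sgn[OF assms(2)]] by metis
    then show ?thesis using flip[OF assms(2,1)] by metis
  qed (use half assms in blast)
qed

end

text \<open>Closure under inverses is automatic for a group \<open>S\<close>, because the inverse of
  a commutator is a commutator. Only three rules are left for the inductions.\<close>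

inductive_set commutator_group :: "(real \<Rightarrow> real) set \<Rightarrow> (real \<Rightarrow> real) set" for S
  where commutator_group_id: "id \<in> commutator_group S"
  | commutator_group_commutator: "f \<in> S \<Longrightarrow> g \<in> S \<Longrightarrow> f \<circ> g \<circ> inv_fun f \<circ> inv_fun g \<in> commutator_group S"
  | commutator_group_comp: "f \<in> commutator_group S \<Longrightarrow> g \<in> commutator_group S \<Longrightarrow> f \<circ> g \<in> commutator_group S"

text \<open>An element is built from finitely many commutators. If their entries all preserve one
  interval, the element is thus a product of commutators of the stabilizer of that interval.\<close>

lemma commutator_group_finite_support:
  assumes "h \<in> commutator_group S"
  shows "\<exists>E. finite E \<and> E \<subseteq> S \<and> (\<forall>\<Gamma>. E \<subseteq> \<Gamma> \<longrightarrow> h \<in> commutator_group \<Gamma>)"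
  using assms
proof induction
  case commutator_group_id
  then show ?case using commutator_group.commutator_group_id by blast
next
  case (commutator_group_commutator f g)
  then have "finite {f, g}" "{f, g} \<subseteq> S" by auto
  then show ?case using commutator_group.commutator_group_commutator insert_subset by metis
next
  case (commutator_group_comp f g)
  then obtain E E' where "finite E" "E \<subseteq> S" "\<And>\<Gamma>. E \<subseteq> \<Gamma> \<Longrightarrow> f \<in> commutator_group \<Gamma>"
    "finite E'" "E' \<subseteq> S" "\<And>\<Gamma>. E' \<subseteq> \<Gamma> \<Longrightarrow> g \<in> commutator_group \<Gamma>" by metis
  then have "finite (E \<union> E')" "E \<union> E' \<subseteq> S" "\<forall>\<Gamma>. E \<union> E' \<subseteq> \<Gamma> \<longrightarrow> f \<circ> g \<in> commutator_group \<Gamma>"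
    using commutator_group.commutator_group_comp by (simp_all del: o_apply)
  then show ?case by blast
qed

text \<open>Where \<open>f\<close> and \<open>g\<close> commute, at \<open>s\<close> say, their
  commutator fixes \<open>g (f s)\<close>; \<open>fixed_comp\<close> passes fixed points on to
  products.\<close>

lemma (in interval_group) commutator_group_fixed:
  assumes "h \<in> commutator_group \<Gamma>"
  shows "h \<in> \<Gamma> \<and> (\<exists>y\<in>J. h y = y)"
  using assms
proof induction
  case commutator_group_id
  then show ?case using g_id J_nonempty by (metis equals0I id_apply)
next
  case (commutator_group_commutator f g)
  obtain s where s: "s \<in> J" "f (g s) = g (f s)"
    using commute_mod_fixed[OF commutator_group_commutator] by blast
  have "(f \<circ> g \<circ> inv_fun f \<circ> inv_fun g) (g (f s)) = g (f s)"
    using commutator_group_commutator s by simp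
  moreover have "g (f s) \<in> J" using g_in commutator_group_commutator s by blast
  ultimately show ?case using commutator_group_commutator g_comp g_inv by blast
next
  case (commutator_group_comp f g)
  then have "\<exists>y\<in>J. (f \<circ> g) y = y" using fixed_comp[of f g] by simp
  then show ?case using commutator_group_comp g_comp by blast
qed

lemma (in line_group) commutator_group_subset: "commutator_group S \<subseteq> S"
proof
  fix h assume "h \<in> commutator_group S"
  then show "h \<in> S" by induction (blast intro: id_mem comp_mem inv_mem)+
qed

lemma (in line_group) line_group_commutator_group: "line_group \<tau> (commutator_group S)"
proof
  fix f assume "f \<in> commutator_group S"
  then show "inv_fun f \<in> commutator_group S"
  proof induction
    case commutator_group_id
    then show ?case using commutator_group.commutator_group_id by (simp add: id_def[symmetric] inv_id)
  next
    case (commutator_group_commutator f g)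
    have "inv_fun (f \<circ> g \<circ> inv_fun f \<circ> inv_fun g) = g \<circ> f \<circ> inv_fun g \<circ> inv_fun f"
      by (rule inv_equality) (use commutator_group_commutator in simp_all)
    then show ?case using commutator_group.commutator_group_commutator commutator_group_commutator by metis
  next
    case (commutator_group_comp f g)
    then have "f \<in> S" "g \<in> S" using commutator_group_subset by auto
    then have "inv_fun (f \<circ> g) = inv_fun g \<circ> inv_fun f"
      by (intro inv_equality) simp_all
    then show ?case using commutator_group.commutator_group_comp commutator_group_comp by metis
  qed
qed (use exponent diffeo commutator_group_subset in \<open>auto intro: commutator_group.intros\<close>)

section \<open>Chains of nested components\<close>

lemma Sup_invariant_fixed:
  fixes e :: "real \<Rightarrow> real"
  assumes "strict_mono e" "e ` Z = Z" "Z \<noteq> {}" "bdd_above Z" "surj e"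
  shows "e (Sup Z) = Sup Z"
proof (rule antisym)
  obtain s where s: "e s = Sup Z" using assms(5) by (metis surjD)
  have "z \<le> s" if "z \<in> Z" for z
  proof -
    have "e z \<in> Z" using that assms(2) by blast
    then have "e z \<le> e s" unfolding s using assms(4) by (rule cSup_upper)
    then show ?thesis using assms(1) by (simp add: strict_mono_less_eq)
  qed
  then have "Sup Z \<le> s" using assms(3) by (intro cSup_least)
  then have "e (Sup Z) \<le> e s" using assms(1) by (simp add: strict_mono_less_eq)
  then show "e (Sup Z) \<le> Sup Z" unfolding s .
  have "z \<le> e (Sup Z)" if z: "z \<in> Z" for z
  proof -
    obtain w where w: "w \<in> Z" "z = e w" using assms(2) z by blast
    then show ?thesis using cSup_upper[OF w(1) assms(4)] assms(1) by (simp add: strict_mono_less_eq)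
  qed
  then show "Sup Z \<le> e (Sup Z)" using assms(3) by (intro cSup_least)
qed

lemma (in line_group) inv_image:
  assumes "e \<in> S" "e ` J = J" shows "inv_fun e ` J = J"
proof -
  have "inv_fun e ` e ` J = J" using inv_apply(1)[OF assms(1)] by (simp add: image_image)
  then show ?thesis using assms(2) by simp
qed

lemma (in line_group) inv_mem_interval: "e \<in> S \<Longrightarrow> e ` J = J \<Longrightarrow> t \<in> J \<Longrightarrow> inv_fun e t \<in> J"
  using inv_image by blast

section \<open>Stabilizers of components at a point moved by the commuting group\<close>

context commuting_line_groups
begin

text \<open>Let \<open>A\<close> be the component of \<open>e1\<close> at the fixed point
  \<open>y\<close> of \<open>e2\<close>; one of its ends lies in \<open>J\<close>. If
  \<open>k\<close> moves a point of \<open>A\<close>, crossings are excluded, \<open>e2\<close>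
  preserves \<open>A\<close>, and that end is fixed by both maps. If \<open>k\<close> is trivial on
  \<open>A\<close>, the supremum of the points of \<open>J\<close> below \<open>y\<close> moved by
  \<open>k\<close> is a common fixed point. Either contradicts that \<open>e1 \<circ> e2\<close>
  moves all of \<open>J\<close> up.\<close>

lemma stabilizer_fixed_comp_up:
  assumes \<gamma>: "\<gamma> \<in> S" "\<gamma> ` J = J" "\<forall>t\<in>J. \<gamma> t > t" and J: "is_interval J"
    and x: "x \<in> J" "k x \<noteq> x" and k: "k \<in> K" "k z = z"
    and e: "e1 \<in> S" "e2 \<in> S" "e1 ` J = J" "e2 ` J = J"
    and fixed: "y1 \<in> J" "e1 y1 = y1" "y \<in> J" "e2 y = y"
    and up: "\<forall>t\<in>J. e1 (e2 t) > t"
  shows False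
proof -
  have "e1 y > y" using up fixed(3,4) by fastforce
  then obtain A where A: "support_component e1 A" "y \<in> A" using S.component_exists[OF e(1)] by (metis less_irrefl)
  then have "A \<noteq> UNIV" using fixed(2) unfolding support_component_def by auto
  then obtain c d where cd: "c < d" "A = {c<..<d}" "e1 c = c" "e1 d = d"
    using A unfolding support_component_def by auto
  have "y1 \<notin> A" using A fixed(2) unfolding support_component_def by blast
  then have "y1 \<le> c \<or> d \<le> y1" using cd by auto
  then have ends: "c \<in> J \<or> d \<in> J"
    using J fixed(1,3) A(2) unfolding cd is_interval_1 by (meson greaterThanLessThan_iff less_imp_le)
  show False
  proof (cases "\<exists>t\<in>A. k t \<noteq> t")
    case True
    have "e2 ` A = A"
    proof (rule ccontr)
      assume "e2 ` A \<noteq> A"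
      moreover have "y \<in> e2 ` A" using A(2) fixed(4) by (intro image_eqI[of _ _ y]) simp_all
      then have "e2 ` A \<inter> A \<noteq> {}" using A(2) by blast
      ultimately show False using crossing_trivial[OF e(1) A(1) e(2) _ _ k] True by blast
    qed
    then have "{e2 c<..<e2 d} = {c<..<d}"
      unfolding cd using strict_mono_surj_image_interval(1)[OF S.mono[OF e(2)] S.surj[OF e(2)], of c d] by simp
    moreover have "e2 c < e2 d" using cd(1) S.less_iff[OF e(2)] by simp
    ultimately have "e2 c = c" "e2 d = d"
      using open_interval_eqD[of "e2 c" "e2 d" c d] by simp_all
    then show False using ends up cd by (metis less_irrefl)
  next
    case False
    define Z where "Z = {t \<in> J. k t \<noteq> t \<and> t < y}"
    have moved: "k (e t) \<noteq> e t" if "e \<in> S" "k t \<noteq> t" for e t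
      unfolding commute[OF that(1) k(1), symmetric] by (simp add: inj_eq[OF S.inj[OF that(1)]] that(2))
    have A_out: "t \<le> c" if "t \<in> Z" for t    proof (rule ccontr)
      assume "\<not> t \<le> c"
      then have "t \<in> A" using that A(2) unfolding Z_def cd by simp
      then show False using that False unfolding Z_def by blast
    qed
    \<comment> \<open>\<open>e1\<close> fixes the barrier \<open>c\<close>, below which all of
      \<open>Z\<close> lies, and \<open>e2\<close> fixes the barrier \<open>y\<close>; so neither
      map nor its inverse carries \<open>Z\<close> past \<open>y\<close>.\<close>
    have Zsub: "e ` Z \<subseteq> Z" if "e \<in> S" "e ` J = J" "e = e1 \<or> e = inv_fun e1 \<or> e = e2 \<or> e = inv_fun e2" for e
    proof
      fix t assume "t \<in> e ` Z"
      then obtain s where s: "s \<in> Z" "t = e s" by blast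
      then have "t \<in> J" "k t \<noteq> t" using that(1,2) moved unfolding Z_def by auto
      moreover have "t < y"
      proof -
        have "e c = c \<or> e y = y"
          using that(3) cd(3) fixed(4) S.inv_fixed[OF e(1)] S.inv_fixed[OF e(2)] by auto
        then show ?thesis
        proof
          assume "e c = c"
          then have "t \<le> c" using A_out[OF s(1)] S.le_iff[OF that(1), of s c] s(2) by simp
          then show ?thesis using A(2) cd by simp
        next
          assume "e y = y"
          then show ?thesis using S.less_iff[OF that(1), of s y] s unfolding Z_def by simp
        qed
      qed
      ultimately show "t \<in> Z" unfolding Z_def by simp
    qed
    have Zeq: "e ` Z = Z" if "e \<in> S" "e ` J = J" "e = e1 \<or> e = e2" for e
    proof
      show "e ` Z \<subseteq> Z" using Zsub that by blast
      have "inv_fun e ` Z \<subseteq> Z" using Zsub[OF S.inv_mem[OF that(1)] S.inv_image[OF that(1,2)]] that(3) by blast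
      then have "e ` inv_fun e ` Z \<subseteq> e ` Z" by (rule image_mono)
      then show "Z \<subseteq> e ` Z" using S.inv_apply(2)[OF that(1)] by (simp add: image_image)
    qed
    \<comment> \<open>\<open>Z\<close> is nonempty: an inverse power of \<open>\<gamma>\<close>
      brings \<open>x\<close> below \<open>y\<close> within \<open>J\<close>, and since it commutes
      with \<open>k\<close>, the new point is still moved by \<open>k\<close>.\<close>
    obtain n where n: "(\<gamma> ^^ n) y > x"
      using funpow_exceeds[OF J S.mono[OF \<gamma>(1)] S.surj[OF \<gamma>(1)] \<gamma>(3) fixed(3) x(1)] by blast
    define g where "g = \<gamma> ^^ n"
    have g: "g \<in> S" unfolding g_def using S.funpow_mem[OF \<gamma>(1)] .
    have "g ` J = J" unfolding g_def
    proof (induction n)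
      case (Suc n)
      then show ?case using \<gamma>(2) by (simp only: funpow.simps image_comp[symmetric])
    qed simp
    define z0 where "z0 = inv_fun g x"
    have "z0 \<in> J" unfolding z0_def using S.inv_image[OF g \<open>g ` J = J\<close>] x(1) by blast
    moreover have "z0 < y" using S.less_iff[OF g, of z0 y] n g unfolding z0_def g_def[symmetric] by simp
    ultimately have z0: "z0 \<in> Z" unfolding Z_def z0_def using moved[OF S.inv_mem[OF g] x(2)] by simp
    have bd: "bdd_above Z" unfolding Z_def by (intro bdd_aboveI[of _ y]) auto
    have s: "z0 \<le> Sup Z" "Sup Z \<le> y"
      using cSup_upper[OF z0 bd] z0 by (auto intro!: cSup_least simp: Z_def)
    then have "Sup Z \<in> J" using J \<open>z0 \<in> J\<close> fixed(3) unfolding is_interval_1 by blast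
    moreover have "e (Sup Z) = Sup Z" if "e \<in> S" "e ` J = J" "e = e1 \<or> e = e2" for e
      using Sup_invariant_fixed[OF S.mono[OF that(1)] Zeq[OF that] _ bd S.surj[OF that(1)]] z0 by blast
    from this[OF e(1,3)] this[OF e(2,4)] have "e1 (e2 (Sup Z)) = Sup Z" by simp
    ultimately show False using up by fastforce
  qed
qed

lemma stabilizer_interval_group:
  assumes \<gamma>: "\<gamma> \<in> S" "support_component \<gamma> J" and x: "x \<in> J" "k x \<noteq> x" and k: "k \<in> K" "k z = z"
  shows "interval_group {e \<in> S. e ` J = J} J"
proof -
  have J: "is_interval J" using support_component_interval \<gamma> by blast
  have \<gamma>J: "\<gamma> ` J = J" by (rule support_component_self_image[OF \<gamma>(2) S.mono[OF \<gamma>(1)] S.surj[OF \<gamma>(1)]])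
  obtain \<gamma>1 where \<gamma>1: "\<gamma>1 \<in> S" "\<gamma>1 ` J = J" "\<forall>t\<in>J. \<gamma>1 t > t"
  proof -
    consider "\<forall>t\<in>J. \<gamma> t > t" | "\<forall>t\<in>J. \<gamma> t < t" using S.component_sign[OF \<gamma>] by blast
    then show ?thesis
    proof cases
      case 1
      then show ?thesis using that[OF \<gamma>(1) \<gamma>J] by blast
    next
      case 2
      have "\<forall>t\<in>J. inv_fun \<gamma> t > t"
      proof
        fix t assume "t \<in> J"
        then have "inv_fun \<gamma> t \<in> J" by (rule S.inv_mem_interval[OF \<gamma>(1) \<gamma>J])
        then show "inv_fun \<gamma> t > t" using 2 S.inv_apply(2)[OF \<gamma>(1), of t] by metis
      qed
      then show ?thesis using that[OF S.inv_mem[OF \<gamma>(1)] S.inv_image[OF \<gamma>(1) \<gamma>J]] by blast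
    qed
  qed
  show ?thesis
  proof
    fix e1 e2 assume "e1 \<in> {e \<in> S. e ` J = J}" "e2 \<in> {e \<in> S. e ` J = J}"
    then have e: "e1 \<in> S" "e2 \<in> S" "e1 ` J = J" "e2 ` J = J" by auto
    assume "\<exists>y\<in>J. e1 y = y" "\<exists>y\<in>J. e2 y = y"
    then obtain y1 y2 where y: "y1 \<in> J" "e1 y1 = y1" "y2 \<in> J" "e2 y2 = y2" by blast
    show "\<exists>y\<in>J. e1 (e2 y) = y"
    proof (rule ccontr)
      assume n: "\<not> ?thesis"
      have "e1 \<circ> e2 \<in> S" using S.comp_mem e by blast
      then consider "\<forall>t\<in>J. (e1 \<circ> e2) t > t" | "\<forall>t\<in>J. (e1 \<circ> e2) t < t"
        using fixed_point_free_sign[OF J S.cont, of "e1 \<circ> e2"] n by (metis comp_apply)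
      then show False
      proof cases
        case 1
        then have "\<forall>t\<in>J. e1 (e2 t) > t" by simp
        then show False by (rule stabilizer_fixed_comp_up[OF \<gamma>1 J x k e y])
      next
        case 2
        have "\<forall>t\<in>J. inv_fun e2 (inv_fun e1 t) > t"
        proof
          fix t assume "t \<in> J"
          then have "inv_fun e2 (inv_fun e1 t) \<in> J" by (intro S.inv_mem_interval e)
          then have "e1 (e2 (inv_fun e2 (inv_fun e1 t))) < inv_fun e2 (inv_fun e1 t)"
            using 2 by (metis comp_apply)
          then show "inv_fun e2 (inv_fun e1 t) > t" using e(1,2) by simp
        qed
        then show False
          by (rule stabilizer_fixed_comp_up[OF \<gamma>1 J x k S.inv_mem[OF e(2)] S.inv_mem[OF e(1)]
              S.inv_image[OF e(2,4)] S.inv_image[OF e(1,3)] y(3) S.inv_fixed[OF e(2) y(4)] y(1) S.inv_fixed[OF e(1) y(2)]])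
      qed
    qed
  next
    fix e e' assume "e \<in> {e \<in> S. e ` J = J}" "e' \<in> {e \<in> S. e ` J = J}"
    then show "e \<circ> e' \<in> {e \<in> S. e ` J = J}" using S.comp_mem[of e e'] image_comp[of e e' J] by simp
  next
    show "id \<in> {e \<in> S. e ` J = J}" using S.id_mem by simp
  qed (use S.mono S.surj S.cont S.inv_mem S.inv_image J x in auto)
qed

lemma component_images_disjoint:
  assumes "f \<in> S" "support_component f A" "x \<in> A" "g \<in> S" "k \<in> K" "k z = z" "k x \<noteq> x"
  shows "g ` A = A \<or> g ` A \<inter> A = {}"
  using crossing_trivial[OF assms(1,2,4) _ _ assms(5,6,3)] assms(7) by blast

text \<open>Components at \<open>x\<close> of different elements are nested. The largest one is
  preserved by all of \<open>E\<close>: each element keeps some point of it inside it, and images of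
  a component at \<open>x\<close> coincide with it or are disjoint from it.\<close>

lemma common_component:
  assumes "finite E" "E \<subseteq> S" and k: "k \<in> K" "k z = z" "k x \<noteq> x"
  shows "(\<forall>e\<in>E. e x = x) \<or> (\<exists>\<gamma>\<in>E. \<exists>J. support_component \<gamma> J \<and> x \<in> J \<and> (\<forall>e\<in>E. e ` J = J))"
  using assms(1,2)
proof (induction E)
  case (insert e E)
  then have e: "e \<in> S" and sub: "E \<subseteq> S" by auto
  have fix_stable: "g ` J = J" if "f \<in> S" "support_component f J" "x \<in> J" "g \<in> S" "y \<in> J" "g y \<in> J" for f g J y
    using component_images_disjoint[OF that(1-4) k] that(5,6) by blast
  from insert.IH[OF sub] show ?case
  proof
    assume all: "\<forall>e\<in>E. e x = x"
    show ?thesis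
    proof (cases "e x = x")
      case False
      then obtain J where J: "support_component e J" "x \<in> J" using S.component_exists[OF e] by blast
      have "f ` J = J" if "f \<in> insert e E" for f
      proof (cases "f = e")
        case True
        then show ?thesis using support_component_self_image[OF J(1) S.mono[OF e] S.surj[OF e]] by simp
      next
        case False
        then have "f x \<in> J" using that all J by auto
        then show ?thesis using fix_stable[OF e J _ J(2)] that sub e by blast
      qed
      then show ?thesis using J by blast
    qed (use all in blast)
  next
    assume "\<exists>\<gamma>\<in>E. \<exists>J. support_component \<gamma> J \<and> x \<in> J \<and> (\<forall>e\<in>E. e ` J = J)"
    then obtain \<gamma> J where J: "\<gamma> \<in> E" "support_component \<gamma> J" "x \<in> J" "\<And>f. f \<in> E \<Longrightarrow> f ` J = J" by blast
    have \<gamma>: "\<gamma> \<in> S" using J sub by blast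
    show ?thesis
    proof (cases "e x = x")
      case True
      then have "e ` J = J" using fix_stable[OF \<gamma> J(2,3) e J(3)] J(3) by simp
      then show ?thesis using J by blast
    next
      case False
      then obtain I where I: "support_component e I" "x \<in> I" using S.component_exists[OF e] by blast
      have eI: "e ` I = I" by (rule support_component_self_image[OF I(1) S.mono[OF e] S.surj[OF e]])
      have "J \<subseteq> I \<or> I \<subseteq> J"
        using support_component_nested(1)[OF J(2) I(1) S.mono[OF e] S.surj[OF e] component_images_disjoint[OF \<gamma> J(2,3) e k]] J I
        by blast
      then show ?thesis
      proof
        assume "J \<subseteq> I"
        have "f ` I = I" if "f \<in> insert e E" for f
        proof (cases "f = e")
          case False
          then have "f x \<in> I" using that J \<open>J \<subseteq> I\<close> by blast
          then show ?thesis using fix_stable[OF e I _ I(2)] that sub e by blast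
        qed (use eI in simp)
        then show ?thesis using I by blast
      next
        assume "I \<subseteq> J"
        then have "e x \<in> J" using eI I by blast
        then have "e ` J = J" using fix_stable[OF \<gamma> J(2,3) e J(3)] by blast
        then show ?thesis using J by blast
      qed
    qed
  qed
qed simp

text \<open>This is one step down a chain. \<open>h\<close> is a product of commutators of the
  stabilizer of a common component \<open>J\<close>, so it fixes a point of \<open>J\<close>, which
  forces the component of \<open>h\<close> at \<open>x\<close> to be smaller than
  \<open>J\<close>.\<close>

lemma commutator_component:
  assumes h: "h \<in> commutator_group S" "h x \<noteq> x" and k: "k \<in> K" "k z = z" "k x \<noteq> x"
  shows "\<exists>\<gamma>\<in>S. \<exists>J. support_component \<gamma> J \<and> x \<in> J \<and> h ` J = J \<and> (\<exists>y\<in>J. h y = y)"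
proof -
  obtain E where E: "finite E" "E \<subseteq> S" "\<And>\<Gamma>. E \<subseteq> \<Gamma> \<Longrightarrow> h \<in> commutator_group \<Gamma>"
    using commutator_group_finite_support[OF h(1)] by blast
  have "\<not> (\<forall>e\<in>E. e x = x)"
  proof
    assume "\<forall>e\<in>E. e x = x"
    then have "E \<subseteq> {e \<in> S. e x = x}" using E(2) by blast
    then have "h \<in> commutator_group {e \<in> S. e x = x}" by (rule E(3))
    then have "h x = x" by induction (auto simp: S.inv_fixed)
    then show False using h by simp
  qed
  then obtain \<gamma> J where J: "\<gamma> \<in> E" "support_component \<gamma> J" "x \<in> J" "\<forall>e\<in>E. e ` J = J"
    using common_component[OF E(1,2) k] by blast
  have \<gamma>: "\<gamma> \<in> S" using J E by blast
  interpret I: interval_group "{e \<in> S. e ` J = J}" J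
    by (rule stabilizer_interval_group[OF \<gamma> J(2,3) k(3,1,2)])
  have "h \<in> commutator_group {e \<in> S. e ` J = J}" by (rule E(3)) (use E(2) J(4) in blast)
  from I.commutator_group_fixed[OF this] show ?thesis using \<gamma> J by blast
qed

lemma commuting_commutator_group: "commuting_line_groups \<tau> ((commutator_group ^^ n) S) K"
proof (induction n)
  case 0
  show ?case by (simp, unfold_locales)
next
  case (Suc n)
  interpret N: commuting_line_groups \<tau> "(commutator_group ^^ n) S" K by (rule Suc)
  interpret D: line_group \<tau> "commutator_group ((commutator_group ^^ n) S)" by (rule N.S.line_group_commutator_group)
  show ?case unfolding funpow.simps o_apply
    by unfold_locales (use N.S.commutator_group_subset N.commute in blast)
qed

lemma commutator_group_power_subset: "(commutator_group ^^ n) S \<subseteq> S"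
proof (induction n)
  case (Suc n)
  interpret N: commuting_line_groups \<tau> "(commutator_group ^^ n) S" K by (rule commuting_commutator_group)
  show ?case using Suc N.S.commutator_group_subset by auto
qed simp

text \<open>The chain is built from its innermost member: an element at depth \<open>Suc N\<close>
  yields an element \<open>\<gamma>\<close> at depth \<open>N\<close> with a strictly larger
  component at \<open>x\<close>, and the induction continues with \<open>\<gamma>\<close>.\<close>

lemma component_chain:
  assumes k: "k \<in> K" "k z = z" "k x \<noteq> x" and h: "h \<in> (commutator_group ^^ N) S" "h x \<noteq> x"
  shows "\<exists>hs A. hs N = h \<and> (\<forall>i\<le>N. hs i \<in> S \<and> support_component (hs i) (A i) \<and> x \<in> A i) \<and>
    (\<forall>i<N. A (Suc i) \<subset> A i)"
  using h
proof (induction N arbitrary: h)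
  case 0
  then have "h \<in> S" by simp
  then obtain J where "support_component h J" "x \<in> J" using S.component_exists 0 by blast
  then show ?case using \<open>h \<in> S\<close> by (intro exI[of _ "\<lambda>_. h"] exI[of _ "\<lambda>_. J"]) simp
next
  case (Suc N)
  interpret N: commuting_line_groups \<tau> "(commutator_group ^^ N) S" K by (rule commuting_commutator_group)
  have hN: "h \<in> commutator_group ((commutator_group ^^ N) S)" using Suc.prems by simp
  then obtain \<gamma> J where J: "\<gamma> \<in> (commutator_group ^^ N) S" "support_component \<gamma> J" "x \<in> J" "h ` J = J" "\<exists>y\<in>J. h y = y"
    using N.commutator_component[OF hN Suc.prems(2) k] by blast
  have "\<gamma> x \<noteq> x" using J unfolding support_component_def by blast
  then obtain hs A where A: "hs N = \<gamma>" "\<And>i. i \<le> N \<Longrightarrow> hs i \<in> S \<and> support_component (hs i) (A i) \<and> x \<in> A i"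
    "\<And>i. i < N \<Longrightarrow> A (Suc i) \<subset> A i" using Suc.IH[OF J(1)] by metis
  have AN: "A N = J" using support_component_unique[of \<gamma> "A N" J] A(1) A(2)[of N] J by auto
  have hS: "h \<in> S" using Suc.prems commutator_group_power_subset by blast
  then obtain B where B: "support_component h B" "x \<in> B" using S.component_exists Suc.prems by blast
  have "B \<subseteq> J"
  proof (cases "J = UNIV")
    case False
    then obtain a b where ab: "a < b" "J = {a<..<b}" using J(2) unfolding support_component_def by auto
    then have "{h a<..<h b} = {a<..<b}"
      using J(4) strict_mono_surj_image_interval(1)[OF S.mono[OF hS] S.surj[OF hS], of a b] by simp
    moreover have "h a < h b" using ab S.less_iff[OF hS] by simp
    ultimately have "h a = a" "h b = b"
      using open_interval_eqD[of "h a" "h b" a b] by simp_all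
    then have out: "a \<notin> B" "b \<notin> B" using B unfolding support_component_def by auto
    show ?thesis
    proof
      fix t assume "t \<in> B"
      then have "\<not> t \<le> a" "\<not> t \<ge> b"
        using out support_component_interval[OF B(1)] B(2) J(3) unfolding ab(2) is_interval_1
        by (meson greaterThanLessThan_iff less_imp_le)+
      then show "t \<in> J" using ab by simp
    qed
  qed simp
  moreover have "B \<noteq> J" using J(5) B(1) unfolding support_component_def by blast
  ultimately have "B \<subset> J" by blast
  then show ?case using A B hS AN
    by (intro exI[of _ "hs(Suc N := h)"] exI[of _ "A(Suc N := B)"]) (auto simp: le_Suc_eq less_Suc_eq)
qed

lemma funpow_component:
  assumes "f \<in> S" "support_component f J" "r > 0"
  shows "support_component (f ^^ r) J"
proof -
  have fJ: "f ` J = J" by (rule support_component_self_image[OF assms(2) S.mono[OF assms(1)] S.surj[OF assms(1)]])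
  have in_J: "(f ^^ i) t \<in> J" if "t \<in> J" for i t using that fJ by (induction i) auto
  have "(f ^^ r) t \<noteq> t" if t: "t \<in> J" for t
  proof -
    consider "\<forall>t\<in>J. f t > t" | "\<forall>t\<in>J. f t < t" using S.component_sign[OF assms(1,2)] by blast
    then show ?thesis
    proof cases
      case 1
      have "(f ^^ Suc i) t > t" for i
      proof (induction i)
        case (Suc i)
        then show ?case using 1 in_J[OF t, of "Suc i"] by fastforce
      qed (use 1 t in simp)
      then show ?thesis using assms(3) by (metis gr0_conv_Suc less_irrefl)
    next
      case 2
      have "(f ^^ Suc i) t < t" for i
      proof (induction i)
        case (Suc i)
        then show ?case using 2 in_J[OF t, of "Suc i"] by fastforce
      qed (use 2 t in simp)
      then show ?thesis using assms(3) by (metis gr0_conv_Suc less_irrefl)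
    qed
  qed
  then show ?thesis using assms(2) funpow_fixed[of f _ r] unfolding support_component_def by metis
qed

end

section \<open>Displaced chains of components\<close>

context commuting_line_groups
begin

text \<open>The words have one exponent below \<open>Q\<close> for each of the \<open>n\<close>
  innermost levels above \<open>A D\<close>. Powers of \<open>hs i\<close> preserve
  \<open>A i\<close> and move \<open>A (Suc i)\<close> to pairwise disjoint places in it, so every
  level multiplies the number of images by \<open>Q\<close> and adds fewer than \<open>Q\<close>
  letters.\<close>

lemma chain_words:
  assumes chain: "\<And>i. i \<le> D \<Longrightarrow> hs i \<in> S \<and> support_component (hs i) (A i)"
    "\<And>i g. i \<le> D \<Longrightarrow> g \<in> S \<Longrightarrow> g ` A i = A i \<or> g ` A i \<inter> A i = {}"
    "\<And>i. i < D \<Longrightarrow> A (Suc i) \<subset> A i" and ne: "A D \<noteq> {}" and n: "n \<le> D"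
  shows "\<exists>Y. finite Y \<and> Q ^ n \<le> card Y \<and> (\<forall>gs\<in>Y. set gs \<subseteq> hs ` {..<D} \<and> length gs \<le> n * Q \<and> word gs ` A D \<subseteq> A (D - n)) \<and>
    (\<forall>gs\<in>Y. \<forall>gs'\<in>Y. gs \<noteq> gs' \<longrightarrow> word gs ` A D \<inter> word gs' ` A D = {})"
  using n
proof (induction n)
  case 0
  show ?case by (intro exI[of _ "{[]}"]) auto
next
  case (Suc n)
  define i where "i = D - Suc n"
  have i: "i < D" "Suc i = D - n" unfolding i_def using Suc.prems by auto
  have "n \<le> D" using Suc.prems by simp
  from Suc.IH[OF this] obtain Y where Y0: "finite Y" "Q ^ n \<le> card Y"
    "\<forall>gs\<in>Y. set gs \<subseteq> hs ` {..<D} \<and> length gs \<le> n * Q \<and> word gs ` A D \<subseteq> A (D - n)"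
    "\<forall>gs\<in>Y. \<forall>gs'\<in>Y. gs \<noteq> gs' \<longrightarrow> word gs ` A D \<inter> word gs' ` A D = {}" by (elim exE conjE)
  have Y: "finite Y" "Q ^ n \<le> card Y" "\<And>gs. gs \<in> Y \<Longrightarrow> set gs \<subseteq> hs ` {..<D}"
    "\<And>gs. gs \<in> Y \<Longrightarrow> length gs \<le> n * Q" "\<And>gs. gs \<in> Y \<Longrightarrow> word gs ` A D \<subseteq> A (Suc i)"
    "\<And>gs gs'. gs \<in> Y \<Longrightarrow> gs' \<in> Y \<Longrightarrow> gs \<noteq> gs' \<Longrightarrow> word gs ` A D \<inter> word gs' ` A D = {}"
    unfolding i(2) using Y0 by simp_all
  define g where "g = hs i"
  have g: "g \<in> S" "support_component g (A i)" unfolding g_def using chain(1) i by auto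
  have gm: "g ^^ m \<in> S" for m by (rule S.funpow_mem[OF g(1)])
  have gA: "(g ^^ m) ` A i = A i" for m
  proof (induction m)
    case (Suc m)
    then show ?case using support_component_self_image[OF g(2) S.mono[OF g(1)] S.surj[OF g(1)]]
      by (simp only: funpow.simps image_comp[symmetric])
  qed simp
  have sub: "A (Suc i) \<subset> A i" using chain(3) i by blast
  have ne': "A (Suc i) \<noteq> {}"
  proof -
    have "\<exists>a b. a < b \<and> A (Suc i) = {a<..<b} \<or> A (Suc i) = UNIV"
      using chain(1)[of "Suc i"] i unfolding support_component_def by fastforce
    then show ?thesis by auto
  qed
  have away: "(g ^^ r) ` A (Suc i) \<inter> A (Suc i) = {}" if "r > 0" for r
  proof (rule support_component_nested(2)[OF _ funpow_component[OF g that] S.mono[OF gm] S.surj[OF gm] _ _ sub])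
    show "support_component (hs (Suc i)) (A (Suc i))" using chain(1) i by auto
    show "(g ^^ r) ` A (Suc i) = A (Suc i) \<or> (g ^^ r) ` A (Suc i) \<inter> A (Suc i) = {}"
      using chain(2)[OF _ gm] i by auto
    show "A (Suc i) \<inter> A i \<noteq> {}" using sub ne' by blast
  qed
  have away2: "(g ^^ m) ` A (Suc i) \<inter> (g ^^ m') ` A (Suc i) = {}" if "m < m'" for m m'
  proof -
    have "(g ^^ m') = (g ^^ m) \<circ> (g ^^ (m' - m))" using that by (simp flip: funpow_add)
    then have "(g ^^ m') ` A (Suc i) = (g ^^ m) ` (g ^^ (m' - m)) ` A (Suc i)" by (simp only: image_comp)
    then have "(g ^^ m) ` A (Suc i) \<inter> (g ^^ m') ` A (Suc i) = (g ^^ m) ` (A (Suc i) \<inter> (g ^^ (m' - m)) ` A (Suc i))"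
      by (simp only: image_Int[OF S.inj[OF gm]])
    also have "\<dots> = {}" using away[of "m' - m"] that by (simp add: Int_commute)
    finally show ?thesis .
  qed
  define W where "W = (\<lambda>(m, gs). replicate m g @ gs)"
  have Wim: "word (W (m, gs)) ` A D = (g ^^ m) ` word gs ` A D" for m gs
    unfolding W_def by (simp add: word_append word_replicate image_comp)
  have disj: "word (W p) ` A D \<inter> word (W p') ` A D = {}"
    if pp: "p \<in> {..<Q} \<times> Y" "p' \<in> {..<Q} \<times> Y" "p \<noteq> p'" for p p'
  proof -
    obtain m gs m' gs' where p: "p = (m, gs)" "p' = (m', gs')" by (meson surj_pair)
    have Yg: "gs \<in> Y" "gs' \<in> Y" using pp p by auto
    have im: "(g ^^ m) ` word gs ` A D \<subseteq> (g ^^ m) ` A (Suc i)" "(g ^^ m') ` word gs' ` A D \<subseteq> (g ^^ m') ` A (Suc i)"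
      using Y(5) Yg by (simp_all add: image_mono)
    show ?thesis
    proof (cases "m = m'")
      case True
      then have "word gs ` A D \<inter> word gs' ` A D = {}" using Y(6)[OF Yg] pp p by blast
      then show ?thesis unfolding p Wim True by (simp add: image_Int[OF S.inj[OF gm], symmetric])
    next
      case False
      then have "(g ^^ m) ` A (Suc i) \<inter> (g ^^ m') ` A (Suc i) = {}"
        using away2[of m m'] away2[of m' m] by (metis Int_commute linorder_neqE_nat)
      then show ?thesis unfolding p Wim using im by blast
    qed
  qed
  \<comment> \<open>Words with disjoint nonempty images are different, so no word is counted
    twice.\<close>
  have inj: "inj_on W ({..<Q} \<times> Y)"
  proof (rule inj_onI, rule ccontr)
    fix p p' assume "p \<in> {..<Q} \<times> Y" "p' \<in> {..<Q} \<times> Y" "W p = W p'" "p \<noteq> p'"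
    then show False using disj[of p p'] ne by auto
  qed
  show ?case
  proof (intro exI[of _ "W ` ({..<Q} \<times> Y)"] conjI ballI impI)
    show "finite (W ` ({..<Q} \<times> Y))" using Y(1) by simp
    show "Q ^ Suc n \<le> card (W ` ({..<Q} \<times> Y))"
      unfolding card_image[OF inj] using Y(2) by (simp add: card_cartesian_product)
    fix gs assume "gs \<in> W ` ({..<Q} \<times> Y)"
    then obtain m gs0 where m: "gs = W (m, gs0)" "m < Q" "gs0 \<in> Y" by auto
    show "set gs \<subseteq> hs ` {..<D}" unfolding m W_def using Y(3)[OF m(3)] i(1) by (auto simp: g_def)
    show "length gs \<le> Suc n * Q" unfolding m W_def using Y(4)[OF m(3)] m(2) by simp
    have "(g ^^ m) ` word gs0 ` A D \<subseteq> (g ^^ m) ` A i"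
      using Y(5)[OF m(3)] sub by (intro image_mono) blast
    then have "(g ^^ m) ` word gs0 ` A D \<subseteq> A i" unfolding gA .
    then show "word gs ` A D \<subseteq> A (D - Suc n)" unfolding m(1) Wim i_def .
    fix gs' assume "gs' \<in> W ` ({..<Q} \<times> Y)" "gs \<noteq> gs'"
    then obtain p' where "gs' = W p'" "p' \<in> {..<Q} \<times> Y" "p' \<noteq> (m, gs0)" using m(1) by blast
    then show "word gs ` A D \<inter> word gs' ` A D = {}" using disj[of "(m, gs0)" p'] m by simp
  qed
qed

text \<open>The letters are \<open>hs i\<close> for \<open>i < D\<close>, the map forced to be
  trivial is \<open>hs D\<close> on the innermost interval, and the window is the closure of
  \<open>A 0\<close>, which \<open>k\<close> displaces because \<open>A 0\<close> is strictly inside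
  a component of \<open>k\<close>.\<close>

lemma displaced_chain_contradiction:
  fixes D :: nat
  assumes D: "1 \<le> \<tau> * (1 + \<tau> * D)"
    and k: "k \<in> K" "support_component k {c<..<d}"
    and chain: "\<And>i. i \<le> D \<Longrightarrow> hs i \<in> S \<and> support_component (hs i) (A i)"
    "\<And>i g. i \<le> D \<Longrightarrow> g \<in> S \<Longrightarrow> g ` A i = A i \<or> g ` A i \<inter> A i = {}"
    "\<And>i. i < D \<Longrightarrow> A (Suc i) \<subset> A i"
    and x: "\<And>i. i \<le> D \<Longrightarrow> x \<in> A i" and sub: "A 0 \<subset> {c<..<d}"
  shows False
proof -
  have "x \<in> {c<..<d}" using x[of 0] sub by auto
  then have "c < d" by auto
  obtain k1 where k1: "k1 \<in> K" "support_component k1 {c<..<d}" "k1 c = c" "k1 d = d" "\<forall>t\<in>{c<..<d}. k1 t > t"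
    using K.orient_up[OF k \<open>c < d\<close>] by metis
  have A0: "A i \<subseteq> A 0" if "i \<le> D" for i
    using that
  proof (induction i)
    case (Suc i)
    then show ?case using chain(3)[of i] by auto
  qed simp
  have "\<exists>a b. a < b \<and> A i = {a<..<b} \<and> hs i a = a \<and> hs i b = b" if "i \<le> D" for i
  proof -
    have "A i \<noteq> UNIV" using A0[OF that] sub by auto
    then show ?thesis using chain(1)[OF that] unfolding support_component_def by blast
  qed
  then obtain a b where ab: "\<And>i. i \<le> D \<Longrightarrow> a i < b i" "\<And>i. i \<le> D \<Longrightarrow> A i = {a i<..<b i}"
    "\<And>i. i \<le> D \<Longrightarrow> hs i (a i) = a i" by metis
  have ab0: "a 0 \<le> a i" "b i \<le> b 0" if "i \<le> D" for i
    using A0[OF that] ab(1,2)[OF that] ab(2)[of 0] by (auto simp: greaterThanLessThan_subseteq_greaterThanLessThan)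
  have A00: "A 0 = {a 0<..<b 0}" "a 0 < b 0" using ab by auto
  have dis0: "k1 ` A 0 \<inter> A 0 = {}"
  proof (rule support_component_nested(2)[OF _ k1(2) K.mono[OF k1(1)] K.surj[OF k1(1)] _ _ sub])
    show "support_component (hs 0) (A 0)" using chain(1) by auto
    show "k1 ` A 0 = A 0 \<or> k1 ` A 0 \<inter> A 0 = {}" using image_component[of "hs 0" k1 "A 0"] chain(1)[of 0] k1 by auto
    show "A 0 \<inter> {c<..<d} \<noteq> {}" using x[of 0] sub by auto
  qed
  have dis: "c < a 0" "b 0 \<le> k1 (a 0)" "b 0 < d"
    using displaced_interval[OF k1(1,3,4,5), of "a 0" "b 0"] dis0 A00 sub by auto
  have hD: "hs D \<in> S" "support_component (hs D) {a D<..<b D}" using chain(1)[of D] ab(2)[of D] by auto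
  obtain f where f: "f \<in> S" "f (a D) = a D" "f (b D) = b D" "\<forall>t\<in>{a D<..<b D}. f t > t"
    using S.orient_up[OF hD ab(1)[OF order_refl]] by metis
  define u where "u = (a D + b D) / 2"
  have u: "a D < u" "u < b D" unfolding u_def using ab(1)[of D] by auto
  show False
  proof (rule many_images_contradiction[OF S.exponent(1) K.diffeo[OF k1(1)] k1(3,4,5) dis(1) A00(2) dis(2,3)
        S.diffeo[OF f(1)] commute[OF f(1) k1(1)] f(2,3,4) ab0(1)[OF order_refl] u ab0(2)[OF order_refl],
        of "hs ` {..<D}" "{a 0..b 0}" D])
    show "finite (hs ` {..<D})" by simp
    have ES: "e \<in> S" if "e \<in> hs ` {..<D}" for e
    proof -
      obtain i where "i < D" "e = hs i" using \<open>e \<in> _\<close> by auto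
      then show ?thesis using chain(1)[of i] by simp
    qed
    show "e \<in> hs ` {..<D} \<Longrightarrow> line_diffeo \<tau> e" for e by (rule S.diffeo[OF ES])
    show "e \<in> hs ` {..<D} \<Longrightarrow> e (k1 t) = k1 (e t)" for e t by (rule commute[OF ES k1(1)])
    show "\<exists>q\<in>{a 0..b 0}. e q = q" if e: "e \<in> hs ` {..<D}" for e
    proof -
      obtain i where i: "i < D" "e = hs i" using e by auto
      then have "a i \<in> {a 0..b 0}" using ab0[of i] ab(1)[of i] by auto
      then show ?thesis using ab(3)[of i] i by auto
    qed
    show "e ` {a 0..b 0} \<subseteq> {a 0..b 0}" if e: "e \<in> hs ` {..<D}" for e
    proof -
      obtain i where i: "i < D" "e = hs i" using e by auto
      then have eS: "e \<in> S" "support_component e (A i)" using chain(1) by auto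
      \<comment> \<open>The letter keeps \<open>x\<close> in its own component and thus in
        \<open>A 0\<close>; the absence of crossings then makes it preserve \<open>A 0\<close>,
        hence fix its endpoints.\<close>
      have "e ` A i = A i" by (rule support_component_self_image[OF eS(2) S.mono[OF eS(1)] S.surj[OF eS(1)]])
      then have "e x \<in> A 0" using x[of i] A0[of i] i by auto
      then have "e ` A 0 = A 0" using chain(2)[OF _ eS(1), of 0] x[of 0] by auto
      then have "{a 0<..<b 0} = {e (a 0)<..<e (b 0)}"
        using strict_mono_surj_image_interval(1)[OF S.mono[OF eS(1)] S.surj[OF eS(1)], of "a 0" "b 0"] A00 by simp
      then have "e (a 0) = a 0" "e (b 0) = b 0" using open_interval_eqD[OF A00(2), of "e (a 0)" "e (b 0)"] by simp_all
      then show ?thesis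
        using strict_mono_surj_image_interval(2)[OF S.mono[OF eS(1)] S.surj[OF eS(1)], of "a 0" "b 0"] by simp
    qed
    show "{u..b D} \<subseteq> {a 0..b 0}" using u ab0[of D] by auto
    show "{a 0..b 0} \<subseteq> {a 0..b 0}" by simp
    show "1 \<le> \<tau> * (1 + \<tau> * D)" by fact
    fix Q
    have "A D \<noteq> {}" using x[of D] by auto
    have "\<exists>Y. finite Y \<and> Q ^ D \<le> card Y \<and>
      (\<forall>gs\<in>Y. set gs \<subseteq> hs ` {..<D} \<and> length gs \<le> D * Q \<and> word gs ` A D \<subseteq> A (D - D)) \<and>
      (\<forall>gs\<in>Y. \<forall>gs'\<in>Y. gs \<noteq> gs' \<longrightarrow> word gs ` A D \<inter> word gs' ` A D = {})"
    proof (rule chain_words[where hs = hs and A = A and D = D and n = D])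
      show "\<And>i. i \<le> D \<Longrightarrow> hs i \<in> S \<and> support_component (hs i) (A i)" by (rule chain(1))
      show "\<And>i g. i \<le> D \<Longrightarrow> g \<in> S \<Longrightarrow> g ` A i = A i \<or> g ` A i \<inter> A i = {}" by (rule chain(2))
      show "\<And>i. i < D \<Longrightarrow> A (Suc i) \<subset> A i" by (rule chain(3))
    qed (use \<open>A D \<noteq> {}\<close> in simp_all)
    then obtain Y where Y0: "finite Y" "Q ^ D \<le> card Y"
      "\<forall>gs\<in>Y. set gs \<subseteq> hs ` {..<D} \<and> length gs \<le> D * Q \<and> word gs ` A D \<subseteq> A (D - D)"
      "\<forall>gs\<in>Y. \<forall>gs'\<in>Y. gs \<noteq> gs' \<longrightarrow> word gs ` A D \<inter> word gs' ` A D = {}" by (elim exE conjE)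
    have Y: "finite Y" "Q ^ D \<le> card Y" "\<And>gs. gs \<in> Y \<Longrightarrow> set gs \<subseteq> hs ` {..<D}"
      "\<And>gs. gs \<in> Y \<Longrightarrow> length gs \<le> D * Q"
      "\<And>gs gs'. gs \<in> Y \<Longrightarrow> gs' \<in> Y \<Longrightarrow> gs \<noteq> gs' \<Longrightarrow> word gs ` A D \<inter> word gs' ` A D = {}"
      using Y0 by simp_all
    have uA: "{u<..<b D} \<subseteq> A D" unfolding ab(2)[OF order_refl] using u(1) by auto
    have disj: "word gs ` {u<..<b D} \<inter> word gs' ` {u<..<b D} = {}" if "gs \<in> Y" "gs' \<in> Y" "gs \<noteq> gs'" for gs gs'
      using Y(5)[OF that] image_mono[OF uA, of "word gs"] image_mono[OF uA, of "word gs'"] by blast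
    show "\<exists>Y. finite Y \<and> Q ^ D \<le> card Y \<and> (\<forall>gs\<in>Y. set gs \<subseteq> hs ` {..<D} \<and> length gs \<le> D * Q) \<and>
        (\<forall>gs\<in>Y. \<forall>gs'\<in>Y. gs \<noteq> gs' \<longrightarrow> word gs ` {u<..<b D} \<inter> word gs' ` {u<..<b D} = {})"
      by (intro exI[of _ Y] conjI ballI impI Y disj)
  qed
qed

text \<open>Comparing \<open>A 2\<close> with \<open>B 1\<close> instead of equal levels takes care
  of equality: unless \<open>A 2\<close> is strictly inside \<open>B 1\<close>, \<open>B 1\<close>
  lies in \<open>A 2\<close> and so strictly inside \<open>A 1\<close>. The levels
  \<open>A 0\<close> and \<open>B 0\<close> only ensure that \<open>A 1\<close> and
  \<open>B 1\<close> are bounded. Below level 2 there remain \<open>D\<close> further levels, whence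
  \<open>D + 2\<close>.\<close>

theorem overlapping_supports_contradiction:
  assumes D: "1 \<le> \<tau> * (1 + \<tau> * real D)"
    and h: "h \<in> (commutator_group ^^ (D + 2)) S" "h y = y" "h x \<noteq> x"
    and k: "k \<in> (commutator_group ^^ (D + 2)) K" "k z = z" "k x \<noteq> x"
  shows False
proof -
  interpret sw: commuting_line_groups \<tau> K S by (rule swap)
  have hS: "h \<in> S" using h(1) commutator_group_power_subset by blast
  have kK: "k \<in> K" using k(1) sw.commutator_group_power_subset by blast
  from component_chain[OF kK k(2,3) h(1,3)]
  obtain hs A where "\<forall>i\<le>D + 2. hs i \<in> S \<and> support_component (hs i) (A i) \<and> x \<in> A i"
    "\<forall>i<D + 2. A (Suc i) \<subset> A i" by (elim exE conjE)
  then have A: "\<And>i. i \<le> D + 2 \<Longrightarrow> hs i \<in> S \<and> support_component (hs i) (A i) \<and> x \<in> A i"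
    "\<And>i. i < D + 2 \<Longrightarrow> A (Suc i) \<subset> A i" by simp_all
  from sw.component_chain[OF hS h(2,3) k(1,3)]
  obtain ks B where "\<forall>i\<le>D + 2. ks i \<in> K \<and> support_component (ks i) (B i) \<and> x \<in> B i"
    "\<forall>i<D + 2. B (Suc i) \<subset> B i" by (elim exE conjE)
  then have B: "\<And>i. i \<le> D + 2 \<Longrightarrow> ks i \<in> K \<and> support_component (ks i) (B i) \<and> x \<in> B i"
    "\<And>i. i < D + 2 \<Longrightarrow> B (Suc i) \<subset> B i" by simp_all
  have ncA: "g ` A i = A i \<or> g ` A i \<inter> A i = {}" if "i \<le> D + 2" "g \<in> S" for i g
    using component_images_disjoint[OF _ _ _ that(2) kK k(2,3)] A(1)[OF that(1)] by blast
  have ncB: "g ` B i = B i \<or> g ` B i \<inter> B i = {}" if "i \<le> D + 2" "g \<in> K" for i g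
    using sw.component_images_disjoint[OF _ _ _ that(2) hS h(2,3)] B(1)[OF that(1)] by blast
  have two: "hs 2 \<in> S" "support_component (hs 2) (A 2)" "x \<in> A 2"
    and one: "hs 1 \<in> S" "support_component (hs 1) (A 1)"
    and oneB: "ks 1 \<in> K" "support_component (ks 1) (B 1)" "x \<in> B 1"
    using A(1)[of 2] A(1)[of 1] B(1)[of 1] by auto
  have bounded: "\<exists>a b. J = {a<..<b}" if "support_component f J" "J \<subset> J'" for f J J'
    using that unfolding support_component_def by blast
  obtain a b where a: "A 1 = {a<..<b}" using bounded[OF one(2), of "A 0"] A(2)[of 0] by auto
  obtain c d where c: "B 1 = {c<..<d}" using bounded[OF oneB(2), of "B 0"] B(2)[of 0] by auto
  note bd = a c
  have "A 2 \<subset> A 1" using A(2)[of 1] by (simp add: numeral_2_eq_2)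
  have "A 2 \<subseteq> B 1 \<or> B 1 \<subseteq> A 2"
    using support_component_nested(1)[OF two(2) oneB(2) K.mono[OF oneB(1)] K.surj[OF oneB(1)]
      image_component[OF two(1) oneB(1) two(2)]] two(3) oneB(3) by blast
  then consider "A 2 \<subset> B 1" | "B 1 \<subseteq> A 2" by blast
  then show False
  proof cases
    case 1
    show False
    proof (rule displaced_chain_contradiction[OF D oneB(1), of c d "\<lambda>i. hs (i + 2)" "\<lambda>i. A (i + 2)" x])
      show "support_component (ks 1) {c<..<d}" using oneB(2) unfolding bd(2) .
      show "hs (i + 2) \<in> S \<and> support_component (hs (i + 2)) (A (i + 2))" "x \<in> A (i + 2)" if "i \<le> D" for i
        using A(1)[of "i + 2"] that by simp_all
      show "g ` A (i + 2) = A (i + 2) \<or> g ` A (i + 2) \<inter> A (i + 2) = {}" if "i \<le> D" "g \<in> S" for i g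
        using ncA[OF _ that(2), of "i + 2"] that(1) by simp
      show "A (Suc i + 2) \<subset> A (i + 2)" if "i < D" for i
        using A(2)[of "i + 2"] that by simp
      show "A (0 + 2) \<subset> {c<..<d}" using 1 unfolding bd(2) by (simp only: add_0)
    qed
  next
    case 2
    then have "B 1 \<subset> A 1" using \<open>A 2 \<subset> A 1\<close> by blast
    show False
    proof (rule sw.displaced_chain_contradiction[OF D one(1), of a b "\<lambda>i. ks (i + 1)" "\<lambda>i. B (i + 1)" x])
      show "support_component (hs 1) {a<..<b}" using one(2) unfolding bd(1) .
      show "ks (i + 1) \<in> K \<and> support_component (ks (i + 1)) (B (i + 1))" "x \<in> B (i + 1)" if "i \<le> D" for i
        using B(1)[of "i + 1"] that by simp_all
      show "g ` B (i + 1) = B (i + 1) \<or> g ` B (i + 1) \<inter> B (i + 1) = {}" if "i \<le> D" "g \<in> K" for i g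
        using ncB[OF _ that(2), of "i + 1"] that(1) by simp
      show "B (Suc i + 1) \<subset> B (i + 1)" if "i < D" for i
        using B(2)[of "i + 1"] that by simp
      show "B (0 + 1) \<subset> {a<..<b}" using \<open>B 1 \<subset> A 1\<close> unfolding bd(1) by simp
    qed
  qed
qed

end

section \<open>Lifts of circle diffeomorphisms\<close>

definition is_lift :: "(real \<Rightarrow> real) \<Rightarrow> (complex \<Rightarrow> complex) \<Rightarrow> bool"
  where "is_lift F f \<longleftrightarrow> continuous_on UNIV F \<and> strict_mono F \<and> (\<forall>t. F (t + 2 * pi) = F t + 2 * pi) \<and>
    (\<forall>t. cis (F t) = f (cis t))"

lemma cis_in_circle [simp]: "cis t \<in> circle"
  by simp

lemma circle_cisE:
  assumes "z \<in> circle" obtains t where "z = cis t"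
proof -
  have "cis (Arg z) = z" using assms by (subst cis_Arg) (auto simp: sgn_if complex_sgn_def)
  then show ?thesis using that by metis
qed

lemma cis_eq_int:
  assumes "cis a = cis b" obtains n :: int where "a = b + 2 * pi * n"
proof -
  have "cis (a - b) = 1" using assms by (simp flip: cis_divide)
  then have "cos (a - b) = 1" by (simp add: complex_eq_iff)
  then obtain n :: int where "a - b = of_int n * 2 * pi" unfolding cos_one_2pi_int by blast
  then show ?thesis by (intro that[of n]) (simp add: algebra_simps)
qed

lemma cis_add_2pi_int: "cis (t + 2 * pi * of_int n) = cis t"
  by (simp add: cis_mult[symmetric])

lemma is_lift_add_int:
  assumes "is_lift F f" shows "F (t + 2 * pi * of_int n) = F t + 2 * pi * of_int n"
proof -
  have per: "F (t + 2 * pi) = F t + 2 * pi" for t using assms unfolding is_lift_def by blast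
  have nat: "F (t + 2 * pi * real m) = F t + 2 * pi * real m" for t m
  proof (induction m)
    case (Suc m)
    have "F (t + 2 * pi * real (Suc m)) = F ((t + 2 * pi * real m) + 2 * pi)" by (simp add: algebra_simps)
    then show ?case unfolding per Suc by (simp add: algebra_simps)
  qed simp
  show ?thesis
  proof (cases "n \<ge> 0")
    case True
    then show ?thesis using nat[of t "nat n"] by simp
  next
    case False
    then show ?thesis using nat[of "t + 2 * pi * of_int n" "nat (- n)"] by simp
  qed
qed

lemma is_lift_surj:
  assumes "is_lift F f" shows "surj F"
  unfolding surj_def
proof
  fix y
  define N where "N = \<lceil>\<bar>y - F 0\<bar> / (2 * pi)\<rceil>"
  have N: "\<bar>y - F 0\<bar> \<le> 2 * pi * of_int N"
    using le_of_int_ceiling[of "\<bar>y - F 0\<bar> / (2 * pi)"] unfolding N_def[symmetric]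
    by (simp add: pos_divide_le_eq mult.commute)
  have "F (2 * pi * of_int N) = F 0 + 2 * pi * of_int N" "F (2 * pi * of_int (- N)) = F 0 + 2 * pi * of_int (- N)"
    using is_lift_add_int[OF assms, of 0 N] is_lift_add_int[OF assms, of 0 "- N"] by (simp_all only: add_0)
  then have "F (- (2 * pi * of_int N)) \<le> y" "y \<le> F (2 * pi * of_int N)" using N by (auto simp: abs_le_iff)
  moreover have "- (2 * pi * of_int N) \<le> 2 * pi * of_int N" using N by linarith
  moreover have "continuous_on {- (2 * pi * of_int N)..2 * pi * of_int N} F"
    using assms unfolding is_lift_def by (blast intro: continuous_on_subset)
  ultimately obtain x where "F x = y" using IVT'[of F] by blast
  then show "\<exists>x. y = F x" by blast
qed

text \<open>The difference of two lifts is continuous with values in the integer multiples of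
  \<open>2 * pi\<close>, where distinct values are at least \<open>2 * pi\<close> apart.\<close>

lemma is_lift_unique:
  assumes "is_lift F f" "is_lift G f"
  shows "\<exists>n :: int. \<forall>t. F t = G t + 2 * pi * n"
proof -
  have int: "\<exists>n::int. F t = G t + 2 * pi * n" for t
    using assms unfolding is_lift_def by (metis cis_eq_int)
  have "(\<lambda>t. F t - G t) constant_on UNIV"
  proof (rule continuous_discrete_range_constant)
    show "continuous_on UNIV (\<lambda>t. F t - G t)"
      using assms unfolding is_lift_def by (intro continuous_intros) auto
    fix x :: real
    have "2 * pi \<le> norm (F y - G y - (F x - G x))" if ne: "F y - G y \<noteq> F x - G x" for y
    proof -
      obtain n m :: int where nm: "F y = G y + 2 * pi * n" "F x = G x + 2 * pi * m" using int by metis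
      then have "n \<noteq> m" using ne by auto
      then have "\<bar>real_of_int n - real_of_int m\<bar> \<ge> 1" by linarith
      then have "2 * pi * 1 \<le> 2 * pi * \<bar>real_of_int n - real_of_int m\<bar>" by (intro mult_left_mono) auto
      also have "\<dots> = \<bar>2 * pi * n - 2 * pi * m\<bar>" by (simp add: abs_mult flip: right_diff_distrib)
      finally show ?thesis unfolding nm by simp
    qed
    then show "\<exists>e>0. \<forall>y. y \<in> UNIV \<and> F y - G y \<noteq> F x - G x \<longrightarrow> e \<le> norm (F y - G y - (F x - G x))"
      by (intro exI[of _ "2 * pi"]) auto
  qed simp
  then obtain c where c: "\<And>t. F t - G t = c" unfolding constant_on_def by blast
  obtain n :: int where n: "F 0 = G 0 + 2 * pi * n" using int by blast
  have "F t = G t + 2 * pi * n" for t using c[of t] c[of 0] n by simp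
  then show ?thesis by blast
qed

lemma is_lift_comp:
  assumes "is_lift F f" "is_lift G g" "\<And>z. z \<in> circle \<Longrightarrow> f (g z) = h z"
  shows "is_lift (F \<circ> G) h"
proof -
  have "continuous_on UNIV (F \<circ> G)" using assms(1,2) unfolding is_lift_def
    by (intro continuous_on_compose) (auto intro: continuous_on_subset)
  moreover have "strict_mono (F \<circ> G)" using assms(1,2) unfolding is_lift_def strict_mono_def by simp
  moreover have "cis (F (G t)) = h (cis t)" for t
  proof -
    have "cis (F (G t)) = f (g (cis t))" using assms(1,2) unfolding is_lift_def by simp
    then show ?thesis using assms(3)[of "cis t"] by simp
  qed
  ultimately show ?thesis using assms(1,2) unfolding is_lift_def by simp
qed

lemma is_lift_translate:
  assumes "is_lift F f" shows "is_lift (\<lambda>t. F t + 2 * pi * of_int n) f"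
  using assms unfolding is_lift_def strict_mono_def
  by (auto intro!: continuous_intros simp: cis_add_2pi_int)

text \<open>\<open>F \<circ> G\<close> lifts the identity, so it is a translation by a multiple of
  \<open>2 * pi\<close>. Correcting \<open>G\<close> by this translation gives the inverse of
  \<open>F\<close>, still a lift of \<open>g\<close>.\<close>

lemma is_lift_inv:
  assumes "is_lift F f" "is_lift G g" "\<And>z. z \<in> circle \<Longrightarrow> f (g z) = z"
  shows "is_lift (inv_fun F) g"
proof -
  have "is_lift (F \<circ> G) id" by (rule is_lift_comp[OF assms(1,2)]) (simp add: assms(3))
  moreover have "is_lift id id" unfolding is_lift_def by (auto simp: strict_mono_def continuous_on_id' id_def)
  ultimately obtain n :: int where n: "\<And>t. (F \<circ> G) t = id t + 2 * pi * n" using is_lift_unique by blast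
  have "inj F" using assms(1) unfolding is_lift_def by (blast intro: strict_mono_imp_inj_on)
  have "F (G t + 2 * pi * of_int (- n)) = t" for t
    using is_lift_add_int[OF assms(1), of "G t" "- n"] n[of t] by simp
  then have "inv_fun F = (\<lambda>t. G t + 2 * pi * of_int (- n))"
    using inv_f_f[OF \<open>inj F\<close>] by metis
  then show ?thesis using is_lift_translate[OF assms(2), of "- n"] by simp
qed

lemma is_lift_bounded_displacement:
  assumes "is_lift F f"
  shows "\<exists>j::nat. \<forall>t. \<bar>F t - t\<bar> \<le> 2 * pi * j"
proof -
  obtain j :: nat where j: "\<bar>F 0\<bar> + 2 * pi \<le> j * (2 * pi)"
    using reals_Archimedean3[of "2 * pi"] by (metis less_imp_le pi_gt_zero mult_pos_pos zero_less_numeral)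
  have "\<bar>F t - t\<bar> \<le> 2 * pi * j" for t
  proof -
    define k where "k = \<lfloor>t / (2 * pi)\<rfloor>"
    have k: "2 * pi * of_int k \<le> t" "t \<le> 2 * pi * of_int (k + 1)"
      using of_int_floor_le[of "t / (2 * pi)"] real_of_int_floor_add_one_ge[of "t / (2 * pi)"]
      unfolding k_def[symmetric] by (simp_all add: pos_le_divide_eq pos_divide_le_eq mult.commute)
    have m: "x \<le> y \<Longrightarrow> F x \<le> F y" for x y using assms unfolding is_lift_def by (simp add: strict_mono_less_eq)
    have "F 0 + 2 * pi * of_int k \<le> F t" "F t \<le> F 0 + 2 * pi * of_int (k + 1)"
      using m[OF k(1)] m[OF k(2)] is_lift_add_int[OF assms, of 0 k] is_lift_add_int[OF assms, of 0 "k + 1"]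
      by (simp_all only: add_0)
    then show ?thesis using k j abs_ge_self[of "F 0"] abs_ge_minus_self[of "F 0"]
      by (auto simp: algebra_simps abs_le_iff)
  qed
  then show ?thesis by blast
qed

text \<open>
  The lifts of commuting maps commute up to a translation by \<open>2 * pi * n\<close>; iterating one of them
  \<open>m\<close> times multiplies the translation by \<open>m\<close> while all displacements stay bounded.
\<close>

lemma is_lift_commute:
  assumes F: "is_lift F f" and G: "is_lift G g" and fg: "\<And>z. z \<in> circle \<Longrightarrow> f (g z) = g (f z)"
  shows "F (G t) = G (F t)"
proof -
  have "is_lift (F \<circ> G) (g \<circ> f)" by (rule is_lift_comp[OF F G]) (simp add: fg)
  moreover have "is_lift (G \<circ> F) (g \<circ> f)" by (rule is_lift_comp[OF G F]) simp
  ultimately obtain n :: int where n: "\<And>t. (F \<circ> G) t = (G \<circ> F) t + 2 * pi * n" using is_lift_unique by blast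
  have iter: "(F ^^ m) (G t) = G ((F ^^ m) t) + 2 * pi * of_int (n * int m)" for m
  proof (induction m)
    case (Suc m)
    have "(F ^^ Suc m) (G t) = F (G ((F ^^ m) t) + 2 * pi * of_int (n * int m))" using Suc by simp
    also have "\<dots> = F (G ((F ^^ m) t)) + 2 * pi * of_int (n * int m)" by (rule is_lift_add_int[OF F])
    also have "F (G ((F ^^ m) t)) = G ((F ^^ Suc m) t) + 2 * pi * n" using n[of "(F ^^ m) t"] by simp
    finally show ?case by (simp add: algebra_simps)
  qed simp
  obtain j :: nat where j: "\<And>t. \<bar>G t - t\<bar> \<le> 2 * pi * j" using is_lift_bounded_displacement[OF G] by blast
  have m: "strict_mono (F ^^ m)" for m using strict_mono_funpow[of F m] F unfolding is_lift_def by blast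
  have per: "(F ^^ m) (t + 2 * pi * of_int i) = (F ^^ m) t + 2 * pi * of_int i" for m i
    by (induction m) (simp_all add: is_lift_add_int[OF F])
  have "\<bar>2 * pi * of_int (n * int m)\<bar> \<le> 2 * (2 * pi * j)" for m
  proof -
    have "t + 2 * pi * of_int (- int j) \<le> G t" "G t \<le> t + 2 * pi * of_int (int j)" using j[of t] by (auto simp: abs_le_iff)
    then have "(F ^^ m) (t + 2 * pi * of_int (- int j)) \<le> (F ^^ m) (G t)" "(F ^^ m) (G t) \<le> (F ^^ m) (t + 2 * pi * of_int (int j))"
      using m[of m] by (simp_all only: strict_mono_less_eq)
    then have "\<bar>(F ^^ m) (G t) - (F ^^ m) t\<bar> \<le> 2 * pi * j" unfolding per by (auto simp: abs_le_iff)
    then show ?thesis using j[of "(F ^^ m) t"] unfolding iter[of m] by linarith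
  qed
  then have bd: "\<bar>real_of_int n\<bar> * m \<le> 2 * j" for m :: nat by (simp add: abs_mult mult.commute)
  have "n = 0"
  proof (rule ccontr)
    assume "n \<noteq> 0"
    then have "\<bar>real_of_int n\<bar> \<ge> 1" by linarith
    then have "1 * real (2 * j + 1) \<le> \<bar>real_of_int n\<bar> * real (2 * j + 1)" by (intro mult_right_mono) auto
    also have "\<dots> \<le> 2 * real j" using bd[of "2 * j + 1"] by simp
    finally show False by simp
  qed
  then show ?thesis using n[of t] by simp
qed

lemma circle_diffeo_deriv:
  assumes "C1_circle_map f" "orientation_preserving f"
  shows "f (cis t) \<in> circle" "has_circle_deriv f (circle_deriv f (cis t)) (cis t)"
    "continuous_on UNIV (\<lambda>t. circle_deriv f (cis t))" "circle_deriv f (cis t) > 0"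
proof -
  show im: "f (cis t) \<in> circle" using assms(1) cis_in_circle[of t] unfolding C1_circle_map_def by blast
  obtain D where "has_circle_deriv f D (cis t)"
    using assms(1) cis_in_circle[of t] unfolding C1_circle_map_def by blast
  then show "has_circle_deriv f (circle_deriv f (cis t)) (cis t)"
    using circle_deriv_eqI[of f D "cis t"] im by simp
  show "circle_deriv f (cis t) > 0" using assms(2) cis_in_circle[of t] unfolding orientation_preserving_def by blast
  have "continuous_on UNIV (circle_deriv f \<circ> cis)"
    using assms(1) unfolding C1_circle_map_def
    by (intro continuous_on_compose) (auto intro: continuous_intros continuous_on_subset)
  then show "continuous_on UNIV (\<lambda>t. circle_deriv f (cis t))" by (simp add: o_def)
qed

text \<open>
  The lift is the antiderivative \<open>F\<close> of the circle derivative: \<open>f (cis t)\<close> and \<open>cis (F t)\<close> solve the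
  same linear differential equation.
\<close>

lemma is_lift_exists:
  assumes "C1_circle_map f" "orientation_preserving f" "inj_on f circle"
  shows "\<exists>F. is_lift F f \<and> (\<forall>t. (F has_real_derivative circle_deriv f (cis t)) (at t))"
proof -
  note d = circle_diffeo_deriv[OF assms(1,2)]
  define d where "d = (\<lambda>t. circle_deriv f (cis t))"
  have "\<exists>F. \<forall>x::real. -\<infinity> < ereal x \<longrightarrow> ereal x < \<infinity> \<longrightarrow> (F has_vector_derivative d x) (at x)"
    using d(3) unfolding d_def by (intro einterval_antiderivative) (auto simp: continuous_on_eq_continuous_at)
  then obtain F0 where F0: "\<And>x. (F0 has_real_derivative d x) (at x)"
    by (auto simp: has_real_derivative_iff_has_vector_derivative)
  obtain \<theta> where \<theta>: "f (cis 0) = cis \<theta>" using circle_cisE[OF d(1)] by metis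
  define F where "F = (\<lambda>t. F0 t - F0 0 + \<theta>)"
  have F: "(F has_real_derivative d t) (at t)" for t
    unfolding F_def by (auto intro!: derivative_eq_intros F0)
  have f': "((\<lambda>t. f (cis t)) has_vector_derivative d t *\<^sub>R (\<i> * f (cis t))) (at t)" for t
  proof -
    have "((\<lambda>s. f (cis t * cis s)) has_vector_derivative d t *\<^sub>R (\<i> * f (cis t))) (at (t - t))"
      using d(2)[of t] unfolding has_circle_deriv_def d_def by simp
    moreover have "((\<lambda>x. x - t) has_vector_derivative 1) (at t)"
      by (auto intro!: derivative_eq_intros)
    ultimately have "((\<lambda>s. f (cis t * cis s)) \<circ> (\<lambda>x. x - t) has_vector_derivative 1 *\<^sub>R (d t *\<^sub>R (\<i> * f (cis t)))) (at t)"
      by (intro vector_diff_chain_at)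
    then show ?thesis by (simp add: o_def cis_mult)
  qed
  have c': "((\<lambda>t. cis (- F t)) has_vector_derivative - d t *\<^sub>R (\<i> * cis (- F t))) (at t)" for t
  proof -
    have "((\<lambda>t. - F t) has_derivative (\<lambda>x. x * - d t)) (at t)"
      using DERIV_minus[OF F[of t]] unfolding has_field_derivative_def
      by (rule has_derivative_eq_rhs) (simp add: fun_eq_iff mult.commute)
    from has_derivative_cis[OF this] show ?thesis
      by (simp add: has_vector_derivative_def algebra_simps)
  qed
  have "((\<lambda>t. f (cis t) * cis (- F t)) has_vector_derivative 0) (at t)" for t
    using has_vector_derivative_mult[OF f'[of t] c'[of t]] by (simp add: algebra_simps)
  then obtain c0 where c0: "\<And>t. f (cis t) * cis (- F t) = c0"
    using has_vector_derivative_zero_constant[of UNIV "\<lambda>t. f (cis t) * cis (- F t)"] by auto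
  then have "c0 = f (cis 0) * cis (- F 0)" using c0[of 0] by simp
  then have "c0 = 1" unfolding \<theta> by (simp add: F_def cis_mult)
  then have "f (cis t) * cis (- F t) = 1" for t using c0 by simp
  then have lift: "cis (F t) = f (cis t)" for t
  proof -
    have "f (cis t) * cis (- F t) * cis (F t) = cis (F t)" using \<open>f (cis t) * cis (- F t) = 1\<close> by simp
    then show ?thesis by (simp add: cis_mult mult.assoc)
  qed
  have pos: "d t > 0" for t using d(4) unfolding d_def .
  have mono: "strict_mono F" using DERIV_pos_strict_mono[OF F pos] .
  have cont: "continuous_on A F" for A using F by (meson DERIV_isCont continuous_at_imp_continuous_on)
  have inj: "cis s = cis t" if "F s = F t + 2 * pi * of_int n" for s t n
  proof -
    have "f (cis s) = f (cis t)" using that lift[of s] lift[of t] cis_add_2pi_int by metis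
    then show ?thesis using assms(3) cis_in_circle by (metis inj_onD)
  qed
  obtain c where "\<And>t. t \<in> UNIV \<Longrightarrow> F (t + 2 * pi) - F t = c"
  proof (rule has_vector_derivative_zero_constant[of UNIV "\<lambda>t. F (t + 2 * pi) - F t"])
    show "((\<lambda>t. F (t + 2 * pi) - F t) has_vector_derivative 0) (at t)" for t
    proof -
      have "d (t + 2 * pi) = d t" unfolding d_def using cis_add_2pi_int[of t 1] by simp
      moreover have "((\<lambda>t. F (t + 2 * pi)) has_real_derivative d (t + 2 * pi)) (at t)"
        using F[of "t + 2 * pi"] by (simp add: DERIV_shift)
      ultimately have "((\<lambda>t. F (t + 2 * pi) - F t) has_real_derivative 0) (at t)"
        using DERIV_diff[OF _ F[of t]] by fastforce
      then show ?thesis by (simp add: has_real_derivative_iff_has_vector_derivative)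
    qed
  qed simp_all
  then have c: "F (t + 2 * pi) = F t + c" for t by (simp add: algebra_simps)
  have "cis (F (0 + 2 * pi)) = cis (F 0)" unfolding lift using cis_add_2pi_int[of 0 1] by simp
  then obtain m :: int where m: "F (0 + 2 * pi) = F 0 + 2 * pi * m" by (rule cis_eq_int)
  then have cm: "c = 2 * pi * m" using c[of 0] by simp
  have "F 0 < F (0 + 2 * pi)" using mono by (simp add: strict_mono_less)
  then have "m > 0" using m by (simp add: zero_less_mult_iff)
  \<comment> \<open>The degree is 1 by injectivity: otherwise \<open>F\<close> would gain
    \<open>2 * pi\<close> strictly before a full turn, and two different points of the circle would
    have the same image.\<close>
  have "m = 1"
  proof (rule ccontr)
    assume "m \<noteq> 1"
    then have "2 \<le> m" using \<open>m > 0\<close> by simp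
    then have "F 0 + 2 * pi < F (2 * pi)" using m by simp
    then obtain s where s: "0 \<le> s" "s \<le> 2 * pi" "F s = F 0 + 2 * pi"
      using IVT'[of F 0 "F 0 + 2 * pi" "2 * pi"] cont by auto
    have "s \<noteq> 0" "s \<noteq> 2 * pi" using s \<open>F 0 + 2 * pi < F (2 * pi)\<close> by auto
    have "cis s = cis 0" using inj[of s 0 1] s by simp
    then obtain n :: int where "s = 0 + 2 * pi * n" by (rule cis_eq_int)
    moreover have "0 < s" "s < 2 * pi" using s(1,2) \<open>s \<noteq> 0\<close> \<open>s \<noteq> 2 * pi\<close> by linarith+
    ultimately have "0 < real_of_int n" "real_of_int n < 1" by (simp_all add: zero_less_mult_iff)
    then show False by simp
  qed
  then have "is_lift F f" unfolding is_lift_def using cont mono lift c cm by simp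
  then show ?thesis using F unfolding d_def by blast
qed

section \<open>Hoelder regularity of lifts\<close>

lemma ln_Lipschitz:
  fixes x y m :: real
  assumes "m > 0" "m \<le> x" "m \<le> y" shows "\<bar>ln x - ln y\<bar> \<le> \<bar>x - y\<bar> / m"
proof -
  have *: "ln a - ln b \<le> \<bar>a - b\<bar> / m" if "m \<le> a" "m \<le> b" for a b
  proof -
    have "ln a - ln b = ln (a / b)" using that assms(1) by (simp add: ln_div)
    also have "\<dots> \<le> a / b - 1" using that assms(1) by (intro ln_le_minus_one) auto
    also have "\<dots> = (a - b) / b" using that assms(1) by (simp add: field_simps)
    also have "\<dots> \<le> \<bar>a - b\<bar> / b" using that assms(1) by (intro divide_right_mono) auto
    also have "\<dots> \<le> \<bar>a - b\<bar> / m" using that assms(1) by (intro divide_left_mono) auto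
    finally show ?thesis .
  qed
  show ?thesis using *[OF assms(2,3)] *[OF assms(3,2)] by (simp add: abs_le_iff abs_minus_commute)
qed

lemma dist_cis_le: "dist (cis s) (cis t) \<le> \<bar>s - t\<bar>"
proof -
  have "cis s - cis t = cis t * (exp (\<i> * of_real (s - t)) - 1)"
    unfolding cis_conv_exp[symmetric] right_diff_distrib cis_mult by simp
  then have "dist (cis s) (cis t) = 2 * \<bar>sin ((s - t) / 2)\<bar>"
    by (simp only: dist_norm norm_mult norm_cis dist_exp_i_1 mult_1)
  also have "\<dots> \<le> 2 * \<bar>(s - t) / 2\<bar>" by (intro mult_left_mono abs_sin_x_le_abs_x) auto
  finally show ?thesis by simp
qed

lemma is_lift_line_diffeo:
  assumes F: "is_lift F f" and "\<tau> > 0" and f: "C1_circle_map f" "orientation_preserving f" "inj_on f circle"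
    "holder_on \<tau> circle (circle_deriv f)"
  shows "line_diffeo (min \<tau> 1) F"
proof -
  define d where "d = (\<lambda>t. circle_deriv f (cis t))"
  obtain G where G: "is_lift G f" "\<And>t. (G has_real_derivative d t) (at t)"
    using is_lift_exists[OF f(1-3)] unfolding d_def by blast
  obtain n :: int where n: "\<And>t. F t = G t + 2 * pi * n" using is_lift_unique[OF F G(1)] by blast
  have D: "(F has_real_derivative d t) (at t)" for t
  proof -
    have "F = (\<lambda>t. G t + 2 * pi * n)" using n by blast
    then show ?thesis using G(2)[of t] by (auto intro!: derivative_eq_intros)
  qed
  have pos: "d t > 0" for t using circle_diffeo_deriv(4)[OF f(1,2)] unfolding d_def .
  obtain z0 where z0: "z0 \<in> circle" "\<And>z. z \<in> circle \<Longrightarrow> circle_deriv f z0 \<le> circle_deriv f z"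
    using continuous_attains_inf[of circle "circle_deriv f"] f(1) unfolding C1_circle_map_def by auto
  define m where "m = circle_deriv f z0"
  have m: "m > 0" "m \<le> d t" for t
    using f(2) z0 unfolding m_def d_def orientation_preserving_def by auto
  obtain C0 where "\<forall>x\<in>circle. \<forall>y\<in>circle. dist (circle_deriv f x) (circle_deriv f y) \<le> C0 * dist x y powr \<tau>"
    using f(4) unfolding holder_on_def by blast
  then have C0: "\<bar>d s - d t\<bar> \<le> C0 * dist (cis s) (cis t) powr \<tau>" for s t
    unfolding d_def dist_real_def[symmetric] by (meson cis_in_circle)
  \<comment> \<open>Chordal distances are at most 2, so lowering the exponent from
    \<open>\<tau>\<close> to \<open>min \<tau> 1\<close> costs the power of 2; the minimum
    \<open>m\<close> of the derivative is the price for passing to logarithms.\<close>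
  define C where "C = max C0 0 * 2 powr (\<tau> - min \<tau> 1) / m"
  have "\<bar>ln (d s) - ln (d t)\<bar> \<le> C * \<bar>s - t\<bar> powr (min \<tau> 1)" for s t
  proof -
    define r where "r = dist (cis s) (cis t)"
    have r: "r \<ge> 0" "r \<le> 2" "r \<le> \<bar>s - t\<bar>"
      using norm_triangle_ineq4[of "cis s" "cis t"] dist_cis_le[of s t] unfolding r_def dist_norm by auto
    have "r powr \<tau> = r powr (\<tau> - min \<tau> 1) * r powr (min \<tau> 1)" by (simp flip: powr_add)
    also have "\<dots> \<le> 2 powr (\<tau> - min \<tau> 1) * \<bar>s - t\<bar> powr (min \<tau> 1)"
      using r \<open>\<tau> > 0\<close> by (intro mult_mono powr_mono2) auto
    finally have "r powr \<tau> \<le> 2 powr (\<tau> - min \<tau> 1) * \<bar>s - t\<bar> powr (min \<tau> 1)" .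
    then have "max C0 0 * r powr \<tau> \<le> max C0 0 * (2 powr (\<tau> - min \<tau> 1) * \<bar>s - t\<bar> powr (min \<tau> 1))"
      by (intro mult_left_mono) auto
    moreover have "C0 * r powr \<tau> \<le> max C0 0 * r powr \<tau>" by (intro mult_right_mono) auto
    ultimately have "\<bar>d s - d t\<bar> \<le> max C0 0 * (2 powr (\<tau> - min \<tau> 1) * \<bar>s - t\<bar> powr (min \<tau> 1))"
      using C0[of s t] unfolding r_def by linarith
    then have "\<bar>d s - d t\<bar> / m \<le> C * \<bar>s - t\<bar> powr (min \<tau> 1)"
      using m(1) unfolding C_def by (simp add: divide_right_mono mult.assoc)
    then show ?thesis using ln_Lipschitz[OF m(1) m(2) m(2), of s t] by linarith
  qed
  then have "\<exists>C f'. \<forall>s. (F has_real_derivative f' s) (at s) \<and> f' s > 0 \<and>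
       (\<forall>t. \<bar>ln (f' s) - ln (f' t)\<bar> \<le> C * \<bar>s - t\<bar> powr (min \<tau> 1))"
    using D pos by (intro exI[of _ C] exI[of _ d]) simp
  \<comment> \<open>With \<open>t\<close> all its translates by multiples of \<open>2 * pi\<close>
    are fixed, so fixed points occur arbitrarily far out on both sides.\<close>
  moreover have "(\<exists>t. F t = t) \<longrightarrow> (\<forall>x. (\<exists>t<x. F t = t) \<and> (\<exists>t>x. F t = t))"
  proof (intro impI allI)
    fix x assume "\<exists>t. F t = t"
    then obtain t where t: "F t = t" by blast
    have fx: "F (t + 2 * pi * of_int i) = t + 2 * pi * of_int i" for i
      using is_lift_add_int[OF F, of t i] t by simp
    obtain N :: nat where N: "\<bar>x - t\<bar> < N * (2 * pi)"
      using reals_Archimedean3[of "2 * pi"] by (metis pi_gt_zero mult_pos_pos zero_less_numeral)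
    show "(\<exists>t<x. F t = t) \<and> (\<exists>t>x. F t = t)"
    proof
      show "\<exists>t<x. F t = t" using fx[of "- int N"] N by (intro exI[of _ "t + 2 * pi * of_int (- int N)"]) (auto simp: mult.commute abs_less_iff)
      show "\<exists>t>x. F t = t" using fx[of "int N"] N by (intro exI[of _ "t + 2 * pi * of_int (int N)"]) (auto simp: mult.commute abs_less_iff)
    qed
  qed
  ultimately show ?thesis unfolding line_diffeo_def using F is_lift_surj[OF F] unfolding is_lift_def by simp
qed

section \<open>Actions of non-solvable groups\<close>

lemma Diff_circleD:
  assumes "f \<in> carrier (Diff_circle \<tau>)"
  shows "f \<in> extensional circle" "f ` circle = circle" "inj_on f circle" "C1_circle_map f"
    "orientation_preserving f" "holder_on \<tau> circle (circle_deriv f)" "f \<in> Bij circle"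
  using assms unfolding Diff_circle_def Bij_def C1_circle_diffeo_def by (auto simp: bij_betw_def)

lemma Diff_circle_mult:
  assumes "f \<in> carrier (Diff_circle \<tau>)" "g \<in> carrier (Diff_circle \<tau>)" "z \<in> circle"
  shows "(f \<otimes>\<^bsub>Diff_circle \<tau>\<^esub> g) z = f (g z)"
  using Diff_circleD(7)[OF assms(1)] Diff_circleD(7)[OF assms(2)] assms(3)
  by (simp add: Diff_circle_def BijGroup_def compose_def)

locale faithful_circle_action = group G for G (structure) +
  fixes \<tau> :: real and \<psi> :: "'a \<Rightarrow> complex \<Rightarrow> complex"
  assumes tau: "\<tau> > 0"
    and diff: "g \<in> carrier G \<Longrightarrow> \<psi> g \<in> carrier (Diff_circle \<tau>)"
    and mult: "g \<in> carrier G \<Longrightarrow> h \<in> carrier G \<Longrightarrow> z \<in> circle \<Longrightarrow> \<psi> (g \<otimes> h) z = \<psi> g (\<psi> h z)"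
    and faithful: "g \<in> carrier G \<Longrightarrow> h \<in> carrier G \<Longrightarrow> (\<And>z. z \<in> circle \<Longrightarrow> \<psi> g z = \<psi> h z) \<Longrightarrow> g = h"
begin

lemma one_apply: "z \<in> circle \<Longrightarrow> \<psi> \<one> z = z"
proof -
  assume z: "z \<in> circle"
  have "\<psi> \<one> z \<in> circle" using Diff_circleD(2)[OF diff[OF one_closed]] z by blast
  moreover have "\<psi> \<one> (\<psi> \<one> z) = \<psi> \<one> z" using mult[OF one_closed one_closed z] by simp
  ultimately show ?thesis using inj_onD[OF Diff_circleD(3)[OF diff[OF one_closed]]] z by blast
qed

text \<open>All lifts of all elements, including the translations by multiples of
  \<open>2 * pi\<close>: a central extension of \<open>G\<close> by the integers.\<close>

definition lifts :: "(real \<Rightarrow> real) set"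
  where "lifts = {F. \<exists>g\<in>carrier G. is_lift F (\<psi> g)}"

lemma lift_exists: "g \<in> carrier G \<Longrightarrow> \<exists>F. is_lift F (\<psi> g)"
  using is_lift_exists[OF Diff_circleD(4,5,3)[OF diff]] by blast

lemma lift_comp: "is_lift F (\<psi> g) \<Longrightarrow> is_lift F' (\<psi> h) \<Longrightarrow> g \<in> carrier G \<Longrightarrow> h \<in> carrier G \<Longrightarrow>
    is_lift (F \<circ> F') (\<psi> (g \<otimes> h))"
  by (rule is_lift_comp[of F "\<psi> g" F' "\<psi> h"]) (simp_all add: mult)

lemma lift_inv:
  assumes "is_lift F (\<psi> g)" "g \<in> carrier G"
  shows "is_lift (inv_fun F) (\<psi> (inv g))"
proof -
  obtain F' where F': "is_lift F' (\<psi> (inv g))" using lift_exists assms(2) by blast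
  have "\<psi> g (\<psi> (inv g) z) = z" if "z \<in> circle" for z
    using mult[of g "inv g" z] assms(2) that one_apply by simp
  then show ?thesis by (rule is_lift_inv[OF assms(1) F'])
qed

lemma lift_one: "is_lift id (\<psi> \<one>)"
  unfolding is_lift_def using one_apply by (simp add: strict_mono_def continuous_on_id' id_def)

lemma line_group_lifts: "line_group (min \<tau> 1) lifts"
proof
  show "0 < min \<tau> 1" "min \<tau> 1 \<le> 1" using tau by auto
  show "line_diffeo (min \<tau> 1) F" if F: "F \<in> lifts" for F
  proof -
    obtain g where "g \<in> carrier G" "is_lift F (\<psi> g)" using F unfolding lifts_def by blast
    then show ?thesis using is_lift_line_diffeo[OF _ tau Diff_circleD(4,5,3,6)[OF diff]] by blast
  qed
  show "id \<in> lifts" unfolding lifts_def using lift_one by blast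
  show "F \<circ> F' \<in> lifts" if "F \<in> lifts" "F' \<in> lifts" for F F'
    using that lift_comp unfolding lifts_def by blast
  show "inv_fun F \<in> lifts" if "F \<in> lifts" for F
    using that lift_inv unfolding lifts_def by blast
qed

sublocale L: line_group "min \<tau> 1" lifts
  by (rule line_group_lifts)

lemma line_group_derived: "line_group (min \<tau> 1) ((commutator_group ^^ n) lifts)"
proof (induction n)
  case (Suc n)
  then show ?case using line_group.line_group_commutator_group by simp
qed (simp add: line_group_lifts)

lemma derived_subset: "(commutator_group ^^ n) lifts \<subseteq> lifts"
proof (induction n)
  case (Suc n)
  then show ?case using line_group.commutator_group_subset[OF line_group_derived, of n] by simp
qed simp

text \<open>A commutator of lifts is a lift of the commutator, whichever lifts are chosen. Hence
  relations in the derived groups of lifts descend to the derived series of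
  \<open>G\<close>.\<close>

lemma derived_lift:
  assumes "g \<in> (derived G ^^ n) (carrier G)"
  shows "\<exists>F\<in>(commutator_group ^^ n) lifts. is_lift F (\<psi> g)"
  using assms
proof (induction n arbitrary: g)
  case 0
  then have "g \<in> carrier G" by simp
  moreover from this obtain F where "is_lift F (\<psi> g)" using lift_exists by blast
  ultimately show ?case unfolding lifts_def by auto
next
  case (Suc n)
  interpret N: line_group "min \<tau> 1" "(commutator_group ^^ n) lifts" by (rule line_group_derived)
  interpret M: line_group "min \<tau> 1" "commutator_group ((commutator_group ^^ n) lifts)"
    by (rule N.line_group_commutator_group)
  have car: "(derived G ^^ n) (carrier G) \<subseteq> carrier G" by (rule exp_of_derived_in_carrier) simp
  then have dcar: "derived_set G ((derived G ^^ n) (carrier G)) \<subseteq> carrier G" by (rule derived_set_in_carrier)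
  have comm: "\<exists>F\<in>commutator_group ((commutator_group ^^ n) lifts). is_lift F (\<psi> h)"
    if h: "h \<in> derived_set G ((derived G ^^ n) (carrier G))" for h
  proof -
    obtain h1 h2 where h12: "h1 \<in> (derived G ^^ n) (carrier G)" "h2 \<in> (derived G ^^ n) (carrier G)"
      "h = h1 \<otimes> h2 \<otimes> inv h1 \<otimes> inv h2" using h by blast
    obtain F1 F2 where F: "F1 \<in> (commutator_group ^^ n) lifts" "is_lift F1 (\<psi> h1)"
      "F2 \<in> (commutator_group ^^ n) lifts" "is_lift F2 (\<psi> h2)"
      using Suc.IH[OF h12(1)] Suc.IH[OF h12(2)] by blast
    have hc: "h1 \<in> carrier G" "h2 \<in> carrier G" using h12 car by auto
    have "is_lift (F1 \<circ> F2 \<circ> inv_fun F1 \<circ> inv_fun F2) (\<psi> h)"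
      unfolding h12(3) by (intro lift_comp lift_inv F hc m_closed inv_closed)
    then show ?thesis using commutator_group_commutator[OF F(1,3)] by blast
  qed
  have "g \<in> generate G (derived_set G ((derived G ^^ n) (carrier G)))"
    using Suc.prems unfolding funpow.simps o_apply derived_def[of G "(derived G ^^ n) (carrier G)"] .
  then have "\<exists>F\<in>commutator_group ((commutator_group ^^ n) lifts). is_lift F (\<psi> g)"
  proof induction
    case one
    then show ?case using commutator_group_id lift_one by blast
  next
    case (incl h)
    then show ?case by (rule comm)
  next
    case (inv h)
    then obtain F where "F \<in> commutator_group ((commutator_group ^^ n) lifts)" "is_lift F (\<psi> h)"
      using comm by blast
    moreover have "h \<in> carrier G" using inv dcar by blast
    ultimately show ?case using M.inv_mem lift_inv by blast
  next
    case (eng h1 h2)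
    then have "h1 \<in> carrier G" "h2 \<in> carrier G" using generate_in_carrier[OF dcar] by auto
    then show ?case using eng.IH commutator_group_comp lift_comp by meson
  qed
  then show ?case by simp
qed

text \<open>
  If no nontrivial element of the derived group had a fixed point, the group would act freely on
  the line and hence be abelian by Hoelder's theorem.
\<close>

lemma derived_element_with_fixed_point:
  assumes "\<not> solvable G"
  obtains g h z where "g \<in> carrier G" "g \<noteq> \<one>" "h \<in> (commutator_group ^^ n) lifts" "is_lift h (\<psi> g)" "h z = z"
proof -
  interpret N: line_group "min \<tau> 1" "(commutator_group ^^ n) lifts" by (rule line_group_derived)
  have "\<exists>h\<in>(commutator_group ^^ n) lifts. (\<exists>z. h z = z) \<and> h \<noteq> id"
  proof (rule ccontr)
    assume "\<not> ?thesis"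
    then have free: "h = id" if "h \<in> (commutator_group ^^ n) lifts" "h z = z" for h z using that by blast
    interpret I: interval_group "(commutator_group ^^ n) lifts" UNIV
    proof
      show "\<exists>y\<in>UNIV. e (e' y) = y" if "e \<in> (commutator_group ^^ n) lifts" "e' \<in> (commutator_group ^^ n) lifts"
        "\<exists>y\<in>UNIV. e y = y" "\<exists>y\<in>UNIV. e' y = y" for e e'
        using free that by (metis id_apply)
    qed (use N.mono N.surj N.cont N.id_mem N.comp_mem N.inv_mem in auto)
    have comm: "a (b t) = b (a t)" if ab: "a \<in> (commutator_group ^^ n) lifts" "b \<in> (commutator_group ^^ n) lifts" for a b t
    proof -
      \<comment> \<open>Agreement at one point suffices: the quotient of \<open>a \<circ> b\<close>
        and \<open>b \<circ> a\<close> fixes \<open>s\<close>, so by freeness it is the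
        identity.\<close>
      obtain s where s: "a (b s) = b (a s)" using I.commute_mod_fixed[OF ab] by blast
      have "inv_fun (b \<circ> a) \<circ> (a \<circ> b) \<in> (commutator_group ^^ n) lifts"
        using ab N.comp_mem N.inv_mem by blast
      moreover have ba: "b \<circ> a \<in> (commutator_group ^^ n) lifts" using ab N.comp_mem by blast
      have "(inv_fun (b \<circ> a) \<circ> (a \<circ> b)) s = s" using N.inv_apply(1)[OF ba, of s] s by simp
      ultimately have "inv_fun (b \<circ> a) \<circ> (a \<circ> b) = id" by (rule free)
      then have "inv_fun (b \<circ> a) (a (b t)) = t" by (metis comp_apply id_apply)
      then show ?thesis using N.inv_apply(2)[OF ba, of "a (b t)"] by simp
    qed
    have car: "(derived G ^^ n) (carrier G) \<subseteq> carrier G" by (rule exp_of_derived_in_carrier) simp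
    have com: "g1 \<otimes> g2 = g2 \<otimes> g1" if g: "g1 \<in> (derived G ^^ n) (carrier G)" "g2 \<in> (derived G ^^ n) (carrier G)" for g1 g2
    proof -
      obtain F1 F2 where F: "F1 \<in> (commutator_group ^^ n) lifts" "is_lift F1 (\<psi> g1)"
        "F2 \<in> (commutator_group ^^ n) lifts" "is_lift F2 (\<psi> g2)"
        using derived_lift[OF g(1)] derived_lift[OF g(2)] by blast
      have gc: "g1 \<in> carrier G" "g2 \<in> carrier G" using g car by auto
      show ?thesis
      proof (rule faithful)
        fix z :: complex assume "z \<in> circle"
        then obtain t where t: "z = cis t" by (rule circle_cisE)
        have "\<psi> (g1 \<otimes> g2) z = cis (F1 (F2 t))" "\<psi> (g2 \<otimes> g1) z = cis (F2 (F1 t))"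
          using F(2,4) mult gc cis_in_circle unfolding is_lift_def t by simp_all
        then show "\<psi> (g1 \<otimes> g2) z = \<psi> (g2 \<otimes> g1) z" using comm[OF F(1,3)] by simp
      qed (use gc in auto)
    qed
    have "derived_set G ((derived G ^^ n) (carrier G)) \<subseteq> {\<one>}"
    proof
      fix c assume "c \<in> derived_set G ((derived G ^^ n) (carrier G))"
      then obtain g1 g2 where g: "g1 \<in> (derived G ^^ n) (carrier G)" "g2 \<in> (derived G ^^ n) (carrier G)"
        "c = g1 \<otimes> g2 \<otimes> inv g1 \<otimes> inv g2" by blast
      then have gc: "g1 \<in> carrier G" "g2 \<in> carrier G" using car by auto
      have "c = g2 \<otimes> g1 \<otimes> inv g1 \<otimes> inv g2" using g com by simp
      also have "\<dots> = \<one>" using gc by (simp add: m_assoc)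
      finally show "c \<in> {\<one>}" by simp
    qed
    then have "derived G ((derived G ^^ n) (carrier G)) \<subseteq> {\<one>}"
      unfolding derived_def using mono_generate[of _ "{\<one>}"] generate_one by blast
    moreover have "\<one> \<in> derived G ((derived G ^^ n) (carrier G))" unfolding derived_def by (rule generate.one)
    ultimately have "(derived G ^^ Suc n) (carrier G) = {\<one>}" by auto
    then show False using assms solvable_iff_trivial_derived_seq by blast
  qed
  then obtain h z where h: "h \<in> (commutator_group ^^ n) lifts" "h z = z" "h \<noteq> id" by blast
  then obtain g where g: "g \<in> carrier G" "is_lift h (\<psi> g)" using derived_subset unfolding lifts_def by blast
  \<comment> \<open>A lift of the identity is a translation; having a fixed point, \<open>h\<close>
    would then be \<open>id\<close>.\<close>
  have "g \<noteq> \<one>"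
  proof
    assume "g = \<one>"
    then obtain i :: int where i: "\<And>t. h t = id t + 2 * pi * i" using is_lift_unique[OF g(2)] lift_one by blast
    then have "i = 0" using h(2) by (metis id_apply add_cancel_right_right mult_eq_0_iff of_int_eq_0_iff pi_neq_zero zero_neq_numeral)
    then have "h = id" using i by (simp add: fun_eq_iff)
    then show False using h(3) by simp
  qed
  then show ?thesis using that g h by blast
qed

end

theorem proposition1p8:
  fixes \<tau> :: real
    and G1 :: "('a, 'm) monoid_scheme" and G2 :: "('b, 'n) monoid_scheme"
    and \<phi> :: "'a \<times> 'b \<Rightarrow> complex \<Rightarrow> complex"
  assumes "\<tau> > 0"
    and "group G1" and "\<not> solvable G1"
    and "group G2" and "\<not> solvable G2"
    and "C1_holder_circle_action \<tau> (G1 \<times>\<times> G2) \<phi>"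
  shows "admits_disjointly_supported_pair (G1 \<times>\<times> G2) circle \<phi>"
proof (rule ccontr)
  assume no_pair: "\<not> ?thesis"
  let ?G = "G1 \<times>\<times> G2"
  interpret G1: group G1 by fact
  interpret G2: group G2 by fact
  interpret G: group ?G by (rule DirProd_group) fact+
  have hom: "\<phi> \<in> hom ?G (Diff_circle \<tau>)" using assms(6) unfolding C1_holder_circle_action_def .
  have diff: "\<phi> g \<in> carrier (Diff_circle \<tau>)" if "g \<in> carrier ?G" for g
    using hom that by (rule hom_in_carrier)
  have mult: "\<phi> (g \<otimes>\<^bsub>?G\<^esub> h) z = \<phi> g (\<phi> h z)" if "g \<in> carrier ?G" "h \<in> carrier ?G" "z \<in> circle" for g h z
    using hom_mult[OF hom that(1,2)] Diff_circle_mult[OF diff[OF that(1)] diff[OF that(2)] that(3)] by simp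
  have overlap: "\<exists>z\<in>circle. \<phi> g z \<noteq> z \<and> \<phi> h z \<noteq> z"
    if "g \<in> carrier ?G" "h \<in> carrier ?G" "g \<noteq> \<one>\<^bsub>?G\<^esub>" "h \<noteq> \<one>\<^bsub>?G\<^esub>" for g h
    using no_pair that unfolding admits_disjointly_supported_pair_def open_support_def invariants_def by blast
  \<comment> \<open>A nontrivial element acting trivially has empty support, disjoint from itself,
    so it would form a disjointly supported pair with itself.\<close>
  have faithful: "g = h" if gh: "g \<in> carrier ?G" "h \<in> carrier ?G" "\<And>z. z \<in> circle \<Longrightarrow> \<phi> g z = \<phi> h z" for g h
  proof (rule ccontr)
    assume "g \<noteq> h"
    define c where "c = inv\<^bsub>?G\<^esub> h \<otimes>\<^bsub>?G\<^esub> g"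
    have c: "c \<in> carrier ?G" unfolding c_def using gh by blast
    have "h \<otimes>\<^bsub>?G\<^esub> c = g" unfolding c_def by (metis G.m_assoc G.inv_closed G.r_inv G.l_one gh(1,2))
    then have "c \<noteq> \<one>\<^bsub>?G\<^esub>" using \<open>g \<noteq> h\<close> gh G.r_one by metis
    then obtain z where z: "z \<in> circle" "\<phi> c z \<noteq> z" using overlap[OF c c] by blast
    have "\<phi> c z \<in> circle" using Diff_circleD(2)[OF diff[OF c]] z by blast
    moreover have "\<phi> h (\<phi> c z) = \<phi> h z" using mult[OF gh(2) c z(1)] \<open>h \<otimes>\<^bsub>?G\<^esub> c = g\<close> gh(3)[OF z(1)] by simp
    ultimately show False using inj_onD[OF Diff_circleD(3)[OF diff[OF gh(2)]]] z by blast
  qed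
  define \<psi>1 where "\<psi>1 = (\<lambda>g. \<phi> (g, \<one>\<^bsub>G2\<^esub>))"
  define \<psi>2 where "\<psi>2 = (\<lambda>g. \<phi> (\<one>\<^bsub>G1\<^esub>, g))"
  have in1: "(g, \<one>\<^bsub>G2\<^esub>) \<in> carrier ?G" if "g \<in> carrier G1" for g using that by simp
  have in2: "(\<one>\<^bsub>G1\<^esub>, g) \<in> carrier ?G" if "g \<in> carrier G2" for g using that by simp
  interpret A: faithful_circle_action G1 \<tau> \<psi>1
  proof
    show "\<psi>1 (g \<otimes>\<^bsub>G1\<^esub> h) z = \<psi>1 g (\<psi>1 h z)" if "g \<in> carrier G1" "h \<in> carrier G1" "z \<in> circle" for g h z
      using mult[OF in1[OF that(1)] in1[OF that(2)] that(3)] unfolding \<psi>1_def by simp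
    show "g = h" if "g \<in> carrier G1" "h \<in> carrier G1" "\<And>z. z \<in> circle \<Longrightarrow> \<psi>1 g z = \<psi>1 h z" for g h
      using faithful[OF in1[OF that(1)] in1[OF that(2)]] that(3) unfolding \<psi>1_def by simp
  qed (use assms(1) diff in1 in \<open>auto simp: \<psi>1_def\<close>)
  interpret B: faithful_circle_action G2 \<tau> \<psi>2
  proof
    show "\<psi>2 (g \<otimes>\<^bsub>G2\<^esub> h) z = \<psi>2 g (\<psi>2 h z)" if "g \<in> carrier G2" "h \<in> carrier G2" "z \<in> circle" for g h z
      using mult[OF in2[OF that(1)] in2[OF that(2)] that(3)] unfolding \<psi>2_def by simp
    show "g = h" if "g \<in> carrier G2" "h \<in> carrier G2" "\<And>z. z \<in> circle \<Longrightarrow> \<psi>2 g z = \<psi>2 h z" for g h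
      using faithful[OF in2[OF that(1)] in2[OF that(2)]] that(3) unfolding \<psi>2_def by simp
  qed (use assms(1) diff in2 in \<open>auto simp: \<psi>2_def\<close>)
  interpret C: commuting_line_groups "min \<tau> 1" A.lifts B.lifts
  proof
    fix f k t assume "f \<in> A.lifts" "k \<in> B.lifts"
    then obtain g h where gh: "g \<in> carrier G1" "is_lift f (\<psi>1 g)" "h \<in> carrier G2" "is_lift k (\<psi>2 h)"
      unfolding A.lifts_def B.lifts_def by blast
    show "f (k t) = k (f t)"
    proof (rule is_lift_commute[OF gh(2,4)])
      fix z :: complex assume z: "z \<in> circle"
      show "\<psi>1 g (\<psi>2 h z) = \<psi>2 h (\<psi>1 g z)"
        using mult[OF in1[OF gh(1)] in2[OF gh(3)] z] mult[OF in2[OF gh(3)] in1[OF gh(1)] z] gh(1,3)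
        unfolding \<psi>1_def \<psi>2_def by simp
    qed
  qed
  define \<sigma> where "\<sigma> = min \<tau> 1"
  have "\<sigma> > 0" unfolding \<sigma>_def using assms(1) by simp
  \<comment> \<open>Then \<open>\<sigma>\<^sup>2 * D \<ge> 1\<close>, which is more than the
    condition on \<open>D\<close> demands.\<close>
  obtain D :: nat where D: "1 / \<sigma>\<^sup>2 \<le> D" using real_arch_simple by blast
  have "1 \<le> \<sigma>\<^sup>2 * D" using D \<open>\<sigma> > 0\<close> by (simp add: field_simps)
  then have D': "1 \<le> \<sigma> * (1 + \<sigma> * real D)" using \<open>\<sigma> > 0\<close> by (simp add: algebra_simps power2_eq_square)
  obtain g F y where g: "g \<in> carrier G1" "g \<noteq> \<one>\<^bsub>G1\<^esub>" "F \<in> (commutator_group ^^ (D + 2)) A.lifts"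
    "is_lift F (\<psi>1 g)" "F y = y" by (rule A.derived_element_with_fixed_point[OF assms(3)])
  obtain h H w where h: "h \<in> carrier G2" "h \<noteq> \<one>\<^bsub>G2\<^esub>" "H \<in> (commutator_group ^^ (D + 2)) B.lifts"
    "is_lift H (\<psi>2 h)" "H w = w" by (rule B.derived_element_with_fixed_point[OF assms(5)])
  obtain z where z: "z \<in> circle" "\<psi>1 g z \<noteq> z" "\<psi>2 h z \<noteq> z"
    using overlap[OF in1[OF g(1)] in2[OF h(1)]] g(2) h(2) unfolding \<psi>1_def \<psi>2_def by auto
  obtain x where x: "z = cis x" using circle_cisE[OF z(1)] .
  have "F x \<noteq> x" "H x \<noteq> x" using z(2,3) g(4) h(4) unfolding is_lift_def x by metis+
  then show False
    using C.overlapping_supports_contradiction[OF D'[unfolded \<sigma>_def] g(3,5) _ h(3,5)] by blast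
qed

end
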